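(* Let $S\subset\mathbb{R}^2$ be a measurable set all of whose horizontal cross-sections $S_y=\{x:(x,y)\in S\}$ and vertical cross-sections $S^x=\{y:(x,y)\in S\}$ have finite measure, with $\sup_y|S_y|<\infty$. Let $\mathbf{H}\chi_S=\chi_S$ in the spectral sense, and suppose that $\partial S$ is contained in a locally finite countable union of lines with finitely many directions. Then $S$ is, up to a null set, a countable union of parallel strips of one positive slope; that is, up to a null set, $S=\{(x,y):\alpha y-\beta x\in E\}$ for some $\alpha,\beta>0$ and some $E\subset\mathbb{R}$ which is a countable union of intervals of finite total length.
   Context: $\mathbf{H}$ is the double Hilbert transform, the Fourier multiplier with symbol $-1$ on the open first and third quadrants and $+1$ on the open second and fourth quadrants. "$\mathbf{H}\chi_S=\chi_S$ in the spectral sense" means that the tempered distribution $\widehat{\chi_S}$ is supported in $Q_{2,4}\cup\{0\}$, where $Q_{2,4}$ is the union of the open second and fourth quadrants of the frequency plane. A union of lines is locally finite if every disc meets only finitely many of the lines. $\partial S$ is the topological boundary. *)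

theory Defs
  imports "HOL-Analysis.Analysis"
begin

section \<open>Distributions and their Fourier transforms\<close>

primrec C_k :: "nat \<Rightarrow> ('a::euclidean_space \<Rightarrow> 'b::real_normed_vector) \<Rightarrow> bool" where
  "C_k 0 f \<longleftrightarrow> continuous_on UNIV f"
| "C_k (Suc k) f \<longleftrightarrow>
     (\<forall>x. f differentiable (at x)) \<and> (\<forall>v. C_k k (\<lambda>x. frechet_derivative f (at x) v))"

definition smooth :: "('a::euclidean_space \<Rightarrow> 'b::real_normed_vector) \<Rightarrow> bool" where
  "smooth f \<longleftrightarrow> (\<forall>k. C_k k f)"

definition test_function_on :: "'a::euclidean_space set \<Rightarrow> ('a \<Rightarrow> complex) \<Rightarrow> bool" where
  "test_function_on U \<phi> \<longleftrightarrow>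
     smooth \<phi> \<and> (\<exists>K. compact K \<and> K \<subseteq> U \<and> (\<forall>x. x \<notin> K \<longrightarrow> \<phi> x = 0))"

definition fourier :: "('a::euclidean_space \<Rightarrow> complex) \<Rightarrow> 'a \<Rightarrow> complex" where
  "fourier \<phi> \<xi> = (LINT x|lborel. cis (- 2 * pi * (x \<bullet> \<xi>)) * \<phi> x)"

text \<open>
  A distribution is represented by its action on test functions. The functionals below are
  total functions, but their values are meaningful only on Schwartz functions, and
  they are only ever evaluated there: the support is determined by compactly supported
  smooth functions, whose Fourier transforms are Schwartz functions.
\<close>

definition regular_dist :: "('a::euclidean_space \<Rightarrow> complex) \<Rightarrow> ('a \<Rightarrow> complex) \<Rightarrow> complex" where
  "regular_dist f \<phi> = (LINT x|lebesgue. f x * \<phi> x)"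

definition fourier_dist ::
    "(('a::euclidean_space \<Rightarrow> complex) \<Rightarrow> complex) \<Rightarrow> ('a \<Rightarrow> complex) \<Rightarrow> complex" where
  "fourier_dist u \<phi> = u (fourier \<phi>)"

definition dist_support :: "(('a::euclidean_space \<Rightarrow> complex) \<Rightarrow> complex) \<Rightarrow> 'a set" where
  "dist_support u = - \<Union>{U. open U \<and> (\<forall>\<phi>. test_function_on U \<phi> \<longrightarrow> u \<phi> = 0)}"

definition Q24 :: "(real \<times> real) set" where
  "Q24 = {(\<xi>, \<eta>). \<xi> < 0 \<and> 0 < \<eta>} \<union> {(\<xi>, \<eta>). 0 < \<xi> \<and> \<eta> < 0}"

text \<open>
  The double Hilbert transform \<open>H\<close> is the Fourier multiplier with symbol \<open>+1\<close> on
  \<open>Q24\<close> and \<open>-1\<close> on the open first and third quadrants. The identity \<open>H \<chi>\<^sub>S = \<chi>\<^sub>S\<close> is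
  understood spectrally, because \<open>\<chi>\<^sub>S\<close> need not be square integrable.
\<close>

definition double_Hilbert_fixed :: "(real \<times> real) set \<Rightarrow> bool" where
  "double_Hilbert_fixed S \<longleftrightarrow>
     dist_support (fourier_dist (regular_dist (indicator S))) \<subseteq> Q24 \<union> {0}"


section \<open>Plane geometry\<close>

definition h_section :: "(real \<times> real) set \<Rightarrow> real \<Rightarrow> real set" where
  "h_section S y = {x. (x, y) \<in> S}"

definition v_section :: "(real \<times> real) set \<Rightarrow> real \<Rightarrow> real set" where
  "v_section S x = {y. (x, y) \<in> S}"

definition is_line :: "(real \<times> real) set \<Rightarrow> bool" where
  "is_line l \<longleftrightarrow> (\<exists>p v. v \<noteq> 0 \<and> l = {p + t *\<^sub>R v | t. True})"

text \<open>The direction of a line is the linear subspace parallel to it.\<close>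

definition line_direction :: "(real \<times> real) set \<Rightarrow> (real \<times> real) set" where
  "line_direction l = {p - q | p q. p \<in> l \<and> q \<in> l}"

definition locally_finite_lines :: "(real \<times> real) set set \<Rightarrow> bool" where
  "locally_finite_lines L \<longleftrightarrow> (\<forall>c r. finite {l \<in> L. l \<inter> cball c r \<noteq> {}})"

end

theory Submission
  imports Defs
begin

text \<open>
  Up to a null set, \<open>S\<close> is its interior; let \<open>f\<close> be its indicator. Near every point \<open>p\<close>, \<open>f\<close> agrees with
  a function \<open>f\<^sub>p\<close> that is constant on the sectors cut out by finitely many lines through \<open>p\<close>.
  Blowing up at \<open>p\<close>, the Fourier transform of \<open>f\<^sub>p\<close> vanishes on the open first quadrant. An iterated
  difference of \<open>f\<^sub>p\<close>, one step along each direction of the lines, has compact support, so its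
  transform is analytic and the difference vanishes. Locally, hence globally, the iterated
  differences of \<open>f\<close> are therefore 0: morally \<open>f\<close> is a sum of functions, each invariant along one direction.

  As \<open>f\<close> has horizontal sections of bounded measure, the summand invariant along \<open>v\<close> is recovered as
  the limit of \<open>f\<close> along the lines of direction \<open>v\<close>, and it is again zero-one valued. Two nonzero summands
  would overlap somewhere, where \<open>f\<close> would exceed 1. So \<open>f\<close> is invariant along a single \<open>v\<close>. Finite
  sections exclude the axis directions, and a negative slope would put the spectrum into the first
  and third quadrants.
\<close>


section \<open>A smooth bump and its Fourier transform\<close>

text \<open>The indicator is merely bounded, so its transform is only a distribution. It is tested
  against one explicit family throughout: transforms of bumps on small boxes in the open first
  quadrant. These wave packets are integrable, and the resulting condition survives translation,
  dilation and bounded pointwise limits, which is what carries it to a blow-up. A second obstacle is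
  that the summands of the decomposition are not given and have to be found without any smoothness.
  The bound on horizontal sections controls them: along almost every line of a direction in
  question, a difference by a step along that line vanishes off a set whose measure is bounded
  uniformly in the step, and this forces an essential limit along the line. Horizontal boundary
  lines contribute a direction of their own, whose limit is 0. That the remainder after subtracting
  a limit is again nonnegative is read off from its limits along the other directions, so that
  disjointness of two invariant sets can replace a count of overlaps.\<close>

definition flat :: "nat \<Rightarrow> real \<Rightarrow> real" where
  "flat n x = (if 0 < x then inverse x ^ n * exp (- inverse x) else 0)"

lemma flat_tendsto_0: "((\<lambda>x. inverse x ^ n * exp (- inverse x)) \<longlongrightarrow> 0) (at_right (0::real))"
proof -
  have "((\<lambda>x. inverse x ^ n / exp (inverse x)) \<longlongrightarrow> 0) (at_right (0::real))"
    by (rule filterlim_compose[OF tendsto_power_div_exp_0 filterlim_inverse_at_top_right])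
  then show ?thesis by (simp add: exp_minus divide_inverse)
qed

lemma flat_has_real_derivative:
  "(flat n has_real_derivative (flat (n + 2) x - real n * flat (n + 1) x)) (at x)"
proof (cases x "0::real" rule: linorder_cases)
  case less
  have "(flat n has_real_derivative 0) (at x)"
    by (rule has_field_derivative_transform_within_open[where f = "\<lambda>_. 0" and S = "{..<0}"])
       (use less in \<open>auto simp: flat_def\<close>)
  with less show ?thesis by (simp add: flat_def)
next
  case equal
  have "((\<lambda>h. flat n h / h) \<longlongrightarrow> 0) (at 0)"
  proof (rule filterlim_split_at)
    show "((\<lambda>h. flat n h / h) \<longlongrightarrow> 0) (at_left 0)"
      by (rule tendsto_eventually) (auto simp: eventually_at_filter flat_def)
    have "((\<lambda>x. inverse x ^ (n + 1) * exp (- inverse x)) \<longlongrightarrow> 0) (at_right (0::real))"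
      by (rule flat_tendsto_0)
    then show "((\<lambda>h. flat n h / h) \<longlongrightarrow> 0) (at_right 0)"
      by (rule Lim_transform_eventually) (auto simp: eventually_at_filter flat_def field_simps)
  qed
  then show ?thesis
    using equal by (simp add: has_field_derivative_iff flat_def)
next
  case greater
  have "((\<lambda>x. inverse x ^ n * exp (- inverse x)) has_real_derivative
     (flat (n + 2) x - real n * flat (n + 1) x)) (at x)"
  proof -
    have "((\<lambda>x. inverse x ^ n) has_real_derivative - real n * inverse x ^ (n + 1)) (at x)"
    proof (rule DERIV_cong[OF DERIV_power[OF DERIV_inverse'[OF DERIV_ident]]])
      show "of_nat n * (- (inverse x * 1 * inverse x) * inverse x ^ (n - Suc 0)) = - real n * inverse x ^ (n + 1)"
        by (cases n) (simp_all add: algebra_simps)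
    qed (use greater in simp)
    moreover have "((\<lambda>x. exp (- inverse x)) has_real_derivative inverse x ^ 2 * exp (- inverse x)) (at x)"
      using greater by (auto intro!: derivative_eq_intros simp: power2_eq_square)
    ultimately show ?thesis
      by (rule DERIV_cong[OF DERIV_mult]) (use greater in \<open>simp add: flat_def algebra_simps power_add power2_eq_square\<close>)
  qed
  then show ?thesis
    by (rule has_field_derivative_transform_within_open[where S = "{0<..}"])
       (use greater in \<open>auto simp: flat_def\<close>)
qed

text \<open>An algebra that contains the directional derivatives of its members, since the
  derivative of \<open>flat n\<close> combines \<open>flat (n + 1)\<close> and
  \<open>flat (n + 2)\<close>. Smoothness of every order then follows by one induction, and the
  affine argument \<open>c + z \<bullet> u\<close> serves the line and the plane alike.\<close>

inductive flat_generated :: "('a::euclidean_space \<Rightarrow> complex) \<Rightarrow> bool" where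
  flat: "flat_generated (\<lambda>z. of_real (flat n (c + z \<bullet> u)))"
| const: "flat_generated (\<lambda>z. k)"
| add: "flat_generated f \<Longrightarrow> flat_generated g \<Longrightarrow> flat_generated (\<lambda>z. f z + g z)"
| mult: "flat_generated f \<Longrightarrow> flat_generated g \<Longrightarrow> flat_generated (\<lambda>z. f z * g z)"

lemma flat_generated_derivative:
  assumes "flat_generated f"
  shows "\<exists>f'. (\<forall>z. (f has_derivative f' z) (at z)) \<and> (\<forall>v. flat_generated (\<lambda>z. f' z v))"
  using assms
proof induction
  case (flat n c u)
  let ?d = "\<lambda>z v. complex_of_real ((flat (n + 2) (c + z \<bullet> u) - real n * flat (n + 1) (c + z \<bullet> u)) * (v \<bullet> u))"
  have "((\<lambda>z. complex_of_real (flat n (c + z \<bullet> u))) has_derivative ?d z) (at z)" for z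
  proof (rule has_derivative_of_real)
    have "((\<lambda>z. c + z \<bullet> u) has_derivative (\<lambda>v. v \<bullet> u)) (at z)"
      by (auto intro!: derivative_eq_intros)
    from has_derivative_compose[OF this flat_has_real_derivative[unfolded has_field_derivative_def]]
    show "((\<lambda>z. flat n (c + z \<bullet> u)) has_derivative
        (\<lambda>v. (flat (n + 2) (c + z \<bullet> u) - real n * flat (n + 1) (c + z \<bullet> u)) * (v \<bullet> u))) (at z)"
      by simp
  qed
  moreover have "flat_generated (\<lambda>z. ?d z v)" for v
  proof -
    have "flat_generated (\<lambda>z. (of_real (flat (n + 2) (c + z \<bullet> u)) + (- of_nat n) * of_real (flat (n + 1) (c + z \<bullet> u))) * of_real (v \<bullet> u))"
      by (intro flat_generated.intros)
    then show ?thesis by (simp add: algebra_simps)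
  qed
  ultimately show ?case by (intro exI[of _ ?d]) auto
next
  case (const k)
  show ?case by (intro exI[of _ "\<lambda>_ _. 0"]) (auto intro: flat_generated.const)
next
  case (add f g)
  then obtain f' g' where "\<And>z. (f has_derivative f' z) (at z)" "\<And>v. flat_generated (\<lambda>z. f' z v)"
    "\<And>z. (g has_derivative g' z) (at z)" "\<And>v. flat_generated (\<lambda>z. g' z v)" by blast
  then show ?case
    by (intro exI[of _ "\<lambda>z v. f' z v + g' z v"]) (auto intro!: has_derivative_add flat_generated.add)
next
  case (mult f g)
  then obtain f' g' where "\<And>z. (f has_derivative f' z) (at z)" "\<And>v. flat_generated (\<lambda>z. f' z v)"
    "\<And>z. (g has_derivative g' z) (at z)" "\<And>v. flat_generated (\<lambda>z. g' z v)" by blast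
  with mult.hyps show ?case
    by (intro exI[of _ "\<lambda>z v. f z * g' z v + f' z v * g z"])
       (auto intro!: has_derivative_mult flat_generated.add flat_generated.mult)
qed

lemma flat_generated_continuous: "flat_generated f \<Longrightarrow> continuous_on A f"
  using flat_generated_derivative[of f] has_derivative_continuous
  by (metis continuous_at_imp_continuous_on)

lemma flat_generated_smooth:
  assumes "flat_generated f"
  shows "smooth f"
proof -
  have "C_k k f" if "flat_generated f" for k and f :: "'a \<Rightarrow> complex"
    using that
  proof (induction k arbitrary: f)
    case 0
    then show ?case by (simp add: flat_generated_continuous)
  next
    case (Suc k)
    obtain f' where f': "\<And>z. (f has_derivative f' z) (at z)" "\<And>v. flat_generated (\<lambda>z. f' z v)"
      using flat_generated_derivative[OF Suc.prems] by blast
    have "frechet_derivative f (at z) = f' z" for z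
      using frechet_derivative_at[OF f'(1)] by simp
    with f' Suc.IH show ?case by (auto simp: differentiable_def)
  qed
  with assms show ?thesis by (simp add: smooth_def)
qed

definition bump :: "real \<Rightarrow> real" where
  "bump x = flat 0 (1 + x) * flat 0 (1 - x)"

lemma bump_eq_0: "1 \<le> \<bar>x\<bar> \<Longrightarrow> bump x = 0"
  by (auto simp: bump_def flat_def)

lemma bump_minus: "bump (- x) = bump x"
  by (simp add: bump_def mult.commute)

lemma flat_generated_bump: "flat_generated (\<lambda>z. of_real (bump (c + z \<bullet> u)))"
proof -
  have "flat_generated (\<lambda>z. of_real (flat 0 ((1 + c) + z \<bullet> u)) * of_real (flat 0 ((1 - c) + z \<bullet> (- u))))"
    by (intro flat_generated.intros)
  then show ?thesis by (simp add: bump_def algebra_simps)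
qed

lemma bump_bounds: "0 \<le> bump x" "bump x \<le> 1"
  by (auto simp: bump_def flat_def intro!: mult_le_one)

lemma continuous_bump: "continuous_on A (\<lambda>x. complex_of_real (bump x))"
  using flat_generated_continuous[OF flat_generated_bump[of 0 "1::real"]] by simp

lemma bump_borel [measurable]: "bump \<in> borel_measurable borel"
proof -
  have "(\<lambda>x. Re (complex_of_real (bump x))) \<in> borel_measurable borel"
    by (intro borel_measurable_continuous_onI continuous_on_Re continuous_bump)
  then show ?thesis by simp
qed

lemma bump_integrable: "integrable lborel bump"
proof (rule Bochner_Integration.integrable_bound)
  show "integrable lborel (indicator {-1..1} :: real \<Rightarrow> real)" by simp
  show "AE x in lborel. norm (bump x) \<le> norm (indicator {-1..1} x :: real)"
    using bump_eq_0 bump_bounds by (intro AE_I2) (auto simp: indicator_def)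
qed simp

lemma bump_integral_pos: "0 < (LINT x|lborel. bump x)"
proof -
  have "(LINT x|lborel. bump x) \<noteq> 0"
  proof
    assume "(LINT x|lborel. bump x) = 0"
    then have "AE x in lborel. bump x = 0"
      using integral_nonneg_eq_0_iff_AE[OF bump_integrable] bump_bounds by auto
    then have "AE x in lborel. x \<notin> {-1<..<1::real}"
      by eventually_elim (auto simp: bump_def flat_def split: if_splits)
    then have "emeasure lborel {-1<..<1::real} = 0"
      using AE_iff_null_sets[of "{-1<..<1::real}" lborel] by (simp add: null_sets_def)
    then show False by simp
  qed
  moreover have "0 \<le> (LINT x|lborel. bump x)"
    using bump_bounds by (intro integral_nonneg_AE) auto
  ultimately show ?thesis by simp
qed

abbreviation bump_hat :: "real \<Rightarrow> complex" where
  "bump_hat \<equiv> fourier (\<lambda>\<xi>. complex_of_real (bump \<xi>))"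

text \<open>The normalisation gives the value 1 at 0: \<open>bump_kernel (\<epsilon> * x)\<close> is
  a cutoff that tends to 1 as \<open>\<epsilon>\<close> tends to 0 and has its spectrum in an
  interval of half-width \<open>\<epsilon>\<close>.\<close>

definition bump_kernel :: "real \<Rightarrow> complex" where
  "bump_kernel x = bump_hat x / of_real (LINT x|lborel. bump x)"

lemma kernel_integrand_integrable: "integrable lborel (\<lambda>\<xi>. cis (c * \<xi>) * complex_of_real (bump \<xi>))"
proof (rule Bochner_Integration.integrable_bound[OF bump_integrable])
  have [measurable]: "(\<lambda>\<xi>. cis (c * \<xi>)) \<in> borel_measurable borel"
    by (intro borel_measurable_continuous_onI continuous_intros)
  show "(\<lambda>\<xi>. cis (c * \<xi>) * complex_of_real (bump \<xi>)) \<in> borel_measurable lborel" by simp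
qed (use bump_bounds in \<open>auto simp: norm_mult\<close>)

lemma kernel_0: "bump_kernel 0 = 1"
proof -
  have "(LINT x|lborel. complex_of_real (bump x)) = of_real (LINT x|lborel. bump x)"
    by (rule integral_complex_of_real)
  with bump_integral_pos show ?thesis by (simp add: bump_kernel_def fourier_def)
qed

lemma norm_fourier_bump: "norm (bump_hat x) \<le> (LINT x|lborel. bump x)"
proof -
  have "norm (bump_hat x) \<le> (LINT \<xi>|lborel. norm (cis (- 2 * pi * (\<xi> \<bullet> x)) * complex_of_real (bump \<xi>)))"
    unfolding fourier_def by (rule integral_norm_bound)
  then show ?thesis using bump_bounds by (simp add: norm_mult)
qed

lemma norm_kernel_le_1: "norm (bump_kernel x) \<le> 1"
  using norm_fourier_bump[of x] bump_integral_pos by (simp add: bump_kernel_def norm_divide)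

lemma continuous_kernel: "continuous_on A bump_kernel"
proof -
  have "isCont bump_kernel x" for x
    unfolding continuous_at_sequentially comp_def
  proof (intro allI impI)
    fix X assume X: "X \<longlonglongrightarrow> x"
    have "(\<lambda>n. bump_hat (X n)) \<longlonglongrightarrow> bump_hat x"
      unfolding fourier_def
    proof (rule integral_dominated_convergence[where w = bump])
      show "AE \<xi> in lborel. (\<lambda>n. cis (- 2 * pi * (\<xi> \<bullet> X n)) * complex_of_real (bump \<xi>)) \<longlonglongrightarrow> cis (- 2 * pi * (\<xi> \<bullet> x)) * complex_of_real (bump \<xi>)"
        using X unfolding cis_conv_exp by (intro AE_I2 tendsto_intros)
      show "(\<lambda>\<xi>. cis (- 2 * pi * (\<xi> \<bullet> x)) * complex_of_real (bump \<xi>)) \<in> borel_measurable lborel" for x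
        using borel_measurable_integrable[OF kernel_integrand_integrable[of "- 2 * pi * x"]] by (simp add: mult_ac)
      then show "(\<lambda>\<xi>. cis (- 2 * pi * (\<xi> \<bullet> X n)) * complex_of_real (bump \<xi>)) \<in> borel_measurable lborel" for n .
    qed (use bump_integrable bump_bounds in \<open>auto simp: norm_mult\<close>)
    then show "(\<lambda>n. bump_kernel (X n)) \<longlonglongrightarrow> bump_kernel x"
      unfolding bump_kernel_def using bump_integral_pos by (intro tendsto_divide tendsto_const) auto
  qed
  then show ?thesis by (simp add: continuous_at_imp_continuous_on)
qed

lemma kernel_borel [measurable]: "bump_kernel \<in> borel_measurable borel"
  by (intro borel_measurable_continuous_onI continuous_kernel)

text \<open>The bump is even, so its transform is real. Squares of the kernel are therefore
  nonnegative, and it is these that \<open>negative_slope_null\<close> integrates.\<close>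

lemma cnj_kernel: "cnj (bump_kernel x) = bump_kernel x"
proof -
  have "cnj (bump_hat x) = (LINT \<xi>|lborel. cis (2 * pi * (\<xi> * x)) * complex_of_real (bump \<xi>))"
    unfolding fourier_def
    by (rule trans[OF Bochner_Integration.integral_cnj[symmetric]], rule Bochner_Integration.integral_cong) (simp_all add: cis_cnj)
  also have "\<dots> = bump_hat x"
    unfolding fourier_def
    using lborel_integral_real_affine[of "-1" "\<lambda>\<xi>. cis (2 * pi * (\<xi> * x)) * complex_of_real (bump \<xi>)" 0]
    by (simp add: bump_minus)
  finally show ?thesis by (simp add: bump_kernel_def)
qed

text \<open>Two integrations by parts, done at once with the antiderivative
  \<open>(w \<beta> - \<beta>') e\<^bsup>w\<xi>\<^esup>\<close> of \<open>(w\<^sup>2 \<beta> - \<beta>'') e\<^bsup>w\<xi>\<^esup>\<close>.\<close>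

lemma kernel_decay_sq: "\<exists>M. \<forall>x. x\<^sup>2 * norm (bump_hat x) \<le> M"
proof -
  define \<beta> where "\<beta> \<xi> = complex_of_real (bump \<xi>)" for \<xi>
  have "flat_generated \<beta>"
    using flat_generated_bump[of 0 "1::real"] by (simp add: \<beta>_def[abs_def])
  then obtain d1 where d1: "\<And>z. (\<beta> has_derivative d1 z) (at z)" "\<And>v. flat_generated (\<lambda>z. d1 z v)"
    using flat_generated_derivative by blast
  define \<beta>1 where "\<beta>1 z = d1 z 1" for z
  have f1: "flat_generated \<beta>1" using d1(2)[of 1] by (simp add: \<beta>1_def[abs_def])
  have v1: "(\<beta> has_vector_derivative \<beta>1 z) (at z)" for z
  proof -
    have "d1 z = (\<lambda>h. h *\<^sub>R d1 z 1)"
    proof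
      fix h :: real
      show "d1 z h = h *\<^sub>R d1 z 1"
        using linear_scale[OF has_derivative_linear[OF d1(1)], of z h 1] by simp
    qed
    from has_derivative_eq_rhs[OF d1(1) this] show ?thesis
      by (simp add: has_vector_derivative_def \<beta>1_def)
  qed
  obtain d2 where d2: "\<And>z. (\<beta>1 has_derivative d2 z) (at z)" "\<And>v. flat_generated (\<lambda>z. d2 z v)"
    using flat_generated_derivative[OF f1] by blast
  define \<beta>2 where "\<beta>2 z = d2 z 1" for z
  have f2: "flat_generated \<beta>2" using d2(2)[of 1] by (simp add: \<beta>2_def[abs_def])
  have v2: "(\<beta>1 has_vector_derivative \<beta>2 z) (at z)" for z
  proof -
    have "d2 z = (\<lambda>h. h *\<^sub>R d2 z 1)"
    proof
      fix h :: real
      show "d2 z h = h *\<^sub>R d2 z 1"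
        using linear_scale[OF has_derivative_linear[OF d2(1)], of z h 1] by simp
    qed
    from has_derivative_eq_rhs[OF d2(1) this] show ?thesis
      by (simp add: has_vector_derivative_def \<beta>2_def)
  qed
  have cont: "continuous_on A \<beta>" "continuous_on A \<beta>1" "continuous_on A \<beta>2" for A
    using f1 f2 \<open>flat_generated \<beta>\<close> by (auto intro: flat_generated_continuous)
  have end0: "\<beta> z = 0" "\<beta>1 z = 0" if "\<bar>z\<bar> > 1" for z
  proof -
    show "\<beta> z = 0" using that by (simp add: \<beta>_def bump_eq_0)
    have "((\<lambda>_. 0) has_vector_derivative 0) (at z)" by simp
    then have "(\<beta> has_vector_derivative 0) (at z)"
      by (rule has_vector_derivative_transform_within_open[where S = "{z. \<bar>z\<bar> > 1}"])
         (use that in \<open>auto simp: \<beta>_def bump_eq_0 intro!: open_Collect_less continuous_intros\<close>)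
    with v1[of z] show "\<beta>1 z = 0" by (rule vector_derivative_unique_at)
  qed
  have "bounded (\<beta>2 ` {-2..2})"
    by (intro compact_imp_bounded compact_continuous_image cont compact_Icc)
  then obtain M where M: "\<And>z. z \<in> {-2..2} \<Longrightarrow> norm (\<beta>2 z) \<le> M"
    unfolding bounded_iff by (meson imageI)
  have "x\<^sup>2 * norm (bump_hat x) \<le> 4 * M" for x
  proof -
    define w where "w = \<i> * complex_of_real (- 2 * pi * x)"
    define E where "E \<xi> = exp (w * of_real \<xi>)" for \<xi> :: real
    have nE: "norm (E \<xi>) = 1" for \<xi>
      by (simp add: E_def w_def norm_exp_eq_Re)
    have E: "cis (- 2 * pi * (\<xi> \<bullet> x)) = E \<xi>" for \<xi>
      by (simp add: E_def w_def cis_conv_exp mult_ac)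
    have dE: "(E has_vector_derivative w * E \<xi>) (at \<xi> within A)" for \<xi> A
    proof -
      have "((\<lambda>z. exp (w * z)) has_field_derivative w * E \<xi>) (at (of_real \<xi>))"
        by (auto intro!: derivative_eq_intros simp: E_def)
      from has_vector_derivative_real_field[OF this] show ?thesis
        by (simp add: E_def[abs_def] has_vector_derivative_at_within)
    qed
    have cE: "continuous_on A E" for A unfolding E_def by (intro continuous_intros)
    \<comment> \<open>The interval exceeds the support \<open>[-1, 1]\<close>, so
      \<open>\<beta>\<close> and \<open>\<beta>1\<close> vanish at both endpoints and no boundary
      term survives.\<close>
    have FTC: "has_bochner_integral lborel (\<lambda>\<xi>. indicator {-2..2} \<xi> *\<^sub>R ((w\<^sup>2 * \<beta> \<xi> - \<beta>2 \<xi>) * E \<xi>))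
       ((w * \<beta> 2 - \<beta>1 2) * E 2 - (w * \<beta> (-2) - \<beta>1 (-2)) * E (-2))"
    proof (rule has_bochner_integral_FTC_Icc)
      fix \<xi> :: real
      show "((\<lambda>\<xi>. (w * \<beta> \<xi> - \<beta>1 \<xi>) * E \<xi>) has_vector_derivative (w\<^sup>2 * \<beta> \<xi> - \<beta>2 \<xi>) * E \<xi>) (at \<xi> within {-2..2})"
        by (rule derivative_eq_intros has_vector_derivative_at_within[OF v1] has_vector_derivative_at_within[OF v2] dE refl)+
           (simp add: algebra_simps power2_eq_square)
    qed (auto intro!: continuous_intros cont cE)
    have i1: "has_bochner_integral lborel (\<lambda>\<xi>. E \<xi> * \<beta> \<xi>) (bump_hat x)"
      using kernel_integrand_integrable[of "- 2 * pi * x"]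
      by (simp add: has_bochner_integral_iff fourier_def E[symmetric] \<beta>_def mult_ac)
    have i2: "integrable lborel (\<lambda>\<xi>. indicator {-2..2} \<xi> *\<^sub>R (\<beta>2 \<xi> * E \<xi>))"
      using borel_integrable_compact[of "{-2..2}" "\<lambda>\<xi>. \<beta>2 \<xi> * E \<xi>"]
      by (simp add: continuous_intros cont cE indicator_scaleR_eq_if)
    have "(LINT \<xi>|lborel. indicator {-2..2} \<xi> *\<^sub>R ((w\<^sup>2 * \<beta> \<xi> - \<beta>2 \<xi>) * E \<xi>)) = 0"
      using has_bochner_integral_integral_eq[OF FTC] end0 by simp
    moreover have "indicator {-2..2} \<xi> *\<^sub>R ((w\<^sup>2 * \<beta> \<xi> - \<beta>2 \<xi>) * E \<xi>) = w\<^sup>2 * (E \<xi> * \<beta> \<xi>) - indicator {-2..2} \<xi> *\<^sub>R (\<beta>2 \<xi> * E \<xi>)" for \<xi>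
      using end0(1)[of \<xi>] by (cases "\<xi> \<in> {-2..2}") (auto simp: algebra_simps)
    ultimately have "w\<^sup>2 * bump_hat x = (LINT \<xi>|lborel. indicator {-2..2} \<xi> *\<^sub>R (\<beta>2 \<xi> * E \<xi>))"
      using i1 i2 by (simp add: has_bochner_integral_iff)
    then have "norm (w\<^sup>2 * bump_hat x) = norm (LINT \<xi>|lborel. indicator {-2..2} \<xi> *\<^sub>R (\<beta>2 \<xi> * E \<xi>))"
      by simp
    also have "\<dots> \<le> (LINT \<xi>|lborel. indicator {-2..2::real} \<xi> * M)"
    proof (rule Bochner_Integration.integral_norm_bound_integral[OF i2])
      show "norm (indicator {-2..2} \<xi> *\<^sub>R (\<beta>2 \<xi> * E \<xi>)) \<le> indicator {-2..2} \<xi> * M" for \<xi>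
        using M[of \<xi>] by (auto simp: norm_mult nE indicator_def)
    qed auto
    also have "\<dots> = 4 * M" by simp
    finally have "(2 * pi)\<^sup>2 * (x\<^sup>2 * norm (bump_hat x)) \<le> 4 * M"
      by (simp add: w_def norm_mult norm_power power_mult_distrib mult_ac)
    moreover have "1 * (x\<^sup>2 * norm (bump_hat x)) \<le> (2 * pi)\<^sup>2 * (x\<^sup>2 * norm (bump_hat x))"
    proof (rule mult_right_mono)
      have "1 \<le> 2 * pi" using pi_ge_two by simp
      then show "1 \<le> (2 * pi)\<^sup>2" by (simp only: one_le_power)
    qed simp
    ultimately show ?thesis by linarith
  qed
  then show ?thesis by blast
qed

text \<open>Quadratic decay makes the kernel integrable, so that a merely bounded function can be
  paired with it.\<close>

lemma kernel_decay: "\<exists>M>0. \<forall>x. norm (bump_kernel x) \<le> M / (1 + x\<^sup>2)"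
proof -
  let ?c = "LINT x|lborel. bump x"
  obtain M where M: "\<And>x. x\<^sup>2 * norm (bump_hat x) \<le> M"
    using kernel_decay_sq by blast
  have M0: "0 \<le> M" using M[of 0] by simp
  have "(1 + x\<^sup>2) * norm (bump_kernel x) \<le> 1 + M / ?c" for x
  proof -
    have "x\<^sup>2 * norm (bump_kernel x) \<le> M / ?c"
      using divide_right_mono[OF M[of x], of ?c] bump_integral_pos by (simp add: bump_kernel_def norm_divide)
    with norm_kernel_le_1[of x] show ?thesis by (simp add: algebra_simps)
  qed
  moreover have "0 < 1 + M / ?c" using M0 bump_integral_pos by (simp add: add_pos_nonneg)
  ultimately show ?thesis
    by (intro exI[of _ "1 + M / ?c"]) (auto simp: field_simps add_pos_nonneg)
qed

lemma integrable_inverse_1_plus_square: "integrable lborel (\<lambda>x::real. inverse (1 + x\<^sup>2))"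
proof (rule integrableI_bounded)
  have half: "(\<integral>\<^sup>+ x. ennreal (inverse (1 + x\<^sup>2)) * indicator {0..} x \<partial>lborel) = ennreal (pi / 2 - arctan 0)"
    by (rule nn_integral_FTC_atLeast)
       (auto intro!: DERIV_arctan tendsto_arctan_at_top simp: add_pos_nonneg)
  have "(\<integral>\<^sup>+ x. ennreal (norm (inverse (1 + x\<^sup>2 :: real))) \<partial>lborel)
      \<le> (\<integral>\<^sup>+ x. ennreal (inverse (1 + x\<^sup>2)) * indicator {0..} x + ennreal (inverse (1 + x\<^sup>2)) * indicator {0..} (- x) \<partial>lborel)"
    by (intro nn_integral_mono) (auto simp: indicator_def)
  also have "\<dots> = (\<integral>\<^sup>+ x. ennreal (inverse (1 + x\<^sup>2)) * indicator {0..} x \<partial>lborel) + (\<integral>\<^sup>+ x. ennreal (inverse (1 + x\<^sup>2)) * indicator {0..} (- x) \<partial>lborel)"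
    by (intro nn_integral_add) measurable
  also have "(\<integral>\<^sup>+ x. ennreal (inverse (1 + x\<^sup>2)) * indicator {0..} (- x) \<partial>lborel) = (\<integral>\<^sup>+ x. ennreal (inverse (1 + x\<^sup>2)) * indicator {0..} x \<partial>lborel)"
    using nn_integral_real_affine[of "\<lambda>x. ennreal (inverse (1 + x\<^sup>2)) * indicator {0..} x" "-1" 0] by simp
  finally show "(\<integral>\<^sup>+ x. ennreal (norm (inverse (1 + x\<^sup>2 :: real))) \<partial>lborel) < \<infinity>"
    unfolding half by (rule le_less_trans) (simp add: ennreal_add_eq_top flip: ennreal_plus)
qed measurable

section \<open>Translates and tensor products of integrable functions\<close>

lemma lborel_integrable_translate:
  fixes f :: "'a::euclidean_space \<Rightarrow> 'b::{banach, second_countable_topology}"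
  assumes "integrable lborel f"
  shows "integrable lborel (\<lambda>x. f (x + \<tau>))"
proof -
  have "integrable (distr lborel borel ((+) \<tau>)) f"
    unfolding lborel_distr_plus by (rule assms)
  then have "integrable lborel (\<lambda>x. f (\<tau> + x))"
    by (rule integrable_distr[rotated]) simp
  then show ?thesis by (simp add: add.commute)
qed

lemma lborel_integral_translate:
  fixes f :: "'a::euclidean_space \<Rightarrow> 'b::{banach, second_countable_topology}"
  assumes "f \<in> borel_measurable borel"
  shows "(LINT x|lborel. f (x + \<tau>)) = (LINT x|lborel. f x)"
proof -
  have "(LINT x|lborel. f x) = (LINT x|distr lborel borel ((+) \<tau>). f x)"
    unfolding lborel_distr_plus ..
  also have "\<dots> = (LINT x|lborel. f (\<tau> + x))"
    by (rule integral_distr) (simp_all add: assms)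
  finally show ?thesis by (simp add: add.commute)
qed

lemma lborel_integrable_product:
  fixes f :: "'a::euclidean_space \<Rightarrow> 'c::{real_normed_field, banach, second_countable_topology}"
    and g :: "'b::euclidean_space \<Rightarrow> 'c"
  assumes "integrable lborel f" "integrable lborel g"
  shows "integrable lborel (\<lambda>z. f (fst z) * g (snd z))"
proof -
  have "integrable (lborel \<Otimes>\<^sub>M lborel) (\<lambda>z. f (fst z) * g (snd z))"
  proof (rule lborel_pair.Fubini_integrable)
    show "(\<lambda>z. f (fst z) * g (snd z)) \<in> borel_measurable (lborel \<Otimes>\<^sub>M lborel)"
      using assms[THEN borel_measurable_integrable] by measurable
  qed (use assms in \<open>auto simp: norm_mult\<close>)
  then show ?thesis by (simp add: lborel_prod)
qed

lemma lborel_integral_product: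
  fixes f :: "'a::euclidean_space \<Rightarrow> complex" and g :: "'b::euclidean_space \<Rightarrow> complex"
  assumes "integrable lborel f" "integrable lborel g"
  shows "(LINT z|lborel. f (fst z) * g (snd z)) = (LINT x|lborel. f x) * (LINT y|lborel. g y)"
proof -
  have "integrable (lborel \<Otimes>\<^sub>M lborel) (\<lambda>z. f (fst z) * g (snd z))"
    using lborel_integrable_product[OF assms] by (simp add: lborel_prod)
  from lborel_pair.integral_fst'[OF this] show ?thesis by (simp add: lborel_prod)
qed

section \<open>Wave packets in the plane\<close>

definition kernel2 :: "real \<times> real \<Rightarrow> complex" where
  "kernel2 x = bump_kernel (fst x) * bump_kernel (snd x)"

definition wave :: "real \<times> real \<Rightarrow> real \<times> real \<Rightarrow> complex" where
  "wave \<zeta> x = cis (- 2 * pi * (x \<bullet> \<zeta>))"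

definition bump2 :: "real \<Rightarrow> real \<times> real \<Rightarrow> real \<times> real \<Rightarrow> complex" where
  "bump2 \<epsilon> \<zeta> z = of_real (bump ((fst z - fst \<zeta>) / \<epsilon>)) * of_real (bump ((snd z - snd \<zeta>) / \<epsilon>))"

text \<open>Up to the constant in \<open>fourier_bump2\<close>, the transform of a bump on the box
  of half-width \<open>\<epsilon>\<close> about \<open>\<zeta>\<close>: a cutoff at spatial scale
  \<open>1 / \<epsilon>\<close> times a pure oscillation.\<close>

abbreviation packet :: "real \<Rightarrow> real \<times> real \<Rightarrow> real \<times> real \<Rightarrow> complex" where
  "packet \<epsilon> \<zeta> x \<equiv> kernel2 (\<epsilon> *\<^sub>R x) * wave \<zeta> x"

lemma norm_wave [simp]: "norm (wave \<zeta> x) = 1"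
  by (simp add: wave_def)

lemma continuous_cis_compose: "continuous_on A f \<Longrightarrow> continuous_on A (\<lambda>x. cis (f x))"
  unfolding cis_conv_exp by (intro continuous_intros)

lemma wave_borel [measurable]: "(\<lambda>x. wave \<zeta> x) \<in> borel_measurable borel"
  unfolding wave_def by (intro borel_measurable_continuous_onI continuous_cis_compose continuous_intros)

lemma continuous_kernel2: "continuous_on A kernel2"
  unfolding kernel2_def
  by (intro continuous_intros continuous_on_compose2[OF continuous_kernel[of UNIV]]) auto

lemma kernel2_borel [measurable]: "kernel2 \<in> borel_measurable borel"
  by (intro borel_measurable_continuous_onI continuous_kernel2)

lemma norm_kernel2_le_1: "norm (kernel2 x) \<le> 1"
  by (simp add: kernel2_def norm_mult mult_le_one norm_kernel_le_1)

lemma kernel2_0: "kernel2 0 = 1"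
  by (simp add: kernel2_def kernel_0)

lemma kernel_integrable: "integrable lborel bump_kernel"
proof -
  obtain M where M: "M > 0" "\<And>x. norm (bump_kernel x) \<le> M / (1 + x\<^sup>2)" using kernel_decay by blast
  show ?thesis
  proof (rule Bochner_Integration.integrable_bound)
    show "integrable lborel (\<lambda>x::real. M * inverse (1 + x\<^sup>2))"
      using integrable_inverse_1_plus_square by simp
    show "AE x in lborel. norm (bump_kernel x) \<le> norm (M * inverse (1 + x\<^sup>2))"
      using M by (intro AE_I2) (simp add: divide_inverse abs_mult add_pos_nonneg)
  qed simp
qed

lemma kernel2_integrable:
  assumes "0 < \<epsilon>"
  shows "integrable lborel (\<lambda>x. kernel2 (\<epsilon> *\<^sub>R x))"
proof -
  have "integrable lborel (\<lambda>x. bump_kernel (\<epsilon> * x))"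
    using lborel_integrable_real_affine[OF kernel_integrable, of \<epsilon> 0] assms by simp
  from lborel_integrable_product[OF this this] show ?thesis by (simp add: kernel2_def)
qed

lemma kernel2_integrable_translate:
  assumes "0 < \<epsilon>"
  shows "integrable lborel (\<lambda>x. kernel2 (\<epsilon> *\<^sub>R (x - \<tau>)))"
  using lborel_integrable_translate[OF kernel2_integrable[OF assms], of "- \<tau>"] by simp

lemma bump2_eq_0:
  assumes "0 < \<epsilon>" "\<not> (\<bar>fst z - fst \<zeta>\<bar> \<le> \<epsilon> \<and> \<bar>snd z - snd \<zeta>\<bar> \<le> \<epsilon>)"
  shows "bump2 \<epsilon> \<zeta> z = 0"
proof -
  have "1 \<le> \<bar>(fst z - fst \<zeta>) / \<epsilon>\<bar> \<or> 1 \<le> \<bar>(snd z - snd \<zeta>) / \<epsilon>\<bar>"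
    using assms by (auto simp: abs_divide field_simps)
  then show ?thesis by (auto simp: bump2_def bump_eq_0)
qed

lemma flat_generated_bump2: "flat_generated (bump2 \<epsilon> \<zeta>)"
proof -
  have "flat_generated (\<lambda>z. of_real (bump (- fst \<zeta> / \<epsilon> + z \<bullet> (inverse \<epsilon>, 0))) * of_real (bump (- snd \<zeta> / \<epsilon> + z \<bullet> (0, inverse \<epsilon>))))"
    by (intro flat_generated.mult flat_generated_bump)
  moreover have "- fst \<zeta> / \<epsilon> + z \<bullet> (inverse \<epsilon>, 0) = (fst z - fst \<zeta>) / \<epsilon>"
    "- snd \<zeta> / \<epsilon> + z \<bullet> (0, inverse \<epsilon>) = (snd z - snd \<zeta>) / \<epsilon>" for z :: "real \<times> real"
    by (simp_all add: inner_prod_def divide_inverse algebra_simps)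
  ultimately show ?thesis by (simp only: bump2_def[abs_def])
qed

lemma scaled_bump_integrable:
  assumes "0 < \<epsilon>"
  shows "integrable lborel (\<lambda>\<xi>. complex_of_real (bump ((\<xi> - a) / \<epsilon>)))"
proof -
  have "- a / \<epsilon> + inverse \<epsilon> * \<xi> = (\<xi> - a) / \<epsilon>" for \<xi>
    by (simp add: divide_inverse algebra_simps)
  with lborel_integrable_real_affine[OF bump_integrable, of "inverse \<epsilon>" "- a / \<epsilon>"] assms
  show ?thesis by simp
qed

lemma bump2_integrable:
  assumes "0 < \<epsilon>"
  shows "integrable lborel (bump2 \<epsilon> \<zeta>)"
  using lborel_integrable_product[OF scaled_bump_integrable[OF assms] scaled_bump_integrable[OF assms]]
  by (simp add: bump2_def[abs_def])

lemma bump2_borel [measurable]: "bump2 \<epsilon> \<zeta> \<in> borel_measurable borel"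
  by (intro borel_measurable_continuous_onI flat_generated_continuous flat_generated_bump2)

lemma fourier_scaled_bump:
  assumes "0 < \<epsilon>"
  shows "(LINT \<xi>|lborel. cis (- 2 * pi * (\<xi> * x)) * complex_of_real (bump ((\<xi> - a) / \<epsilon>)))
     = of_real (\<epsilon> * (LINT x|lborel. bump x)) * bump_kernel (\<epsilon> * x) * cis (- 2 * pi * (a * x))"
proof -
  have "(LINT \<xi>|lborel. cis (- 2 * pi * (\<xi> * x)) * complex_of_real (bump ((\<xi> - a) / \<epsilon>)))
      = \<epsilon> *\<^sub>R (LINT \<xi>|lborel. cis (- 2 * pi * ((a + \<epsilon> * \<xi>) * x)) * complex_of_real (bump \<xi>))"
    using lborel_integral_real_affine[of \<epsilon> "\<lambda>\<xi>. cis (- 2 * pi * (\<xi> * x)) * complex_of_real (bump ((\<xi> - a) / \<epsilon>))" a] assms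
    by simp
  also have "(LINT \<xi>|lborel. cis (- 2 * pi * ((a + \<epsilon> * \<xi>) * x)) * complex_of_real (bump \<xi>))
      = (LINT \<xi>|lborel. cis (- 2 * pi * (a * x)) * (cis (- 2 * pi * (\<xi> \<bullet> (\<epsilon> * x))) * complex_of_real (bump \<xi>)))"
  proof (intro Bochner_Integration.integral_cong refl)
    fix \<xi> :: real
    have "- 2 * pi * ((a + \<epsilon> * \<xi>) * x) = - 2 * pi * (a * x) + - 2 * pi * (\<xi> \<bullet> (\<epsilon> * x))"
      by (simp add: algebra_simps)
    then show "cis (- 2 * pi * ((a + \<epsilon> * \<xi>) * x)) * complex_of_real (bump \<xi>)
        = cis (- 2 * pi * (a * x)) * (cis (- 2 * pi * (\<xi> \<bullet> (\<epsilon> * x))) * complex_of_real (bump \<xi>))"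
      by (simp only: cis_mult[symmetric] mult.assoc)
  qed
  also have "\<dots> = cis (- 2 * pi * (a * x)) * bump_hat (\<epsilon> * x)"
    by (simp add: fourier_def)
  finally show ?thesis
    using bump_integral_pos by (simp add: bump_kernel_def scaleR_conv_of_real mult_ac)
qed

lemma fourier_bump2:
  assumes "0 < \<epsilon>"
  shows "fourier (bump2 \<epsilon> \<zeta>) x = of_real ((\<epsilon> * (LINT x|lborel. bump x))\<^sup>2) * packet \<epsilon> \<zeta> x"
proof -
  have int: "integrable lborel (\<lambda>\<xi>. cis (- 2 * pi * (\<xi> * x)) * complex_of_real (bump ((\<xi> - a) / \<epsilon>)))" for x a
  proof (rule Bochner_Integration.integrable_bound[OF scaled_bump_integrable[OF assms, of a]])
    have [measurable]: "(\<lambda>\<xi>. cis (- 2 * pi * (\<xi> * x))) \<in> borel_measurable borel"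
      by (intro borel_measurable_continuous_onI continuous_cis_compose continuous_intros)
    show "(\<lambda>\<xi>. cis (- 2 * pi * (\<xi> * x)) * complex_of_real (bump ((\<xi> - a) / \<epsilon>))) \<in> borel_measurable lborel"
      by measurable
  qed (simp add: norm_mult)
  have "fourier (bump2 \<epsilon> \<zeta>) x = (LINT z|lborel. (cis (- 2 * pi * (fst z * fst x)) * complex_of_real (bump ((fst z - fst \<zeta>) / \<epsilon>)))
       * (cis (- 2 * pi * (snd z * snd x)) * complex_of_real (bump ((snd z - snd \<zeta>) / \<epsilon>))))"
    unfolding fourier_def bump2_def
  proof (intro Bochner_Integration.integral_cong refl)
    fix z :: "real \<times> real"
    have "- 2 * pi * (z \<bullet> x) = - 2 * pi * (fst z * fst x) + - 2 * pi * (snd z * snd x)"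
      by (simp add: inner_prod_def algebra_simps)
    then have "cis (- 2 * pi * (z \<bullet> x)) = cis (- 2 * pi * (fst z * fst x)) * cis (- 2 * pi * (snd z * snd x))"
      by (simp only: cis_mult)
    then show "cis (- 2 * pi * (z \<bullet> x)) * (complex_of_real (bump ((fst z - fst \<zeta>) / \<epsilon>)) * complex_of_real (bump ((snd z - snd \<zeta>) / \<epsilon>))) =
      (cis (- 2 * pi * (fst z * fst x)) * complex_of_real (bump ((fst z - fst \<zeta>) / \<epsilon>)))
       * (cis (- 2 * pi * (snd z * snd x)) * complex_of_real (bump ((snd z - snd \<zeta>) / \<epsilon>)))"
      by (simp only: mult_ac)
  qed
  also have "\<dots> = (of_real (\<epsilon> * (LINT x|lborel. bump x)) * bump_kernel (\<epsilon> * fst x) * cis (- 2 * pi * (fst \<zeta> * fst x)))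
      * (of_real (\<epsilon> * (LINT x|lborel. bump x)) * bump_kernel (\<epsilon> * snd x) * cis (- 2 * pi * (snd \<zeta> * snd x)))"
    unfolding lborel_integral_product[OF int int] fourier_scaled_bump[OF assms] ..
  also have "\<dots> = of_real ((\<epsilon> * (LINT x|lborel. bump x))\<^sup>2) * (kernel2 (\<epsilon> *\<^sub>R x) *
       (cis (- 2 * pi * (fst \<zeta> * fst x)) * cis (- 2 * pi * (snd \<zeta> * snd x))))"
    by (simp add: kernel2_def power2_eq_square mult_ac)
  also have "cis (- 2 * pi * (fst \<zeta> * fst x)) * cis (- 2 * pi * (snd \<zeta> * snd x)) = wave \<zeta> x"
  proof -
    have "- 2 * pi * (fst \<zeta> * fst x) + - 2 * pi * (snd \<zeta> * snd x) = - 2 * pi * (x \<bullet> \<zeta>)"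
      by (simp add: inner_prod_def algebra_simps)
    then show ?thesis by (simp only: wave_def cis_mult)
  qed
  finally show ?thesis .
qed

text \<open>Multiplying by a function whose Fourier transform is supported in a box averages the
  Fourier transform over translates of that box.\<close>

lemma integral_kernel2_wave_eq_0:
  fixes F :: "real \<times> real \<Rightarrow> complex"
  assumes "0 < \<epsilon>" and F: "integrable lborel F"
    and zero: "\<And>\<zeta>'. \<bar>fst \<zeta>' - fst \<zeta>\<bar> \<le> \<epsilon> \<Longrightarrow> \<bar>snd \<zeta>' - snd \<zeta>\<bar> \<le> \<epsilon> \<Longrightarrow> (LINT x|lborel. F x * wave \<zeta>' x) = 0"
  shows "(LINT x|lborel. F x * (kernel2 (\<epsilon> *\<^sub>R (x - \<tau>)) * wave \<zeta> (x - \<tau>))) = 0"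
proof -
  have [measurable]: "F \<in> borel_measurable borel" using borel_measurable_integrable[OF F] by simp
  \<comment> \<open>The packet is a superposition of the frequencies \<open>\<zeta>'\<close>
    weighted by \<open>bump2\<close>. Integrating \<open>G\<close> over \<open>x\<close> first gives
    0 by hypothesis; integrating over \<open>\<zeta>'\<close> first gives the packet translated by
    \<open>\<tau>\<close>.\<close>
  define G where "G x \<zeta>' = F x * (bump2 \<epsilon> \<zeta> \<zeta>' * cis (- 2 * pi * (\<zeta>' \<bullet> (x - \<tau>))))" for x \<zeta>'
  have "(\<lambda>p. cis (- 2 * pi * (snd p \<bullet> (fst p - \<tau>)))) \<in> borel_measurable (borel :: ((real \<times> real) \<times> (real \<times> real)) measure)"
    by (intro borel_measurable_continuous_onI continuous_cis_compose continuous_intros)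
  then have [measurable]: "(\<lambda>p. cis (- 2 * pi * (snd p \<bullet> (fst p - \<tau>)))) \<in> borel_measurable (lborel \<Otimes>\<^sub>M lborel)"
    by (simp add: lborel_prod)
  have "integrable (lborel \<Otimes>\<^sub>M lborel) (\<lambda>p. G (fst p) (snd p))"
  proof (rule Bochner_Integration.integrable_bound)
    show "integrable (lborel \<Otimes>\<^sub>M lborel) (\<lambda>p. F (fst p) * bump2 \<epsilon> \<zeta> (snd p))"
      using lborel_integrable_product[OF F bump2_integrable[OF assms(1)]] by (simp add: lborel_prod)
    show "(\<lambda>p. G (fst p) (snd p)) \<in> borel_measurable (lborel \<Otimes>\<^sub>M lborel)"
      unfolding G_def by measurable
  qed (simp add: G_def norm_mult)
  then have "(LINT \<zeta>'|lborel. LINT x|lborel. G x \<zeta>') = (LINT x|lborel. LINT \<zeta>'|lborel. G x \<zeta>')"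
    by (intro lborel_pair.Fubini_integral) (simp add: case_prod_beta')
  moreover have "(LINT x|lborel. G x \<zeta>') = 0" for \<zeta>'
  proof (cases "\<bar>fst \<zeta>' - fst \<zeta>\<bar> \<le> \<epsilon> \<and> \<bar>snd \<zeta>' - snd \<zeta>\<bar> \<le> \<epsilon>")
    case True
    have "cis (- 2 * pi * (\<zeta>' \<bullet> (x - \<tau>))) = cis (2 * pi * (\<zeta>' \<bullet> \<tau>)) * wave \<zeta>' x" for x
    proof -
      have "- 2 * pi * (\<zeta>' \<bullet> (x - \<tau>)) = 2 * pi * (\<zeta>' \<bullet> \<tau>) + - 2 * pi * (x \<bullet> \<zeta>')"
        by (simp add: inner_diff_right inner_commute algebra_simps)
      then show ?thesis by (simp only: wave_def cis_mult)
    qed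
    then have "G x \<zeta>' = bump2 \<epsilon> \<zeta> \<zeta>' * cis (2 * pi * (\<zeta>' \<bullet> \<tau>)) * (F x * wave \<zeta>' x)" for x
      by (simp add: G_def mult_ac)
    with zero True show ?thesis by simp
  qed (simp add: G_def bump2_eq_0[OF assms(1)])
  moreover have "(LINT \<zeta>'|lborel. G x \<zeta>') = F x * fourier (bump2 \<epsilon> \<zeta>) (x - \<tau>)" for x
    by (simp add: G_def fourier_def mult_ac)
  ultimately have "(LINT x|lborel. of_real ((\<epsilon> * (LINT x|lborel. bump x))\<^sup>2) * (F x * (kernel2 (\<epsilon> *\<^sub>R (x - \<tau>)) * wave \<zeta> (x - \<tau>)))) = 0"
    by (simp add: fourier_bump2[OF assms(1)] mult_ac)
  with assms(1) bump_integral_pos show ?thesis by simp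
qed

section \<open>The spectral condition on bounded functions\<close>

text \<open>The test functions whose transforms occur here are supported in the open first quadrant.\<close>

definition quadrant_null :: "(real \<times> real \<Rightarrow> real) \<Rightarrow> bool" where
  "quadrant_null f \<longleftrightarrow> (\<forall>\<tau> \<zeta> \<epsilon>. 0 < \<epsilon> \<longrightarrow> \<epsilon> < fst \<zeta> \<longrightarrow> \<epsilon> < snd \<zeta> \<longrightarrow>
     (LINT x|lborel. of_real (f (x + \<tau>)) * packet \<epsilon> \<zeta> x) = 0)"

lemma integrable_bounded_kernel2:
  assumes [measurable]: "f \<in> borel_measurable borel" and M: "\<And>x. \<bar>f x\<bar> \<le> M" and "0 < \<epsilon>"
  shows "integrable lborel (\<lambda>x. complex_of_real (f (x + \<tau>)) * kernel2 (\<epsilon> *\<^sub>R x))"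
    and "integrable lborel (\<lambda>x. complex_of_real (f (x + \<tau>)) * packet \<epsilon> \<zeta> x)"
proof -
  have i: "integrable lborel (\<lambda>x. complex_of_real M * kernel2 (\<epsilon> *\<^sub>R x))"
    using kernel2_integrable[OF assms(3)] by simp
  have b: "\<bar>f x\<bar> * y \<le> \<bar>M\<bar> * y" if "0 \<le> y" for x y
    using M[of x] that by (intro mult_right_mono) auto
  show "integrable lborel (\<lambda>x. complex_of_real (f (x + \<tau>)) * kernel2 (\<epsilon> *\<^sub>R x))"
    by (rule Bochner_Integration.integrable_bound[OF i]) (auto simp: norm_mult b)
  show "integrable lborel (\<lambda>x. complex_of_real (f (x + \<tau>)) * packet \<epsilon> \<zeta> x)"
    by (rule Bochner_Integration.integrable_bound[OF i]) (auto simp: norm_mult b)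
qed

text \<open>The squared kernel is nonnegative, while the kernel itself is only known to be real. The
  second factor spreads each frequency by another \<open>\<epsilon>\<close>, hence the margin
  \<open>2 * \<epsilon>\<close>.\<close>

lemma quadrant_null_square:
  assumes "quadrant_null f" "f \<in> borel_measurable borel" "\<And>x. \<bar>f x\<bar> \<le> M"
    and "0 < \<epsilon>" "2 * \<epsilon> < fst \<zeta>" "2 * \<epsilon> < snd \<zeta>"
  shows "(LINT x|lborel. of_real (f x) * ((kernel2 (\<epsilon> *\<^sub>R x))\<^sup>2 * wave \<zeta> x)) = 0"
proof -
  have "(LINT x|lborel. (of_real (f x) * kernel2 (\<epsilon> *\<^sub>R x)) * (kernel2 (\<epsilon> *\<^sub>R (x - 0)) * wave \<zeta> (x - 0))) = 0"
  proof (rule integral_kernel2_wave_eq_0[OF assms(4)])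
    show "integrable lborel (\<lambda>x. complex_of_real (f x) * kernel2 (\<epsilon> *\<^sub>R x))"
      using integrable_bounded_kernel2(1)[OF assms(2-4), of 0] by simp
    fix \<zeta>' assume "\<bar>fst \<zeta>' - fst \<zeta>\<bar> \<le> \<epsilon>" "\<bar>snd \<zeta>' - snd \<zeta>\<bar> \<le> \<epsilon>"
    then have "\<epsilon> < fst \<zeta>'" "\<epsilon> < snd \<zeta>'" using assms(4-6) by auto
    with assms(1,4) have "(LINT x|lborel. complex_of_real (f (x + 0)) * (kernel2 (\<epsilon> *\<^sub>R x) * wave \<zeta>' x)) = 0"
      unfolding quadrant_null_def by blast
    then show "(LINT x|lborel. complex_of_real (f x) * kernel2 (\<epsilon> *\<^sub>R x) * wave \<zeta>' x) = 0"
      by (simp add: mult.assoc)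
  qed
  then show ?thesis by (simp add: power2_eq_square mult_ac)
qed

lemma compact_box: "compact {z :: real \<times> real. \<bar>fst z - fst \<zeta>\<bar> \<le> \<epsilon> \<and> \<bar>snd z - snd \<zeta>\<bar> \<le> \<epsilon>}"
proof -
  have "{z. \<bar>fst z - fst \<zeta>\<bar> \<le> \<epsilon> \<and> \<bar>snd z - snd \<zeta>\<bar> \<le> \<epsilon>}
      = {fst \<zeta> - \<epsilon>..fst \<zeta> + \<epsilon>} \<times> {snd \<zeta> - \<epsilon>..snd \<zeta> + \<epsilon>}"
    by (auto simp: abs_le_iff)
  then show ?thesis by (simp add: compact_Times)
qed

text \<open>The support of a distribution is defined through open sets on which it vanishes; a partition
  of unity is avoided by averaging bumps that are small compared to the Lebesgue number of the cover,
  whose width \<open>\<delta>\<close> then tends to 0.\<close>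

lemma double_Hilbert_fixed_quadrant_null:
  assumes S: "S \<in> sets lebesgue" "double_Hilbert_fixed S"
    and f [measurable]: "f \<in> borel_measurable borel" and M: "\<And>x. \<bar>f x\<bar> \<le> M"
    and eq: "AE x in lebesgue. indicator S x = f x"
  shows "quadrant_null f"
  unfolding quadrant_null_def
proof (intro allI impI)
  fix \<tau> \<zeta> :: "real \<times> real" and \<epsilon> :: real
  assume \<epsilon>: "0 < \<epsilon>" "\<epsilon> < fst \<zeta>" "\<epsilon> < snd \<zeta>"
  define K where "K = {z :: real \<times> real. \<bar>fst z - fst \<zeta>\<bar> \<le> \<epsilon> \<and> \<bar>snd z - snd \<zeta>\<bar> \<le> \<epsilon>}"
  let ?u = "fourier_dist (regular_dist (indicator S)) :: (real \<times> real \<Rightarrow> complex) \<Rightarrow> complex"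
  let ?\<U> = "{U. open U \<and> (\<forall>\<phi>. test_function_on U \<phi> \<longrightarrow> ?u \<phi> = 0)}"
  have cover: "K \<subseteq> \<Union>?\<U>"
  proof
    fix z assume "z \<in> K"
    then have "0 < fst z" "0 < snd z" using \<epsilon> by (auto simp: K_def abs_le_iff)
    then have "z \<notin> Q24 \<union> {0}" by (auto simp: Q24_def case_prod_beta')
    with S(2) show "z \<in> \<Union>?\<U>"
      unfolding double_Hilbert_fixed_def dist_support_def by blast
  qed
  have "compact K" unfolding K_def by (rule compact_box)
  then obtain e where e: "e > 0" "\<And>z. z \<in> K \<Longrightarrow> \<exists>U\<in>?\<U>. ball z e \<subseteq> U"
    using Heine_Borel_lemma[OF _ cover] by blast
  have u: "?u \<phi> = (LINT x|lborel. of_real (f x) * fourier \<phi> x)" if [measurable]: "fourier \<phi> \<in> borel_measurable borel" for \<phi>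
  proof -
    have "?u \<phi> = (LINT x|lebesgue. of_real (f x) * fourier \<phi> x)"
      unfolding fourier_dist_def regular_dist_def
    proof (rule integral_cong_AE)
      have 1: "(indicator S :: real \<times> real \<Rightarrow> complex) \<in> borel_measurable lebesgue"
        using S(1) by simp
      have 2: "fourier \<phi> \<in> borel_measurable lebesgue" "(\<lambda>x. complex_of_real (f x)) \<in> borel_measurable lebesgue"
        by (auto intro!: measurable_completion)
      show "(\<lambda>x. indicator S x * fourier \<phi> x) \<in> borel_measurable lebesgue"
        by (intro borel_measurable_times 1 2)
      show "(\<lambda>x. of_real (f x) * fourier \<phi> x) \<in> borel_measurable lebesgue"
        by (intro borel_measurable_times 2)
      show "AE x in lebesgue. indicator S x * fourier \<phi> x = complex_of_real (f x) * fourier \<phi> x"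
        using eq by eventually_elim (auto simp: indicator_def split: if_splits)
    qed
    also have "\<dots> = (LINT x|lborel. of_real (f x) * fourier \<phi> x)"
      by (intro integral_completion) measurable
    finally show ?thesis .
  qed
  \<comment> \<open>The kernel at scale \<open>\<delta>\<close> makes \<open>f\<close> integrable
    and widens a frequency to a box of half-width \<open>\<delta>\<close>, which for
    \<open>2 * \<delta> < e\<close> lies in a single member of the cover.\<close>
  have small: "(LINT x|lborel. (of_real (f x) * kernel2 (\<delta> *\<^sub>R x)) * wave \<zeta>' x) = 0"
    if \<delta>: "0 < \<delta>" "2 * \<delta> < e" and \<zeta>': "\<zeta>' \<in> K" for \<delta> \<zeta>'
  proof -
    obtain U where U: "U \<in> ?\<U>" "ball \<zeta>' e \<subseteq> U" using e(2)[OF \<zeta>'] by blast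
    have "test_function_on U (bump2 \<delta> \<zeta>')"
      unfolding test_function_on_def
    proof (intro conjI exI)
      let ?C = "{z :: real \<times> real. \<bar>fst z - fst \<zeta>'\<bar> \<le> \<delta> \<and> \<bar>snd z - snd \<zeta>'\<bar> \<le> \<delta>}"
      show "smooth (bump2 \<delta> \<zeta>')" by (rule flat_generated_smooth[OF flat_generated_bump2])
      show "compact ?C" by (rule compact_box)
      show "?C \<subseteq> U"
      proof
        fix z assume z: "z \<in> ?C"
        have "dist \<zeta>' z \<le> \<bar>fst z - fst \<zeta>'\<bar> + \<bar>snd z - snd \<zeta>'\<bar>"
          using sqrt_sum_squares_le_sum_abs[of "dist (fst \<zeta>') (fst z)" "dist (snd \<zeta>') (snd z)"]
          by (simp add: dist_prod_def dist_real_def abs_minus_commute)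
        with z \<delta> have "z \<in> ball \<zeta>' e" by simp
        with U(2) show "z \<in> U" by blast
      qed
      show "\<forall>x. x \<notin> ?C \<longrightarrow> bump2 \<delta> \<zeta>' x = 0"
        using bump2_eq_0[OF \<delta>(1)] by blast
    qed
    with U(1) have "?u (bump2 \<delta> \<zeta>') = 0" by blast
    moreover have "fourier (bump2 \<delta> \<zeta>') \<in> borel_measurable borel"
      unfolding fourier_bump2[OF \<delta>(1), abs_def] by measurable
    ultimately have "(LINT x|lborel. of_real (f x) * fourier (bump2 \<delta> \<zeta>') x) = 0"
      using u by simp
    then have "(LINT x|lborel. of_real ((\<delta> * (LINT x|lborel. bump x))\<^sup>2) * (of_real (f x) * kernel2 (\<delta> *\<^sub>R x) * wave \<zeta>' x)) = 0"
      by (simp add: fourier_bump2[OF \<delta>(1)] mult_ac)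
    with \<delta>(1) bump_integral_pos show ?thesis by simp
  qed
  \<comment> \<open>A box of half-width \<open>\<delta>\<close> has radius at most
    \<open>2 * \<delta>\<close>, so widths from \<open>e / 4\<close> downwards stay strictly below
    \<open>e\<close>.\<close>
  define \<delta> where "\<delta> n = e / 4 * inverse (real (Suc n))" for n
  have \<delta>: "0 < \<delta> n" "2 * \<delta> n < e" for n
  proof -
    show "0 < \<delta> n" using e(1) by (simp add: \<delta>_def)
    have "inverse (real (Suc n)) \<le> 1" by (simp add: inverse_le_1_iff)
    then have "e / 4 * inverse (real (Suc n)) \<le> e / 4 * 1"
      using e(1) by (intro mult_left_mono) auto
    then show "2 * \<delta> n < e" using e(1) unfolding \<delta>_def by linarith
  qed
  have \<delta>_lim: "\<delta> \<longlonglongrightarrow> 0"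
    unfolding \<delta>_def using tendsto_mult_right_zero[OF LIMSEQ_inverse_real_of_nat] by blast
  let ?g = "\<lambda>x. kernel2 (\<epsilon> *\<^sub>R (x - \<tau>)) * wave \<zeta> (x - \<tau>)"
  have zero: "(LINT x|lborel. (of_real (f x) * kernel2 (\<delta> n *\<^sub>R x)) * ?g x) = 0" for n
  proof (rule integral_kernel2_wave_eq_0[OF \<epsilon>(1)])
    show "integrable lborel (\<lambda>x. complex_of_real (f x) * kernel2 (\<delta> n *\<^sub>R x))"
      using integrable_bounded_kernel2(1)[OF f M \<delta>(1), of 0] by simp
  qed (rule small, auto simp: \<delta> K_def)
  \<comment> \<open>The fixed packet \<open>?g\<close> is integrable by itself and dominates, so the
    auxiliary cutoff can be removed: it tends to \<open>kernel2 0 = 1\<close>.\<close>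
  have "(\<lambda>n. LINT x|lborel. (of_real (f x) * kernel2 (\<delta> n *\<^sub>R x)) * ?g x) \<longlonglongrightarrow> (LINT x|lborel. (of_real (f x) * kernel2 (0 *\<^sub>R x)) * ?g x)"
  proof (rule integral_dominated_convergence[where w = "\<lambda>x. \<bar>M\<bar> * norm (kernel2 (\<epsilon> *\<^sub>R (x - \<tau>)))"])
    show "integrable lborel (\<lambda>x. \<bar>M\<bar> * norm (kernel2 (\<epsilon> *\<^sub>R (x - \<tau>))))"
      using kernel2_integrable_translate[OF \<epsilon>(1)] by simp
    show "AE x in lborel. (\<lambda>n. (of_real (f x) * kernel2 (\<delta> n *\<^sub>R x)) * ?g x) \<longlonglongrightarrow> (of_real (f x) * kernel2 (0 *\<^sub>R x)) * ?g x"
      by (intro AE_I2 tendsto_intros continuous_on_tendsto_compose[OF continuous_kernel2[of UNIV]] \<delta>_lim) auto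
    show "AE x in lborel. norm ((of_real (f x) * kernel2 (\<delta> n *\<^sub>R x)) * ?g x) \<le> \<bar>M\<bar> * norm (kernel2 (\<epsilon> *\<^sub>R (x - \<tau>)))" for n
    proof (rule AE_I2)
      fix x
      have "\<bar>f x\<bar> * norm (kernel2 (\<delta> n *\<^sub>R x)) \<le> \<bar>M\<bar> * 1"
        using M[of x] norm_kernel2_le_1 by (intro mult_mono) auto
      then show "norm ((of_real (f x) * kernel2 (\<delta> n *\<^sub>R x)) * ?g x) \<le> \<bar>M\<bar> * norm (kernel2 (\<epsilon> *\<^sub>R (x - \<tau>)))"
        by (simp add: norm_mult mult_right_mono flip: mult.assoc)
    qed
  qed measurable
  then have "(LINT x|lborel. of_real (f x) * ?g x) = 0"
    unfolding zero by (simp add: kernel2_0 LIMSEQ_const_iff)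
  moreover have "(LINT x|lborel. of_real (f (x + \<tau>)) * packet \<epsilon> \<zeta> x) = (LINT x|lborel. of_real (f x) * ?g x)"
    using lborel_integral_translate[of "\<lambda>x. of_real (f x) * ?g x" \<tau>] by simp
  ultimately show "(LINT x|lborel. of_real (f (x + \<tau>)) * packet \<epsilon> \<zeta> x) = 0"
    by simp
qed

section \<open>Functions of bounded support with spectrum off the first quadrant\<close>

lemma norm_cis_minus_1_le: "norm (cis t - 1) \<le> \<bar>t\<bar>"
proof -
  have "norm (cis t - 1) = 2 * \<bar>sin (t / 2)\<bar>"
    using dist_exp_i_1[of t] by (simp add: cis_conv_exp)
  also have "\<dots> \<le> 2 * \<bar>t / 2\<bar>" by (intro mult_left_mono abs_sin_x_le_abs_x) auto
  finally show ?thesis by simp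
qed

lemma cis_difference_quotient:
  assumes "X \<longlonglongrightarrow> 0" "\<And>n. X n \<noteq> 0"
  shows "(\<lambda>n. (cis (s * X n) - 1) / of_real (X n)) \<longlonglongrightarrow> \<i> * of_real s"
proof -
  have "((\<lambda>z. exp (\<i> * of_real s * z)) has_field_derivative \<i> * of_real s) (at 0)"
    by (auto intro!: derivative_eq_intros)
  then have lim: "((\<lambda>h. (exp (\<i> * of_real s * h) - 1) / h) \<longlongrightarrow> \<i> * of_real s) (at 0)"
    by (simp add: has_field_derivative_iff)
  have "filterlim (\<lambda>n. complex_of_real (X n)) (at 0) sequentially"
    unfolding filterlim_at using assms tendsto_of_real[OF assms(1), where 'a = complex] by simp
  from filterlim_compose[OF lim this] show ?thesis
    by (simp add: cis_conv_exp mult_ac)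
qed

text \<open>Differentiating the transform shows that polynomials act on this class.\<close>

definition quadrant_class :: "(real \<times> real \<Rightarrow> real) \<Rightarrow> bool" where
  "quadrant_class g \<longleftrightarrow> g \<in> borel_measurable borel \<and> (\<exists>M. \<forall>x. \<bar>g x\<bar> \<le> M) \<and> (\<exists>R. \<forall>x. R < norm x \<longrightarrow> g x = 0) \<and>
     (\<forall>\<zeta>. 0 < fst \<zeta> \<longrightarrow> 0 < snd \<zeta> \<longrightarrow> (LINT x|lborel. of_real (g x) * wave \<zeta> x) = 0)"

lemma quadrant_class_integral:
  "quadrant_class g \<Longrightarrow> 0 < fst \<zeta> \<Longrightarrow> 0 < snd \<zeta> \<Longrightarrow> (LINT x|lborel. of_real (g x) * wave \<zeta> x) = 0"
  unfolding quadrant_class_def by blast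

lemma bounded_support_integrable:
  fixes g :: "'a::euclidean_space \<Rightarrow> real"
  assumes "g \<in> borel_measurable borel" and M: "\<And>x. \<bar>g x\<bar> \<le> M" and R: "\<And>x. R < norm x \<Longrightarrow> g x = 0"
  shows "integrable lborel g"
proof (rule Bochner_Integration.integrable_bound)
  show "integrable lborel (\<lambda>x. M * indicator (cball 0 R) x :: real)"
    by (intro integrable_mult_right integrable_real_indicator emeasure_lborel_cball_finite) auto
  have "\<bar>g x\<bar> \<le> \<bar>M\<bar> * indicator (cball 0 R) x" for x
    using M[of x] R[of x] by (auto simp: indicator_def)
  then show "AE x in lborel. norm (g x) \<le> norm (M * indicator (cball 0 R) x :: real)"
    by (simp add: abs_mult)
qed (use assms in simp)

lemma quadrant_class_integrable:
  assumes "quadrant_class g"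
  shows "integrable lborel g" "integrable lborel (\<lambda>x. complex_of_real (g x) * wave \<zeta> x)"
proof -
  show i: "integrable lborel g"
    using assms bounded_support_integrable unfolding quadrant_class_def by blast
  have [measurable]: "g \<in> borel_measurable borel" using assms by (simp add: quadrant_class_def)
  show "integrable lborel (\<lambda>x. complex_of_real (g x) * wave \<zeta> x)"
    by (rule Bochner_Integration.integrable_bound[OF i]) (auto simp: norm_mult)
qed

text \<open>The open quadrant contains \<open>\<zeta> + t *\<^sub>R u\<close> for small
  \<open>t\<close>, so the difference quotient of the transform in direction \<open>u\<close> is 0.
  Its limit inserts the factor \<open>x \<bullet> u\<close>, and the bounded support supplies the
  domination.\<close>

lemma quadrant_class_inner:
  assumes g: "quadrant_class g"
  shows "quadrant_class (\<lambda>x. g x * (x \<bullet> u))"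
  unfolding quadrant_class_def
proof (intro conjI allI impI)
  have m [measurable]: "g \<in> borel_measurable borel" using g by (simp add: quadrant_class_def)
  then show m': "(\<lambda>x. g x * (x \<bullet> u)) \<in> borel_measurable borel" by measurable
  obtain M R where MR: "\<And>x. \<bar>g x\<bar> \<le> M" "\<And>x. R < norm x \<Longrightarrow> g x = 0"
    using g unfolding quadrant_class_def by blast
  have M0: "0 \<le> M" using MR(1)[of 0] by linarith
  have bound: "\<bar>g x * (x \<bullet> u)\<bar> \<le> M * (\<bar>R\<bar> * norm u)" for x
  proof (cases "R < norm x")
    case False
    have "\<bar>x \<bullet> u\<bar> \<le> norm x * norm u" by (rule Cauchy_Schwarz_ineq2)
    also have "\<dots> \<le> \<bar>R\<bar> * norm u" using False by (intro mult_right_mono) auto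
    finally show ?thesis unfolding abs_mult using MR(1)[of x] M0 by (intro mult_mono) auto
  qed (use M0 MR in simp)
  then show "\<exists>M. \<forall>x. \<bar>g x * (x \<bullet> u)\<bar> \<le> M" by blast
  show "\<exists>R. \<forall>x. R < norm x \<longrightarrow> g x * (x \<bullet> u) = 0" by (intro exI[of _ R]) (simp add: MR)
  fix \<zeta> :: "real \<times> real" assume \<zeta>: "0 < fst \<zeta>" "0 < snd \<zeta>"
  define X where "X n = inverse (real (Suc n))" for n
  have X: "X \<longlonglongrightarrow> 0" "\<And>n. X n \<noteq> 0" "\<And>n. 0 < X n"
    using LIMSEQ_inverse_real_of_nat by (simp_all add: X_def[abs_def])
  have "(\<lambda>n. \<zeta> + X n *\<^sub>R u) \<longlonglongrightarrow> \<zeta> + 0 *\<^sub>R u"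
    by (intro tendsto_intros X)
  then have lim: "(\<lambda>n. \<zeta> + X n *\<^sub>R u) \<longlonglongrightarrow> \<zeta>" by simp
  have ev: "\<forall>\<^sub>F n in sequentially. 0 < fst (\<zeta> + X n *\<^sub>R u) \<and> 0 < snd (\<zeta> + X n *\<^sub>R u)"
    using order_tendstoD(1)[OF tendsto_fst[OF lim] \<zeta>(1)] order_tendstoD(1)[OF tendsto_snd[OF lim] \<zeta>(2)]
    by eventually_elim auto
  let ?q = "\<lambda>n x. (cis (- 2 * pi * (x \<bullet> u) * X n) - 1) / of_real (X n)"
  have conv: "(\<lambda>n. LINT x|lborel. (of_real (g x) * wave \<zeta> x) * ?q n x) \<longlonglongrightarrow> (LINT x|lborel. (of_real (g x) * wave \<zeta> x) * (\<i> * of_real (- 2 * pi * (x \<bullet> u))))"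
  proof (rule integral_dominated_convergence[where w = "\<lambda>x. 2 * pi * \<bar>g x * (x \<bullet> u)\<bar>"])
    have "integrable lborel (\<lambda>x. g x * (x \<bullet> u))"
      by (rule bounded_support_integrable[OF m' bound, of R]) (use MR in simp)
    then show "integrable lborel (\<lambda>x. 2 * pi * \<bar>g x * (x \<bullet> u)\<bar>)" by simp
    show "AE x in lborel. (\<lambda>n. (of_real (g x) * wave \<zeta> x) * ?q n x) \<longlonglongrightarrow> (of_real (g x) * wave \<zeta> x) * (\<i> * of_real (- 2 * pi * (x \<bullet> u)))"
      by (intro AE_I2 tendsto_mult tendsto_const cis_difference_quotient X)
    show "AE x in lborel. norm ((of_real (g x) * wave \<zeta> x) * ?q n x) \<le> 2 * pi * \<bar>g x * (x \<bullet> u)\<bar>" for n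
    proof (rule AE_I2)
      fix x
      have "norm (?q n x) \<le> \<bar>- 2 * pi * (x \<bullet> u) * X n\<bar> / \<bar>X n\<bar>"
        unfolding norm_divide norm_of_real by (intro divide_right_mono norm_cis_minus_1_le) simp
      also have "\<dots> = 2 * pi * \<bar>x \<bullet> u\<bar>" using X(2)[of n] by (simp add: abs_mult)
      finally have "\<bar>g x\<bar> * norm (?q n x) \<le> \<bar>g x\<bar> * (2 * pi * \<bar>x \<bullet> u\<bar>)"
        by (rule mult_left_mono) simp
      then show "norm ((of_real (g x) * wave \<zeta> x) * ?q n x) \<le> 2 * pi * \<bar>g x * (x \<bullet> u)\<bar>"
        by (simp only: norm_mult norm_of_real norm_wave mult_1_right abs_mult mult_ac)
    qed
    have [measurable]: "(\<lambda>x. cis (- 2 * pi * (x \<bullet> u) * X n)) \<in> borel_measurable borel" for n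
      by (intro borel_measurable_continuous_onI continuous_cis_compose continuous_intros)
    show "(\<lambda>x. (of_real (g x) * wave \<zeta> x) * ?q n x) \<in> borel_measurable lborel" for n
      by measurable
  qed measurable
  have zero: "\<forall>\<^sub>F n in sequentially. (LINT x|lborel. (of_real (g x) * wave \<zeta> x) * ?q n x) = 0"
    using ev
  proof eventually_elim
    fix n assume pos: "0 < fst (\<zeta> + X n *\<^sub>R u) \<and> 0 < snd (\<zeta> + X n *\<^sub>R u)"
    have "wave \<zeta> x * cis (- 2 * pi * (x \<bullet> u) * X n) = wave (\<zeta> + X n *\<^sub>R u) x" for x
    proof -
      have "- 2 * pi * (x \<bullet> \<zeta>) + - 2 * pi * (x \<bullet> u) * X n = - 2 * pi * (x \<bullet> (\<zeta> + X n *\<^sub>R u))"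
        by (simp add: inner_add_right algebra_simps)
      then show ?thesis by (simp only: wave_def cis_mult)
    qed
    then have eq: "(of_real (g x) * wave \<zeta> x) * ?q n x
        = (of_real (g x) * wave (\<zeta> + X n *\<^sub>R u) x - of_real (g x) * wave \<zeta> x) / of_real (X n)" for x
      by (simp add: algebra_simps flip: diff_divide_distrib)
    have "(LINT x|lborel. of_real (g x) * wave (\<zeta> + X n *\<^sub>R u) x - of_real (g x) * wave \<zeta> x) = 0"
      using pos \<zeta> quadrant_class_integral[OF g]
      by (subst Bochner_Integration.integral_diff) (auto intro!: quadrant_class_integrable g)
    then show "(LINT x|lborel. (of_real (g x) * wave \<zeta> x) * ?q n x) = 0"
      unfolding eq by simp
  qed
  have "(LINT x|lborel. (of_real (g x) * wave \<zeta> x) * (\<i> * of_real (- 2 * pi * (x \<bullet> u)))) = 0"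
    by (rule LIMSEQ_unique[OF conv tendsto_eventually[OF zero]])
  moreover have eq: "(of_real (g x) * wave \<zeta> x) * (\<i> * of_real (- 2 * pi * (x \<bullet> u)))
      = (\<i> * of_real (- 2 * pi)) * (of_real (g x * (x \<bullet> u)) * wave \<zeta> x)" for x
    by simp
  ultimately show "(LINT x|lborel. of_real (g x * (x \<bullet> u)) * wave \<zeta> x) = 0"
    unfolding eq by (simp only: Bochner_Integration.integral_mult_right_zero) simp
qed

lemma quadrant_class_add:
  assumes "quadrant_class g" "quadrant_class h"
  shows "quadrant_class (\<lambda>x. g x + h x)"
  unfolding quadrant_class_def
proof (intro conjI allI impI)
  have [measurable]: "g \<in> borel_measurable borel" "h \<in> borel_measurable borel"
    using assms by (simp_all add: quadrant_class_def)
  show "(\<lambda>x. g x + h x) \<in> borel_measurable borel" by measurable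
  obtain M R M' R' where MR: "\<And>x. \<bar>g x\<bar> \<le> M" "\<And>x. R < norm x \<Longrightarrow> g x = 0"
    "\<And>x. \<bar>h x\<bar> \<le> M'" "\<And>x. R' < norm x \<Longrightarrow> h x = 0"
    using assms unfolding quadrant_class_def by metis
  have "\<bar>g x + h x\<bar> \<le> M + M'" for x
    using MR(1)[of x] MR(3)[of x] by linarith
  then show "\<exists>M. \<forall>x. \<bar>g x + h x\<bar> \<le> M" by blast
  show "\<exists>R. \<forall>x. R < norm x \<longrightarrow> g x + h x = 0"
    by (intro exI[of _ "max R R'"]) (simp add: MR)
  fix \<zeta> :: "real \<times> real" assume "0 < fst \<zeta>" "0 < snd \<zeta>"
  then show "(LINT x|lborel. of_real (g x + h x) * wave \<zeta> x) = 0"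
    using quadrant_class_integrable[OF assms(1)] quadrant_class_integrable[OF assms(2)]
    by (simp add: distrib_right quadrant_class_integral[OF assms(1)] quadrant_class_integral[OF assms(2)])
qed

lemma quadrant_class_cmult:
  assumes "quadrant_class g"
  shows "quadrant_class (\<lambda>x. g x * c)"
  unfolding quadrant_class_def
proof (intro conjI allI impI)
  have [measurable]: "g \<in> borel_measurable borel"
    using assms by (simp add: quadrant_class_def)
  show "(\<lambda>x. g x * c) \<in> borel_measurable borel" by measurable
  obtain M R where MR: "\<And>x. \<bar>g x\<bar> \<le> M" "\<And>x. R < norm x \<Longrightarrow> g x = 0"
    using assms unfolding quadrant_class_def by metis
  have "\<bar>g x * c\<bar> \<le> M * \<bar>c\<bar>" for x
    using MR(1)[of x] by (simp add: abs_mult mult_right_mono)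
  then show "\<exists>M. \<forall>x. \<bar>g x * c\<bar> \<le> M" by blast
  show "\<exists>R. \<forall>x. R < norm x \<longrightarrow> g x * c = 0"
    by (intro exI[of _ R]) (simp add: MR)
  fix \<zeta> :: "real \<times> real" assume "0 < fst \<zeta>" "0 < snd \<zeta>"
  then have "(LINT x|lborel. of_real c * (of_real (g x) * wave \<zeta> x)) = 0"
    using quadrant_class_integral[OF assms] by simp
  then show "(LINT x|lborel. of_real (g x * c) * wave \<zeta> x) = 0"
    by (simp add: mult_ac)
qed

lemma quadrant_class_polynomial:
  assumes "real_polynomial_function p" "quadrant_class g"
  shows "quadrant_class (\<lambda>x. g x * p x)"
  using assms
proof (induction arbitrary: g)
  case (linear p)
  obtain u where u: "u = (p (1, 0), p (0, 1))" by blast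
  have p: "p x = x \<bullet> u" for x
  proof -
    have "x = fst x *\<^sub>R (1, 0) + snd x *\<^sub>R (0, 1)" by (simp add: prod_eq_iff)
    then have "p x = p (fst x *\<^sub>R (1, 0) + snd x *\<^sub>R (0, 1))" by simp
    also have "\<dots> = fst x *\<^sub>R p (1, 0) + snd x *\<^sub>R p (0, 1)"
      using bounded_linear.linear[OF linear(1)] by (simp only: linear_add linear_scale)
    finally show ?thesis by (simp add: inner_prod_def u)
  qed
  show ?case unfolding p by (rule quadrant_class_inner[OF linear(2)])
next
  case (const c)
  then show ?case by (rule quadrant_class_cmult)
next
  case (add p q)
  then show ?case by (simp add: distrib_left quadrant_class_add)
next
  case (mult p q)
  have "quadrant_class (\<lambda>x. (g x * p x) * q x)"
    by (intro mult.IH mult.prems)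
  then show ?case by (simp add: mult.assoc)
qed

text \<open>On the bounded support of \<open>g\<close>, a continuous multiplier is a uniform limit
  of polynomials. This takes the place of analytic continuation of the transform.\<close>

lemma quadrant_class_continuous:
  assumes g: "quadrant_class g" and h: "continuous_on UNIV (h :: real \<times> real \<Rightarrow> real)"
    and \<zeta>: "0 < fst \<zeta>" "0 < snd \<zeta>"
  shows "(LINT x|lborel. of_real (g x * h x) * wave \<zeta> x) = 0"
proof -
  have [measurable]: "g \<in> borel_measurable borel" "h \<in> borel_measurable borel"
    using g h by (auto simp: quadrant_class_def borel_measurable_continuous_onI)
  obtain R where R: "\<And>x. R < norm x \<Longrightarrow> g x = 0"
    using g unfolding quadrant_class_def by blast
  let ?I = "LINT x|lborel. \<bar>g x\<bar>"
  have "norm (LINT x|lborel. of_real (g x * h x) * wave \<zeta> x) \<le> e * ?I" if e0: "e > 0" for e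
  proof -
    obtain p where p: "real_polynomial_function p" "\<And>x. x \<in> cball 0 R \<Longrightarrow> \<bar>h x - p x\<bar> < e"
      using Stone_Weierstrass_real_polynomial_function[OF compact_cball continuous_on_subset[OF h subset_UNIV] e0]
      by blast
    have gp: "quadrant_class (\<lambda>x. g x * p x)" by (rule quadrant_class_polynomial[OF p(1) g])
    then have [measurable]: "(\<lambda>x. g x * p x) \<in> borel_measurable borel" by (simp add: quadrant_class_def)
    have bound: "\<bar>g x * h x - g x * p x\<bar> \<le> e * \<bar>g x\<bar>" for x
    proof (cases "R < norm x")
      case False
      then have "\<bar>h x - p x\<bar> \<le> e" using p(2)[of x] by auto
      then have "\<bar>g x\<bar> * \<bar>h x - p x\<bar> \<le> \<bar>g x\<bar> * e" by (intro mult_left_mono) auto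
      then show ?thesis by (simp add: mult.commute flip: abs_mult right_diff_distrib)
    qed (simp add: R)
    have ie: "integrable lborel (\<lambda>x. e * \<bar>g x\<bar>)"
      using quadrant_class_integrable(1)[OF g] by simp
    have id: "integrable lborel (\<lambda>x. of_real (g x * h x - g x * p x) * wave \<zeta> x)"
    proof (rule Bochner_Integration.integrable_bound[OF ie])
      have "norm (of_real (g x * h x - g x * p x) * wave \<zeta> x) \<le> norm (e * \<bar>g x\<bar>)" for x
        using bound[of x] e0 by (simp only: norm_mult norm_of_real norm_wave real_norm_def abs_mult) simp
      then show "AE x in lborel. norm (of_real (g x * h x - g x * p x) * wave \<zeta> x) \<le> norm (e * \<bar>g x\<bar>)"
        by (intro AE_I2)
    qed measurable
    have "(LINT x|lborel. of_real (g x * h x) * wave \<zeta> x)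
        = (LINT x|lborel. of_real (g x * h x - g x * p x) * wave \<zeta> x + of_real (g x * p x) * wave \<zeta> x)"
      by (simp add: algebra_simps)
    also have "\<dots> = (LINT x|lborel. of_real (g x * h x - g x * p x) * wave \<zeta> x) + (LINT x|lborel. of_real (g x * p x) * wave \<zeta> x)"
      by (intro Bochner_Integration.integral_add id quadrant_class_integrable(2)[OF gp])
    also have "(LINT x|lborel. of_real (g x * p x) * wave \<zeta> x) = 0"
      using gp \<zeta> unfolding quadrant_class_def by blast
    finally have "norm (LINT x|lborel. of_real (g x * h x) * wave \<zeta> x) = norm (LINT x|lborel. of_real (g x * h x - g x * p x) * wave \<zeta> x)"
      by simp
    also have "\<dots> \<le> (LINT x|lborel. e * \<bar>g x\<bar>)"
      using bound by (intro Bochner_Integration.integral_norm_bound_integral id ie) (simp add: norm_mult del: of_real_diff of_real_mult)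
    finally show ?thesis by simp
  qed
  note b = this
  show ?thesis
  proof (rule ccontr)
    define N where "N = norm (LINT x|lborel. of_real (g x * h x) * wave \<zeta> x)"
    define I where "I = ?I"
    assume "(LINT x|lborel. of_real (g x * h x) * wave \<zeta> x) \<noteq> 0"
    then have N: "N > 0" by (simp add: N_def)
    have I: "I \<ge> 0" by (simp add: I_def)
    \<comment> \<open>With this tolerance the bound is at most \<open>N / 2\<close>; the summand 1
      covers the case \<open>I = 0\<close>.\<close>
    have "N / (2 * (1 + I)) > 0" using N I by (simp add: divide_pos_pos add_pos_nonneg)
    from b[OF this] have "N \<le> N / (2 * (1 + I)) * I" by (simp only: N_def I_def)
    also have "\<dots> \<le> N / (2 * (1 + I)) * (1 + I)"
      using N I by (intro mult_left_mono) auto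
    also have "\<dots> = N / 2"
    proof -
      have "N / (2 * J) * J = N / 2" if "J \<noteq> 0" for J using that by simp
      from this[of "1 + I"] I show ?thesis by linarith
    qed
    finally show False using N by simp
  qed
qed

text \<open>A continuous multiplier can cancel the oscillation of a single frequency, so
  \<open>g\<close> is orthogonal to every continuous function that obeys the bound of
  \<open>g\<close>. Approximating \<open>g\<close> by such functions makes the integral of its
  square 0.\<close>

lemma quadrant_class_eq_0:
  assumes g: "quadrant_class g"
  shows "AE x in lborel. g x = 0"
proof -
  have [measurable]: "g \<in> borel_measurable borel"
    using g by (auto simp: quadrant_class_def)
  obtain M where M: "\<And>x. \<bar>g x\<bar> \<le> M"
    using g unfolding quadrant_class_def by blast
  have M0: "0 \<le> M" using M[of 0] by linarith
  have ig: "integrable lborel g" by (rule quadrant_class_integrable[OF g])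
  have cont: "(LINT x|lborel. g x * h x) = 0" if h: "continuous_on UNIV h" "\<And>x. \<bar>h x\<bar> \<le> M" for h
  proof -
    let ?\<zeta> = "(1, 1) :: real \<times> real"
    have [measurable]: "h \<in> borel_measurable borel" using h by (simp add: borel_measurable_continuous_onI)
    have int: "integrable lborel (\<lambda>x. of_real (g x * (h x * k x)) * wave ?\<zeta> x)"
      if k: "continuous_on UNIV k" "\<And>x. \<bar>k x\<bar> \<le> 1" for k :: "real \<times> real \<Rightarrow> real"
    proof (rule Bochner_Integration.integrable_bound)
      have [measurable]: "k \<in> borel_measurable borel" using k by (simp add: borel_measurable_continuous_onI)
      show "(\<lambda>x. of_real (g x * (h x * k x)) * wave ?\<zeta> x) \<in> borel_measurable lborel" by measurable
      show "integrable lborel (\<lambda>x. M * g x)" using ig by simp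
      have "\<bar>g x\<bar> * (\<bar>h x\<bar> * \<bar>k x\<bar>) \<le> \<bar>g x\<bar> * (M * 1)" for x
        using h(2)[of x] k(2)[of x] M0 by (intro mult_left_mono mult_mono) auto
      then show "AE x in lborel. norm (of_real (g x * (h x * k x)) * wave ?\<zeta> x) \<le> norm (M * g x)"
        using M0 by (simp add: norm_mult abs_mult mult_ac)
    qed
    let ?c = "\<lambda>x. cos (2 * pi * (x \<bullet> ?\<zeta>))" and ?s = "\<lambda>x. sin (2 * pi * (x \<bullet> ?\<zeta>))"
    have c: "continuous_on UNIV ?c" "continuous_on UNIV ?s" by (intro continuous_intros)+
    \<comment> \<open>\<open>wave\<close> is multiplied by its conjugate, split into cosine and sine
      so that the multipliers stay real.\<close>
    have "of_real (g x * h x) = of_real (g x * (h x * ?c x)) * wave ?\<zeta> x + \<i> * (of_real (g x * (h x * ?s x)) * wave ?\<zeta> x)" for x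
    proof -
      have "cis (2 * pi * (x \<bullet> ?\<zeta>)) * wave ?\<zeta> x = 1"
        by (simp add: wave_def cis_mult)
      moreover have "cis (2 * pi * (x \<bullet> ?\<zeta>)) = of_real (?c x) + \<i> * of_real (?s x)"
        by (simp add: complex_eq_iff)
      ultimately have "(of_real (?c x) + \<i> * of_real (?s x)) * wave ?\<zeta> x = 1"
        by (simp only:)
      then have "of_real (g x * h x) * ((of_real (?c x) + \<i> * of_real (?s x)) * wave ?\<zeta> x) = of_real (g x * h x)"
        by simp
      then show ?thesis by (simp add: algebra_simps)
    qed
    then have "(LINT x|lborel. complex_of_real (g x * h x))
        = (LINT x|lborel. of_real (g x * (h x * ?c x)) * wave ?\<zeta> x) + \<i> * (LINT x|lborel. of_real (g x * (h x * ?s x)) * wave ?\<zeta> x)"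
      using int[OF c(1)] int[OF c(2)] by (simp only: Bochner_Integration.integral_add integrable_mult_right abs_cos_le_one abs_sin_le_one Bochner_Integration.integral_mult_right)
    also have "\<dots> = 0"
      using quadrant_class_continuous[OF g, of "\<lambda>x. h x * ?c x" ?\<zeta>] quadrant_class_continuous[OF g, of "\<lambda>x. h x * ?s x" ?\<zeta>]
        continuous_on_mult[OF h(1) c(1)] continuous_on_mult[OF h(1) c(2)] by simp
    finally have "complex_of_real (LINT x|lborel. g x * h x) = 0"
      by (simp only: integral_complex_of_real)
    then show ?thesis by simp
  qed
  have "g \<in> borel_measurable lebesgue"
    by (rule measurable_completion) simp
  then have "g measurable_on UNIV"
    by (rule lebesgue_measurable_imp_measurable_on) simp
  then obtain N h where h: "negligible N" "\<And>n. continuous_on UNIV (h n)" "\<And>x. x \<notin> N \<Longrightarrow> (\<lambda>n. h n x) \<longlonglongrightarrow> g x"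
    unfolding measurable_on_def by auto
  \<comment> \<open>Clipping at the bound of \<open>g\<close> leaves the limit unchanged and
    supplies the domination.\<close>
  define k where "k n x = max (- M) (min M (h n x))" for n x
  have kc: "continuous_on UNIV (k n)" for n
    unfolding k_def by (intro continuous_intros h)
  have kM: "\<bar>k n x\<bar> \<le> M" for n x
    using M0 by (auto simp: k_def)
  have [measurable]: "k n \<in> borel_measurable borel" for n
    by (simp add: borel_measurable_continuous_onI kc)
  have "AE x in lebesgue. x \<notin> N"
    using h(1) by (simp add: AE_not_in negligible_iff_null_sets)
  then have "AE x in lebesgue. (\<lambda>n. k n x) \<longlonglongrightarrow> g x"
  proof eventually_elim
    fix x assume "x \<notin> N"
    then have "(\<lambda>n. k n x) \<longlonglongrightarrow> max (- M) (min M (g x))"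
      unfolding k_def by (intro tendsto_max tendsto_min tendsto_const h)
    moreover have "max (- M) (min M (g x)) = g x" using M[of x] by auto
    ultimately show "(\<lambda>n. k n x) \<longlonglongrightarrow> g x" by simp
  qed
  then have lim: "AE x in lborel. (\<lambda>n. k n x) \<longlonglongrightarrow> g x"
    by (simp add: AE_completion_iff)
  have "(\<lambda>n. LINT x|lborel. g x * k n x) \<longlonglongrightarrow> (LINT x|lborel. g x * g x)"
  proof (rule integral_dominated_convergence[where w = "\<lambda>x. M * \<bar>g x\<bar>"])
    show "integrable lborel (\<lambda>x. M * \<bar>g x\<bar>)" using ig by simp
    show "AE x in lborel. (\<lambda>n. g x * k n x) \<longlonglongrightarrow> g x * g x"
      using lim by eventually_elim (intro tendsto_mult tendsto_const)
    show "AE x in lborel. norm (g x * k n x) \<le> M * \<bar>g x\<bar>" for n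
    proof (rule AE_I2)
      fix x show "norm (g x * k n x) \<le> M * \<bar>g x\<bar>"
        using mult_left_mono[OF kM[of n x], of "\<bar>g x\<bar>"] by (simp add: abs_mult mult.commute)
    qed
  qed measurable
  then have "(LINT x|lborel. g x * g x) = 0"
    by (simp add: cont[OF kc kM] LIMSEQ_const_iff)
  moreover have "integrable lborel (\<lambda>x. g x * g x)"
  proof (rule Bochner_Integration.integrable_bound[OF integrable_mult_right[OF ig, of M]])
    have "norm (g x * g x) \<le> norm (M * g x)" for x
      using mult_right_mono[OF M[of x], of "\<bar>g x\<bar>"] M0 by (simp add: abs_mult)
    then show "AE x in lborel. norm (g x * g x) \<le> norm (M * g x)" by (rule AE_I2)
  qed measurable
  ultimately have "AE x in lborel. g x * g x = 0"
    using integral_nonneg_eq_0_iff_AE[of lborel "\<lambda>x. g x * g x"] by simp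
  then show ?thesis by simp
qed

section \<open>Functions annihilated by iterated differences\<close>

lemma sets_Collect_borel: "Measurable.pred borel P \<Longrightarrow> {x. P x} \<in> sets borel"
  by (simp add: pred_def)

lemma sets_Collect_lborel: "Measurable.pred borel P \<Longrightarrow> {x. P x} \<in> sets lborel"
  by (simp add: pred_def)

lemma AE_lborel_translate:
  fixes u :: "'a::euclidean_space"
  assumes "AE z in lborel. P z"
  shows "AE z in lborel. P (z + u)"
proof -
  have "AE z in distr lborel borel ((+) u). P z"
    unfolding lborel_distr_plus by (rule assms)
  from AE_distrD[OF _ this] show ?thesis
    by (simp add: add.commute)
qed

text \<open>Each \<open>s\<close> comes with its own exceptional null set of points
  \<open>z\<close>. Fubini merges these into one null set of \<open>z\<close>, at the price of an
  exceptional null set of \<open>s\<close>.\<close>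

lemma AE_lborel_swap:
  fixes P :: "'a::euclidean_space \<Rightarrow> 'b::euclidean_space \<Rightarrow> bool"
  assumes "Measurable.pred (borel \<Otimes>\<^sub>M borel) (\<lambda>x. P (fst x) (snd x))"
    and "\<And>s. AE z in lborel. P z s"
  shows "AE z in lborel. AE s in lborel. P z s"
proof -
  have "(AE z in lborel. AE s in lborel. P z s) \<longleftrightarrow> (AE s in lborel. AE z in lborel. P z s)"
  proof (rule lborel_pair.AE_commute)
    have "sets (lborel \<Otimes>\<^sub>M lborel) = sets (borel \<Otimes>\<^sub>M borel :: ('a \<times> 'b) measure)"
      by (rule sets_pair_measure_cong) simp_all
    with assms(1) show "{x \<in> space (lborel \<Otimes>\<^sub>M lborel). P (fst x) (snd x)} \<in> sets (lborel \<Otimes>\<^sub>M lborel)"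
      by (simp add: pred_def space_pair_measure)
  qed
  with assms(2) show ?thesis by simp
qed

text \<open>The swap needs measurability, which a Borel null set around the failures of
  \<open>P\<close> supplies.\<close>

lemma AE_lborel_translate_line:
  fixes v :: "'a::euclidean_space"
  assumes "AE z in lborel. P z"
  shows "AE z in lborel. AE s::real in lborel. P (z + s *\<^sub>R v)"
proof -
  obtain N where N: "N \<in> null_sets lborel" "{z. \<not> P z} \<subseteq> N"
    using assms by (auto elim!: AE_E simp: null_sets_def)
  then have [measurable]: "N \<in> sets borel" by auto
  have "AE z in lborel. z \<notin> N" using N by (rule_tac AE_not_in)
  then have "AE z in lborel. AE s in lborel. z + s *\<^sub>R v \<notin> N"
    by (intro AE_lborel_swap AE_lborel_translate) measurable
  then show ?thesis
    using N(2) by (auto elim!: eventually_mono)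
qed

text \<open>The line has infinite measure, so a set of full measure is not contained in
  \<open>A\<close>. This picks the sample points at which a function has already reached its limit
  along a line.\<close>

lemma AE_ex_not_in_finite_measure:
  fixes A :: "real set"
  assumes "AE s in lborel. P s" "A \<in> sets borel" "emeasure lborel A < \<infinity>"
  shows "\<exists>s. s \<notin> A \<and> P s"
proof (rule ccontr)
  assume "\<not> ?thesis"
  then have "AE s in lborel. s \<in> A" using assms(1) by (auto elim!: eventually_mono)
  then have "emeasure lborel A = emeasure lborel (UNIV::real set)"
    using assms(2) by (intro emeasure_eq_AE) auto
  with assms(3) show False by simp
qed

lemma borel_measurable_slice:
  assumes "(\<lambda>x. G (fst x) (snd x)) \<in> borel_measurable (borel \<Otimes>\<^sub>M borel)"
  shows "G z \<in> borel_measurable borel"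
  using measurable_compose[OF measurable_Pair1'[of z borel borel] assms] by simp

section \<open>Thin functions and iterated difference equations\<close>

abbreviation off_level :: "('a::euclidean_space \<Rightarrow> real) \<Rightarrow> 'a \<Rightarrow> 'a \<Rightarrow> real \<Rightarrow> ennreal" where
  "off_level f z u c \<equiv> emeasure lborel {r::real. f (z + r *\<^sub>R u) \<noteq> c}"

text \<open>The form in which the bound on horizontal sections enters. The constant is explicit
  because it has to be uniform in the step of a difference.\<close>

definition thin :: "'a::euclidean_space \<Rightarrow> real \<Rightarrow> ('a \<Rightarrow> real) \<Rightarrow> bool" where
  "thin u C f \<longleftrightarrow> (AE z in lborel. off_level f z u 0 \<le> ennreal C)"

text \<open>The functional equation satisfied by sums of functions that are each invariant along one
  direction of the list, stated without exhibiting the summands.\<close>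

primrec annih :: "'a::euclidean_space list \<Rightarrow> ('a \<Rightarrow> real) \<Rightarrow> bool" where
  "annih [] f \<longleftrightarrow> (AE z in lborel. f z = 0)"
| "annih (v # vs) f \<longleftrightarrow> (\<forall>t. annih vs (\<lambda>z. f (z + t *\<^sub>R v) - f z))"

lemma annih_minus: "annih vs f \<Longrightarrow> annih vs (\<lambda>z. - f z)"
proof (induction vs arbitrary: f)
  case (Cons v vs)
  have "annih vs (\<lambda>z. - f (z + t *\<^sub>R v) - - f z)" for t
    using Cons.IH[of "\<lambda>z. f (z + t *\<^sub>R v) - f z"] Cons.prems by simp
  then show ?case by simp
qed auto

text \<open>For all \<open>s\<close> off a set of finite measure \<open>F z\<close> agrees with
  \<open>G z s\<close>, so some \<open>s\<close> outside the finitely many sets met in the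
  differences transfers the equation. With \<open>G z s = f z - f (z + s *\<^sub>R v)\<close> it
  passes to \<open>f\<close> minus its limit along \<open>v\<close>.\<close>

lemma annih_limit:
  fixes F :: "'a::euclidean_space \<Rightarrow> real" and G :: "'a \<Rightarrow> real \<Rightarrow> real"
  assumes "F \<in> borel_measurable borel"
    and "(\<lambda>x. G (fst x) (snd x)) \<in> borel_measurable (borel \<Otimes>\<^sub>M borel)"
    and "\<And>s. annih vs (\<lambda>z. G z s)"
    and "AE z in lborel. emeasure lborel {s. F z \<noteq> G z s} < \<infinity>"
  shows "annih vs F"
  using assms
proof (induction vs arbitrary: F G)
  case Nil
  note [measurable] = Nil(1,2)
  have "AE z in lborel. AE s in lborel. G z s = 0"
    by (intro AE_lborel_swap) (use Nil(3) in auto)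
  with Nil(4) have "AE z in lborel. F z = 0"
  proof eventually_elim
    fix z assume *: "emeasure lborel {s. F z \<noteq> G z s} < \<infinity>" "AE s in lborel. G z s = 0"
    have "{s. F z \<noteq> G z s} \<in> sets borel"
      using borel_measurable_slice[OF Nil(2)] by (intro sets_Collect_borel) measurable
    from AE_ex_not_in_finite_measure[OF *(2) this *(1)] show "F z = 0" by auto
  qed
  then show ?case by simp
next
  case (Cons v vs)
  note [measurable] = Cons.prems(1,2)
  have "annih vs (\<lambda>z. F (z + t *\<^sub>R v) - F z)" for t
  proof (rule Cons.IH)
    show "(\<lambda>z. F (z + t *\<^sub>R v) - F z) \<in> borel_measurable borel" by measurable
    have "(\<lambda>x. (\<lambda>x. G (fst x) (snd x)) (fst x + t *\<^sub>R v, snd x)) \<in> borel_measurable (borel \<Otimes>\<^sub>M borel)"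
      by (rule measurable_compose[OF _ Cons.prems(2)]) measurable
    then have [measurable]: "(\<lambda>x. G (fst x + t *\<^sub>R v) (snd x)) \<in> borel_measurable (borel \<Otimes>\<^sub>M borel)"
      by simp
    show "(\<lambda>x. G (fst x + t *\<^sub>R v) (snd x) - G (fst x) (snd x)) \<in> borel_measurable (borel \<Otimes>\<^sub>M borel)"
      by measurable
    show "annih vs (\<lambda>z. G (z + t *\<^sub>R v) s - G z s)" for s
      using Cons.prems(3)[of s] by simp
    show "AE z in lborel. emeasure lborel {s. F (z + t *\<^sub>R v) - F z \<noteq> G (z + t *\<^sub>R v) s - G z s} < \<infinity>"
      using AE_lborel_translate[OF Cons.prems(4), of "t *\<^sub>R v"] Cons.prems(4)
    proof eventually_elim
      fix z
      assume *: "emeasure lborel {s. F (z + t *\<^sub>R v) \<noteq> G (z + t *\<^sub>R v) s} < \<infinity>"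
        "emeasure lborel {s. F z \<noteq> G z s} < \<infinity>"
      have [measurable]: "(\<lambda>s. G z s) \<in> borel_measurable borel" for z
        by (rule borel_measurable_slice[OF Cons.prems(2)])
      have m: "{s. F z \<noteq> G z s} \<in> sets lborel" for z
        by (intro sets_Collect_lborel) measurable
      have "emeasure lborel {s. F (z + t *\<^sub>R v) - F z \<noteq> G (z + t *\<^sub>R v) s - G z s}
         \<le> emeasure lborel ({s. F (z + t *\<^sub>R v) \<noteq> G (z + t *\<^sub>R v) s} \<union> {s. F z \<noteq> G z s})"
        using m by (intro emeasure_mono) auto
      also have "\<dots> \<le> emeasure lborel {s. F (z + t *\<^sub>R v) \<noteq> G (z + t *\<^sub>R v) s} + emeasure lborel {s. F z \<noteq> G z s}"
        using m by (intro emeasure_subadditive) auto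
      also have "\<dots> < \<infinity>" using * by simp
      finally show "emeasure lborel {s. F (z + t *\<^sub>R v) - F z \<noteq> G (z + t *\<^sub>R v) s - G z s} < \<infinity>" .
    qed
  qed
  then show ?case by simp
qed

text \<open>Averaging over a long interval produces a value that \<open>\<phi>\<close> takes on all of it up to
  bounded measure; these values agree for all long intervals.\<close>

lemma eventually_constant_of_differences:
  fixes \<phi> :: "real \<Rightarrow> real"
  assumes [measurable]: "\<phi> \<in> borel_measurable borel"
    and B: "0 \<le> B" "AE s in lborel. emeasure lborel {r. \<phi> (r + s) \<noteq> \<phi> r} \<le> ennreal B"
  shows "\<exists>c. emeasure lborel {r. \<phi> r \<noteq> c} < \<infinity>"
proof -
  \<comment> \<open>Any number above \<open>2 * B\<close> works. If every value failed on measure at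
    least \<open>D\<close>, the pairs of points of \<open>[-T, T]\<close> with different values
    would have measure at least \<open>2 * T * D\<close>; slicing by the difference \<open>s\<close>
    of the points bounds it by \<open>4 * T * B\<close>.\<close>
  define D where "D = 3 * B + 1"
  have D: "D > 2 * B" "D > 0" using B by (auto simp: D_def)
  have ms: "{r \<in> {-T..T}. \<phi> r \<noteq> c} \<in> sets lborel" for T c
  proof -
    have "{r. r \<in> {-T..T} \<and> \<phi> r \<noteq> c} \<in> sets lborel"
      by (intro sets_Collect_lborel) measurable
    then show ?thesis by simp
  qed
  have ex: "\<exists>r. emeasure lborel {r' \<in> {-T..T}. \<phi> r' \<noteq> \<phi> r} \<le> ennreal D" if T: "T > 0" for T
  proof (rule ccontr)
    assume "\<not> ?thesis"
    then have big: "ennreal D \<le> emeasure lborel {r' \<in> {-T..T}. \<phi> r' \<noteq> \<phi> r}" for r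
      by (meson le_less_linear less_imp_le)
    define I where "I = (indicator {-T..T} :: real \<Rightarrow> ennreal)"
    define J where "J r s = (if \<phi> s \<noteq> \<phi> r then 1 else 0 :: ennreal)" for r s
    have [measurable]: "I \<in> borel_measurable borel" by (simp add: I_def)
    have [measurable]: "(\<lambda>x. J (f x) (g x)) \<in> borel_measurable M"
      if [measurable]: "f \<in> borel_measurable M" "g \<in> borel_measurable M" for f g and M :: "'c measure"
      unfolding J_def by measurable
    have "ennreal (2 * T) * ennreal D = (\<integral>\<^sup>+ r. I r * ennreal D \<partial>lborel)"
      using T by (simp add: nn_integral_multc I_def)
    also have "\<dots> \<le> (\<integral>\<^sup>+ r. I r * emeasure lborel {r' \<in> {-T..T}. \<phi> r' \<noteq> \<phi> r} \<partial>lborel)"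
      using big by (intro nn_integral_mono mult_left_mono) auto
    also have "\<dots> = (\<integral>\<^sup>+ r. I r * (\<integral>\<^sup>+ s. I s * J r s \<partial>lborel) \<partial>lborel)"
    proof -
      have "emeasure lborel {r' \<in> {-T..T}. \<phi> r' \<noteq> \<phi> r} = (\<integral>\<^sup>+ s. I s * J r s \<partial>lborel)" for r
        unfolding nn_integral_indicator[OF ms, symmetric]
        by (intro nn_integral_cong) (auto simp: I_def J_def indicator_def)
      then show ?thesis by simp
    qed
    also have "\<dots> = (\<integral>\<^sup>+ r. I r * (\<integral>\<^sup>+ s. I (r + s) * J r (r + s) \<partial>lborel) \<partial>lborel)"
      using nn_integral_real_affine[of "\<lambda>s. I s * J r s" 1 r for r] by simp
    also have "\<dots> = (\<integral>\<^sup>+ r. (\<integral>\<^sup>+ s. I r * (I (r + s) * J r (r + s)) \<partial>lborel) \<partial>lborel)"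
      by (simp add: nn_integral_cmult)
    \<comment> \<open>Two points of \<open>[-T, T]\<close> differ by at most
      \<open>2 * T\<close>.\<close>
    also have "\<dots> \<le> (\<integral>\<^sup>+ r. (\<integral>\<^sup>+ s. indicator {-2*T..2*T} s * J r (r + s) \<partial>lborel) \<partial>lborel)"
      by (intro nn_integral_mono) (auto simp: I_def indicator_def)
    also have "\<dots> = (\<integral>\<^sup>+ s. (\<integral>\<^sup>+ r. indicator {-2*T..2*T} s * J r (r + s) \<partial>lborel) \<partial>lborel)"
      by (rule lborel_pair.Fubini') measurable
    also have "\<dots> = (\<integral>\<^sup>+ s. indicator {-2*T..2*T} s * emeasure lborel {r. \<phi> (r + s) \<noteq> \<phi> r} \<partial>lborel)"
    proof -
      have "emeasure lborel {r. \<phi> (r + s) \<noteq> \<phi> r} = (\<integral>\<^sup>+ r. J r (r + s) \<partial>lborel)" for s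
      proof -
        have "{r. \<phi> (r + s) \<noteq> \<phi> r} \<in> sets lborel"
          by (intro sets_Collect_lborel) measurable
        from nn_integral_indicator[OF this, symmetric] show ?thesis
          by (auto simp: J_def indicator_def intro!: nn_integral_cong)
      qed
      then show ?thesis by (simp add: nn_integral_cmult)
    qed
    also have "\<dots> \<le> (\<integral>\<^sup>+ s. indicator {-2*T..2*T} s * ennreal B \<partial>lborel)"
      using B(2) by (intro nn_integral_mono_AE) (auto elim!: eventually_mono intro!: mult_left_mono)
    also have "\<dots> = ennreal (4 * T) * ennreal B"
      using T by (simp add: nn_integral_multc)
    finally have "2 * T * D \<le> 4 * T * B"
      using T D B by (simp flip: ennreal_mult)
    with T D show False by (simp add: mult.commute)
  qed
  have "\<forall>n::nat. \<exists>c. emeasure lborel {r \<in> {-real (Suc n)..real (Suc n)}. \<phi> r \<noteq> c} \<le> ennreal D"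
    using ex by (metis of_nat_0_less_iff zero_less_Suc)
  then obtain c where c: "\<And>n. emeasure lborel {r \<in> {-real (Suc n)..real (Suc n)}. \<phi> r \<noteq> c n} \<le> ennreal D"
    by metis
  \<comment> \<open>An interval longer than \<open>2 * D\<close> is not covered by two exceptional
    sets of measure at most \<open>D\<close>, so all later intervals have the same value.\<close>
  obtain n0 where n0: "real n0 > D" using reals_Archimedean2 by blast
  have eq: "c n = c n0" if "n \<ge> n0" for n
  proof (rule ccontr)
    assume ne: "c n \<noteq> c n0"
    let ?I = "\<lambda>n. {-real (Suc n)..real (Suc n)}"
    have "ennreal (2 * real (Suc n0)) = emeasure lborel (?I n0)" by simp
    also have "\<dots> \<le> emeasure lborel ({r \<in> ?I n0. \<phi> r \<noteq> c n0} \<union> {r \<in> ?I n. \<phi> r \<noteq> c n})"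
      using ne that by (intro emeasure_mono sets.Un ms) auto
    also have "\<dots> \<le> emeasure lborel {r \<in> ?I n0. \<phi> r \<noteq> c n0} + emeasure lborel {r \<in> ?I n. \<phi> r \<noteq> c n}"
      by (intro emeasure_subadditive ms)
    also have "\<dots> \<le> ennreal D + ennreal D" by (intro add_mono c)
    finally have "2 * real (Suc n0) \<le> 2 * D" using D by (simp flip: ennreal_plus)
    with n0 show False by simp
  qed
  have "emeasure lborel (\<Union>n. {r \<in> {-real (Suc n)..real (Suc n)}. \<phi> r \<noteq> c n0}) \<le> ennreal D"
  proof -
    let ?A = "\<lambda>n. {r \<in> {-real (Suc n)..real (Suc n)}. \<phi> r \<noteq> c n0}"
    have bound: "emeasure lborel (?A n) \<le> ennreal D" for n
    proof -
      have "emeasure lborel (?A n) \<le> emeasure lborel {r \<in> {-real (Suc (max n n0))..real (Suc (max n n0))}. \<phi> r \<noteq> c (max n n0)}"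
        using eq[of "max n n0"] by (intro emeasure_mono ms) auto
      with c[of "max n n0"] show ?thesis by (rule order_trans[rotated])
    qed
    have "(SUP n. emeasure lborel (?A n)) = emeasure lborel (\<Union>n. ?A n)"
    proof (rule SUP_emeasure_incseq)
      show "range ?A \<subseteq> sets lborel" by (rule image_subsetI) (rule ms)
      show "incseq ?A" by (rule incseq_SucI) auto
    qed
    from this[symmetric] show ?thesis by (simp only: SUP_least bound)
  qed
  moreover have "(\<Union>n. {r \<in> {-real (Suc n)..real (Suc n)}. \<phi> r \<noteq> c n0}) = {r. \<phi> r \<noteq> c n0}"
  proof -
    have "\<exists>n. - real (Suc n) \<le> r \<and> r \<le> real (Suc n)" for r :: real
    proof -
      obtain n where "\<bar>r\<bar> \<le> real n" using real_arch_simple by blast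
      then show ?thesis by (intro exI[of _ n]) auto
    qed
    then show ?thesis by auto
  qed
  ultimately have "emeasure lborel {r. \<phi> r \<noteq> c n0} \<le> ennreal D"
    by (simp only:)
  then show ?thesis
    by (intro exI[of _ "c n0"]) (auto intro: le_less_trans)
qed

lemma emeasure_lborel_affine_Collect:
  fixes c :: real
  assumes "Measurable.pred borel P" "c \<noteq> 0"
  shows "emeasure lborel {s. P s} = ennreal \<bar>c\<bar> * emeasure lborel {s. P (t + c * s)}"
proof -
  note [measurable] = assms(1)
  have m: "{s. P s} \<in> sets lborel" "{s. P (t + c * s)} \<in> sets lborel"
    by (intro sets_Collect_lborel; measurable)+
  have "emeasure lborel {s. P s} = ennreal \<bar>c\<bar> * (\<integral>\<^sup>+ s. indicator {s. P s} (t + c * s) \<partial>lborel)"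
    unfolding nn_integral_indicator[OF m(1), symmetric]
    using m(1) assms(2) by (intro nn_integral_real_affine) auto
  also have "(\<integral>\<^sup>+ s. indicator {s. P s} (t + c * s) \<partial>lborel) = emeasure lborel {s. P (t + c * s)}"
    unfolding nn_integral_indicator[OF m(2), symmetric]
    by (intro nn_integral_cong) (auto simp: indicator_def)
  finally show ?thesis .
qed

lemma sets_line_Collect:
  fixes f :: "'a::euclidean_space \<Rightarrow> real"
  assumes [measurable]: "f \<in> borel_measurable borel"
  shows "{r::real. f (z + r *\<^sub>R u) \<noteq> c} \<in> sets lborel"
    and "{r::real. f (z + r *\<^sub>R u) > c} \<in> sets lborel"
  by (intro sets_Collect_lborel; measurable)+

lemma thin_diff:
  assumes [measurable]: "f \<in> borel_measurable borel" "g \<in> borel_measurable borel"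
    and "thin u C f" "thin u D g" "0 \<le> C" "0 \<le> D"
  shows "thin u (C + D) (\<lambda>z. f z - g z)"
  using assms(3,4) unfolding thin_def
proof eventually_elim
  fix z
  assume *: "off_level f z u 0 \<le> ennreal C"
    "off_level g z u 0 \<le> ennreal D"
  have "emeasure lborel {r::real. f (z + r *\<^sub>R u) - g (z + r *\<^sub>R u) \<noteq> 0}
      \<le> emeasure lborel ({r::real. f (z + r *\<^sub>R u) \<noteq> 0} \<union> {r::real. g (z + r *\<^sub>R u) \<noteq> 0})"
    by (intro emeasure_mono sets.Un sets_line_Collect assms) auto
  also have "\<dots> \<le> off_level f z u 0 + off_level g z u 0"
    by (intro emeasure_subadditive sets_line_Collect assms)
  also have "\<dots> \<le> ennreal C + ennreal D" by (intro add_mono *)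
  finally show "emeasure lborel {r::real. f (z + r *\<^sub>R u) - g (z + r *\<^sub>R u) \<noteq> 0} \<le> ennreal (C + D)"
    using assms by simp
qed

lemma thin_translate:
  assumes "thin u C f"
  shows "thin u C (\<lambda>z. f (z + a))"
proof -
  have "z + a + r *\<^sub>R u = z + r *\<^sub>R u + a" for z and r :: real
    by (simp add: ac_simps)
  with AE_lborel_translate[OF assms[unfolded thin_def], of a] show ?thesis
    by (simp add: thin_def)
qed

section \<open>Limits along lines\<close>

text \<open>The essential value of \<open>f\<close> far out along the line through \<open>z\<close> in direction \<open>v\<close>.\<close>

definition line_limit :: "'a::euclidean_space \<Rightarrow> ('a \<Rightarrow> real) \<Rightarrow> 'a \<Rightarrow> real" where
  "line_limit v f z = Sup {q. emeasure lborel {s::real. q < f (z + s *\<^sub>R v)} = \<infinity>}"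

lemma line_limit_eq:
  fixes f :: "'a::euclidean_space \<Rightarrow> real"
  assumes [measurable]: "f \<in> borel_measurable borel"
    and fin: "off_level f z v c < \<infinity>"
  shows "line_limit v f z = c"
proof -
  note m = sets_line_Collect[OF assms(1)]
  have "emeasure lborel {s::real. q < f (z + s *\<^sub>R v)} = \<infinity>" if "q < c" for q
  proof (rule ccontr)
    assume "\<not> ?thesis"
    then have *: "emeasure lborel {s::real. q < f (z + s *\<^sub>R v)} < \<infinity>"
      by (simp add: top.not_eq_extremum)
    have "emeasure lborel (UNIV :: real set) \<le> emeasure lborel ({s::real. q < f (z + s *\<^sub>R v)} \<union> {s::real. f (z + s *\<^sub>R v) \<noteq> c})"
      using that by (intro emeasure_mono sets.Un m) auto
    also have "\<dots> \<le> emeasure lborel {s::real. q < f (z + s *\<^sub>R v)} + off_level f z v c"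
      by (intro emeasure_subadditive m)
    also have "\<dots> < \<infinity>" using * fin by simp
    finally show False by simp
  qed
  moreover have "emeasure lborel {s::real. q < f (z + s *\<^sub>R v)} \<noteq> \<infinity>" if "q \<ge> c" for q
  proof -
    have "emeasure lborel {s::real. q < f (z + s *\<^sub>R v)} \<le> off_level f z v c"
      using that by (intro emeasure_mono m) auto
    also note fin
    finally show ?thesis by simp
  qed
  ultimately have "{q. emeasure lborel {s::real. q < f (z + s *\<^sub>R v)} = \<infinity>} = {..<c}"
    by (auto simp: not_le[symmetric])
  then show ?thesis by (simp add: line_limit_def)
qed

lemma line_limit_shift:
  fixes f :: "'a::euclidean_space \<Rightarrow> real"
  assumes [measurable]: "f \<in> borel_measurable borel"
  shows "line_limit v f (z + r *\<^sub>R v) = line_limit v f z"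
proof -
  have "emeasure lborel {s::real. q < f (z + r *\<^sub>R v + s *\<^sub>R v)} = emeasure lborel {s::real. q < f (z + s *\<^sub>R v)}" for q
    using emeasure_lborel_affine_Collect[of "\<lambda>s. q < f (z + s *\<^sub>R v)" 1 r]
    by (simp add: scaleR_add_left add.assoc)
  then show ?thesis by (simp add: line_limit_def)
qed

context
  fixes f :: "'a::euclidean_space \<Rightarrow> real" and M :: real
  assumes f_borel [measurable]: "f \<in> borel_measurable borel" and f_bound: "\<And>z. \<bar>f z\<bar> \<le> M"
begin

lemma line_limit_set:
  fixes z v :: 'a
  defines "A \<equiv> {q. emeasure lborel {s::real. q < f (z + s *\<^sub>R v)} = \<infinity>}"
  shows "q < - M \<Longrightarrow> q \<in> A" "q \<in> A \<Longrightarrow> q \<le> M" "bdd_above A" "A \<noteq> {}"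
proof -
  show 1: "q \<in> A" if "q < - M" for q
  proof -
    have "{s::real. q < f (z + s *\<^sub>R v)} = UNIV"
    proof (intro set_eqI iffI CollectI)
      fix s show "q < f (z + s *\<^sub>R v)" using f_bound[of "z + s *\<^sub>R v"] that by linarith
    qed auto
    then show ?thesis by (simp add: A_def)
  qed
  show 2: "q \<le> M" if "q \<in> A" for q
  proof (rule ccontr)
    assume q: "\<not> q \<le> M"
    have "{s::real. q < f (z + s *\<^sub>R v)} = {}"
    proof (intro equals0I)
      fix s assume "s \<in> {s::real. q < f (z + s *\<^sub>R v)}"
      then show False using f_bound[of "z + s *\<^sub>R v"] q by simp
    qed
    with that show False by (simp add: A_def)
  qed
  show "bdd_above A" using 2 by (rule bdd_aboveI)
  show "A \<noteq> {}" using 1[of "- M - 1"] by auto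
qed

lemma line_limit_bound: "\<bar>line_limit v f z\<bar> \<le> M"
proof -
  note A = line_limit_set[where z = z and v = v]
  have "line_limit v f z \<le> M"
    unfolding line_limit_def by (rule cSup_least[OF A(4) A(2)])
  moreover have "- M \<le> line_limit v f z"
  proof (rule dense_le)
    fix q assume "q < - M"
    then show "q \<le> line_limit v f z"
      unfolding line_limit_def by (intro cSup_upper A)
  qed
  ultimately show ?thesis by simp
qed

text \<open>This is what the supremum in \<open>line_limit\<close> is for: its superlevel sets are
  countable unions, over rational \<open>q\<close>, of sets that are measurable by Fubini.\<close>

lemma line_limit_borel [measurable]: "line_limit v f \<in> borel_measurable borel"
proof (rule borel_measurableI_greater)
  fix a :: real
  let ?m = "\<lambda>q z. emeasure lborel {s::real. q < f (z + s *\<^sub>R v)}"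
  have [measurable]: "?m q \<in> borel_measurable borel" for q
  proof (rule lborel.measurable_emeasure)
    have "{x \<in> space (borel \<Otimes>\<^sub>M borel). q < f (fst x + snd x *\<^sub>R v)} \<in> sets (borel \<Otimes>\<^sub>M borel)"
      by measurable
    moreover have "sets (borel \<Otimes>\<^sub>M lborel) = sets (borel \<Otimes>\<^sub>M borel :: ('a \<times> real) measure)"
      by (rule sets_pair_measure_cong) simp_all
    ultimately show "{x \<in> space (borel \<Otimes>\<^sub>M lborel). snd x \<in> {s. q < f (fst x + s *\<^sub>R v)}} \<in> sets (borel \<Otimes>\<^sub>M lborel)"
      by (simp add: space_pair_measure)
  qed auto
  have "{z. a < line_limit v f z} = (\<Union>q\<in>\<rat> \<inter> {a<..}. {z. ?m q z = \<infinity>})"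
  proof (intro set_eqI iffI)
    fix z assume "z \<in> {z. a < line_limit v f z}"
    then obtain x where x: "?m x z = \<infinity>" "a < x"
      using line_limit_set[where z = z and v = v] by (auto simp: line_limit_def less_cSup_iff)
    obtain q where q: "q \<in> \<rat>" "a < q" "q < x" using Rats_dense_in_real[OF x(2)] by auto
    have "?m x z \<le> ?m q z"
      using q by (intro emeasure_mono sets_line_Collect f_borel) auto
    with x q show "z \<in> (\<Union>q\<in>\<rat> \<inter> {a<..}. {z. ?m q z = \<infinity>})"
      by (auto simp: top_unique)
  next
    fix z assume "z \<in> (\<Union>q\<in>\<rat> \<inter> {a<..}. {z. ?m q z = \<infinity>})"
    then obtain q where q: "a < q" "?m q z = \<infinity>" by auto
    then have "q \<le> line_limit v f z"
      unfolding line_limit_def by (intro cSup_upper line_limit_set(3)) auto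
    with q show "z \<in> {z. a < line_limit v f z}" by simp
  qed
  also have "\<dots> \<in> sets borel"
    by (intro sets.countable_UN'' countable_Int1 countable_rat sets_Collect_borel) measurable
  finally show "{z \<in> space borel. a < line_limit v f z} \<in> sets borel" by simp
qed

text \<open>Fatou's lemma: the average over \<open>{0..n}\<close> of the translates along \<open>v\<close> of the indicator
  of \<open>{f \<noteq> 0}\<close> tends to 1 wherever the limit is nonzero.\<close>

lemma thin_line_limit:
  assumes thin: "thin e C f" "0 \<le> C"
    and lim: "AE z in lborel. emeasure lborel {s::real. f (z + s *\<^sub>R v) \<noteq> line_limit v f z} < \<infinity>"
  shows "thin e C (line_limit v f)"
  unfolding thin_def
  using AE_lborel_translate_line[OF lim, of e] AE_lborel_translate_line[OF thin(1)[unfolded thin_def], of v]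
proof eventually_elim
  fix z
  assume lim: "AE r in lborel. emeasure lborel {s::real. f (z + r *\<^sub>R e + s *\<^sub>R v) \<noteq> line_limit v f (z + r *\<^sub>R e)} < \<infinity>"
    and thin: "AE s in lborel. emeasure lborel {r::real. f (z + s *\<^sub>R v + r *\<^sub>R e) \<noteq> 0} \<le> ennreal C"
  define J where "J r s = (if f (z + r *\<^sub>R e + s *\<^sub>R v) \<noteq> 0 then 1 else 0 :: ennreal)" for r s :: real
  have [measurable]: "(\<lambda>x. J (p x) (q x)) \<in> borel_measurable N"
    if [measurable]: "p \<in> borel_measurable N" "q \<in> borel_measurable N" for p q and N :: "'c measure"
    unfolding J_def by measurable
  define U where "U n r = ennreal (1 / real (Suc n)) * (\<integral>\<^sup>+ s. indicator {0..real (Suc n)} s * J r s \<partial>lborel)" for n r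
  let ?A = "{r. line_limit v f (z + r *\<^sub>R e) \<noteq> 0}"
  have m: "?A \<in> sets lborel"
    by (intro sets_line_Collect line_limit_borel)
  have "emeasure lborel ?A = (\<integral>\<^sup>+ r. indicator ?A r \<partial>lborel)"
    using m by simp
  also have "\<dots> \<le> (\<integral>\<^sup>+ r. liminf (\<lambda>n. U n r) \<partial>lborel)"
  proof (intro nn_integral_mono_AE, use lim in eventually_elim)
    fix r
    assume fin: "emeasure lborel {s::real. f (z + r *\<^sub>R e + s *\<^sub>R v) \<noteq> line_limit v f (z + r *\<^sub>R e)} < \<infinity>"
    show "indicator ?A r \<le> liminf (\<lambda>n. U n r)"
    proof (cases "r \<in> ?A")
      case True
      let ?D = "{s::real. f (z + r *\<^sub>R e + s *\<^sub>R v) \<noteq> line_limit v f (z + r *\<^sub>R e)}"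
      obtain d where d: "emeasure lborel ?D = ennreal d" "0 \<le> d"
        using fin by (cases "emeasure lborel ?D") auto
      have D: "?D \<in> sets lborel" by (intro sets_line_Collect f_borel)
      \<comment> \<open>The limit is nonzero here, so on an interval of length \<open>n + 1\<close>
        the function \<open>f\<close> can vanish only where it misses its limit, that is on measure
        at most \<open>d\<close>.\<close>
      have "ennreal (1 - d / real (Suc n)) \<le> U n r" for n
      proof -
        have "{s \<in> {0..real (Suc n)}. f (z + r *\<^sub>R e + s *\<^sub>R v) \<noteq> 0} = {0..real (Suc n)} \<inter> {s. f (z + r *\<^sub>R e + s *\<^sub>R v) \<noteq> 0}"
          by auto
        then have I: "{s \<in> {0..real (Suc n)}. f (z + r *\<^sub>R e + s *\<^sub>R v) \<noteq> 0} \<in> sets lborel"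
          using sets_line_Collect(1)[OF f_borel, of "z + r *\<^sub>R e" v 0] by simp
        have "ennreal (real (Suc n)) = emeasure lborel {0..real (Suc n)}" by simp
        also have "\<dots> \<le> emeasure lborel ({s \<in> {0..real (Suc n)}. f (z + r *\<^sub>R e + s *\<^sub>R v) \<noteq> 0} \<union> ?D)"
          using True by (intro emeasure_mono sets.Un I D) auto
        also have "\<dots> \<le> emeasure lborel {s \<in> {0..real (Suc n)}. f (z + r *\<^sub>R e + s *\<^sub>R v) \<noteq> 0} + ennreal d"
          using emeasure_subadditive[OF I D] d by simp
        finally have "ennreal (real (Suc n) - d) \<le> emeasure lborel {s \<in> {0..real (Suc n)}. f (z + r *\<^sub>R e + s *\<^sub>R v) \<noteq> 0}"
          using d by (auto simp: ennreal_minus[symmetric] ennreal_minus_le_iff add.commute simp del: of_nat_Suc)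
        also have "\<dots> = (\<integral>\<^sup>+ s. indicator {0..real (Suc n)} s * J r s \<partial>lborel)"
          unfolding nn_integral_indicator[OF I, symmetric]
          by (intro nn_integral_cong) (auto simp: J_def indicator_def)
        finally have "ennreal (1 / real (Suc n)) * ennreal (real (Suc n) - d) \<le> U n r"
          unfolding U_def by (rule mult_left_mono) simp
        moreover have "ennreal (1 / real (Suc n)) * ennreal (real (Suc n) - d) = ennreal (1 - d / real (Suc n))"
        proof -
          have "(1 / real (Suc n)) * (real (Suc n) - d) = 1 - d / real (Suc n)"
            by (simp add: field_simps)
          then show ?thesis by (metis ennreal_mult' divide_nonneg_nonneg of_nat_0_le_iff zero_le_one)
        qed
        ultimately show ?thesis by simp
      qed
      moreover have "(\<lambda>n. ennreal (1 - d / real (Suc n))) \<longlonglongrightarrow> ennreal (1 - 0)"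
        by (intro tendsto_ennrealI tendsto_diff tendsto_const LIMSEQ_Suc[OF lim_const_over_n])
      ultimately have "ennreal (1 - 0) \<le> liminf (\<lambda>n. U n r)"
        by (metis (no_types, lifting) Liminf_mono always_eventually lim_imp_Liminf trivial_limit_sequentially)
      then show ?thesis using True by simp
    qed simp
  qed
  also have "\<dots> \<le> liminf (\<lambda>n. \<integral>\<^sup>+ r. U n r \<partial>lborel)"
    unfolding U_def by (intro nn_integral_liminf) measurable
  also have "\<dots> \<le> liminf (\<lambda>n. ennreal C)"
  proof (intro Liminf_mono always_eventually allI)
    fix n
    have "(\<integral>\<^sup>+ r. U n r \<partial>lborel) = ennreal (1 / real (Suc n)) * (\<integral>\<^sup>+ r. \<integral>\<^sup>+ s. indicator {0..real (Suc n)} s * J r s \<partial>lborel \<partial>lborel)"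
      unfolding U_def by (intro nn_integral_cmult) measurable
    also have "(\<integral>\<^sup>+ r. \<integral>\<^sup>+ s. indicator {0..real (Suc n)} s * J r s \<partial>lborel \<partial>lborel)
        = (\<integral>\<^sup>+ s. \<integral>\<^sup>+ r. indicator {0..real (Suc n)} s * J r s \<partial>lborel \<partial>lborel)"
      by (rule lborel_pair.Fubini') measurable
    also have "\<dots> = (\<integral>\<^sup>+ s. indicator {0..real (Suc n)} s * (\<integral>\<^sup>+ r. J r s \<partial>lborel) \<partial>lborel)"
      by (intro nn_integral_cong nn_integral_cmult) measurable
    also have "\<dots> \<le> (\<integral>\<^sup>+ s. indicator {0..real (Suc n)} s * ennreal C \<partial>lborel)"
    proof (intro nn_integral_mono_AE, use thin in eventually_elim)
      fix s :: real
      assume "emeasure lborel {r::real. f (z + s *\<^sub>R v + r *\<^sub>R e) \<noteq> 0} \<le> ennreal C"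
      moreover have "(\<integral>\<^sup>+ r. J r s \<partial>lborel) = emeasure lborel {r::real. f (z + s *\<^sub>R v + r *\<^sub>R e) \<noteq> 0}"
        unfolding nn_integral_indicator[OF sets_line_Collect(1)[OF f_borel], symmetric]
        by (intro nn_integral_cong) (auto simp: J_def indicator_def add.commute add.left_commute)
      ultimately show "indicator {0..real (Suc n)} s * (\<integral>\<^sup>+ r. J r s \<partial>lborel) \<le> indicator {0..real (Suc n)} s * ennreal C"
        by (intro mult_left_mono) auto
    qed
    also have "\<dots> = ennreal (real (Suc n)) * ennreal C"
      by (simp add: nn_integral_multc)
    finally have "(\<integral>\<^sup>+ r. U n r \<partial>lborel) \<le> ennreal (1 / real (Suc n)) * (ennreal (real (Suc n)) * ennreal C)"
      by (simp add: mult_left_mono)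
    also have "\<dots> = ennreal (1 / real (Suc n) * (real (Suc n) * C))"
      using thin(1) \<open>0 \<le> C\<close> by (subst ennreal_mult'[symmetric], simp, subst ennreal_mult'[symmetric], simp_all)
    also have "1 / real (Suc n) * (real (Suc n) * C) = C" by simp
    finally show "(\<integral>\<^sup>+ r. U n r \<partial>lborel) \<le> ennreal C" .
  qed
  finally show "emeasure lborel ?A \<le> ennreal C" by (simp add: Liminf_const)
qed

end

definition spans_over :: "'a::euclidean_space \<Rightarrow> 'a \<Rightarrow> 'a \<Rightarrow> bool" where
  "spans_over e v w \<longleftrightarrow> (\<exists>\<alpha> \<beta>. \<alpha> \<noteq> 0 \<and> w = \<alpha> *\<^sub>R e + \<beta> *\<^sub>R v)"

text \<open>Modulo \<open>v\<close>, the direction \<open>w\<close> is \<open>\<alpha>\<close> times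
  \<open>e\<close>, so sections along \<open>w\<close> are sections along \<open>e\<close> rescaled
  by \<open>1 / \<bar>\<alpha>\<bar>\<close>. The factor depends on the directions only.\<close>

lemma thin_invariant_transfer:
  assumes w: "spans_over e v w"
  shows "\<exists>K\<ge>0. \<forall>h C. h \<in> borel_measurable borel \<longrightarrow> (\<forall>z r. h (z + r *\<^sub>R v) = h z) \<longrightarrow> 0 \<le> C \<longrightarrow> thin e C h \<longrightarrow> thin w (K * C) h"
proof -
  obtain \<alpha> \<beta> where ab: "\<alpha> \<noteq> 0" "w = \<alpha> *\<^sub>R e + \<beta> *\<^sub>R v" using w by (auto simp: spans_over_def)
  have "thin w (inverse \<bar>\<alpha>\<bar> * C) h"
    if [measurable]: "h \<in> borel_measurable borel" and inv: "\<And>z r. h (z + r *\<^sub>R v) = h z"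
      and C: "0 \<le> C" and thin: "thin e C h" for h C
    using thin unfolding thin_def
  proof eventually_elim
    fix z
    assume *: "off_level h z e 0 \<le> ennreal C"
    have "h (z + r *\<^sub>R w) = h (z + (0 + \<alpha> * r) *\<^sub>R e)" for r :: real
      using inv[of "z + (r * \<alpha>) *\<^sub>R e" "r * \<beta>"] by (simp add: ab scaleR_add_right add.assoc mult.commute)
    then have "ennreal \<bar>\<alpha>\<bar> * off_level h z w 0 = off_level h z e 0"
      using emeasure_lborel_affine_Collect[of "\<lambda>r. h (z + r *\<^sub>R e) \<noteq> 0" \<alpha> 0] ab by simp
    with * have "ennreal \<bar>\<alpha>\<bar> * off_level h z w 0 \<le> ennreal C" by simp
    then have "ennreal (inverse \<bar>\<alpha>\<bar>) * (ennreal \<bar>\<alpha>\<bar> * off_level h z w 0) \<le> ennreal (inverse \<bar>\<alpha>\<bar>) * ennreal C"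
      by (rule mult_left_mono) simp
    moreover have "ennreal (inverse \<bar>\<alpha>\<bar>) * (ennreal \<bar>\<alpha>\<bar> * X) = X" for X
      using ab by (simp add: mult.assoc[symmetric] ennreal_mult'[symmetric])
    ultimately show "off_level h z w 0 \<le> ennreal (inverse \<bar>\<alpha>\<bar> * C)"
      using C by (simp add: ennreal_mult')
  qed
  then show ?thesis by (intro exI[of _ "inverse \<bar>\<alpha>\<bar>"]) auto
qed

text \<open>One factor \<open>K\<close> serves all functions: it is applied to
  \<open>f (z + s *\<^sub>R v) - f z\<close> for every \<open>s\<close>, and
  \<open>eventually_constant_of_differences\<close> asks for a bound uniform in
  \<open>s\<close>.\<close>

definition transfers :: "'a::euclidean_space \<Rightarrow> 'a list \<Rightarrow> 'a \<Rightarrow> real \<Rightarrow> bool" where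
  "transfers e vs w K \<longleftrightarrow> 0 \<le> K \<and>
     (\<forall>f M C. f \<in> borel_measurable borel \<longrightarrow> (\<forall>z. \<bar>f z\<bar> \<le> M) \<longrightarrow> 0 \<le> C \<longrightarrow> thin e C f \<longrightarrow> annih vs f
        \<longrightarrow> thin w (K * C) f)"

lemma transfersD:
  assumes "transfers e vs w K" "f \<in> borel_measurable borel" "\<And>z. \<bar>f z\<bar> \<le> M" "0 \<le> C" "thin e C f" "annih vs f"
  shows "thin w (K * C) f"
  using assms unfolding transfers_def by blast

text \<open>The differences along \<open>v\<close> satisfy the equation of the shorter list, so
  \<open>transfers\<close> makes them thin along \<open>v\<close>, uniformly in the step. Hence
  \<open>f\<close> is constant up to finite measure on almost every line of direction
  \<open>v\<close>, and this constant splits off as an invariant summand.\<close>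

lemma line_limit_split:
  fixes f :: "'a::euclidean_space \<Rightarrow> real"
  assumes f [measurable]: "f \<in> borel_measurable borel" and M: "\<And>z. \<bar>f z\<bar> \<le> M"
    and C: "0 \<le> C" "thin e C f" and annih: "annih (v # vs) f"
    and tr: "transfers e vs v K"
  defines "h \<equiv> line_limit v f"
  shows "h \<in> borel_measurable borel" "\<And>z. \<bar>h z\<bar> \<le> M" "\<And>z r. h (z + r *\<^sub>R v) = h z"
    and "AE z in lborel. emeasure lborel {r::real. f (z + r *\<^sub>R v) \<noteq> h z} < \<infinity>"
    and "thin e C h" "annih vs (\<lambda>z. f z - h z)" "thin e (2 * C) (\<lambda>z. f z - h z)"
    and "\<And>z. \<bar>f z - h z\<bar> \<le> 2 * M"
proof -
  show h [measurable]: "h \<in> borel_measurable borel"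
    unfolding h_def by (rule line_limit_borel[OF f M])
  show hM: "\<And>z. \<bar>h z\<bar> \<le> M"
    unfolding h_def by (rule line_limit_bound[OF f M])
  show "\<bar>f z - h z\<bar> \<le> 2 * M" for z
    using M[of z] hM[of z] by linarith
  show "\<And>z r. h (z + r *\<^sub>R v) = h z"
    unfolding h_def by (rule line_limit_shift[OF f])
  have K: "0 \<le> K" using tr by (simp add: transfers_def)
  have d: "thin v (K * (C + C)) (\<lambda>z. f (z + s *\<^sub>R v) - f z)" for s
  proof (rule transfersD[OF tr])
    show "\<bar>f (z + s *\<^sub>R v) - f z\<bar> \<le> 2 * M" for z
      using M[of z] M[of "z + s *\<^sub>R v"] by linarith
    show "thin e (C + C) (\<lambda>z. f (z + s *\<^sub>R v) - f z)"
      using C by (intro thin_diff thin_translate) auto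
    show "annih vs (\<lambda>z. f (z + s *\<^sub>R v) - f z)" using annih by simp
  qed (use C in \<open>auto intro!: borel_measurable_diff\<close>)
  let ?B = "K * (C + C)"
  have "AE z in lborel. AE s in lborel. emeasure lborel {r::real. f (z + r *\<^sub>R v + s *\<^sub>R v) \<noteq> f (z + r *\<^sub>R v)} \<le> ennreal ?B"
  proof (rule AE_lborel_swap)
    show "AE z in lborel. emeasure lborel {r. f (z + r *\<^sub>R v + s *\<^sub>R v) \<noteq> f (z + r *\<^sub>R v)} \<le> ennreal ?B" for s
      using d[of s] by (simp add: thin_def)
    have [measurable]: "(\<lambda>x. emeasure lborel {r. f (fst x + r *\<^sub>R v + snd x *\<^sub>R v) \<noteq> f (fst x + r *\<^sub>R v)})
        \<in> borel_measurable (borel \<Otimes>\<^sub>M borel :: ('a \<times> real) measure)"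
    proof (rule lborel.measurable_emeasure)
      have "{x \<in> space ((borel \<Otimes>\<^sub>M borel) \<Otimes>\<^sub>M borel). f (fst (fst x) + snd x *\<^sub>R v + snd (fst x) *\<^sub>R v) \<noteq> f (fst (fst x) + snd x *\<^sub>R v)}
          \<in> sets ((borel \<Otimes>\<^sub>M borel) \<Otimes>\<^sub>M borel :: (('a \<times> real) \<times> real) measure)"
        by measurable
      moreover have "sets ((borel \<Otimes>\<^sub>M borel) \<Otimes>\<^sub>M lborel) = sets ((borel \<Otimes>\<^sub>M borel) \<Otimes>\<^sub>M borel :: (('a \<times> real) \<times> real) measure)"
        by (rule sets_pair_measure_cong) simp_all
      ultimately show "{x \<in> space ((borel \<Otimes>\<^sub>M borel) \<Otimes>\<^sub>M lborel). snd x \<in> {r. f (fst (fst x) + r *\<^sub>R v + snd (fst x) *\<^sub>R v) \<noteq> f (fst (fst x) + r *\<^sub>R v)}}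
          \<in> sets ((borel \<Otimes>\<^sub>M borel :: ('a \<times> real) measure) \<Otimes>\<^sub>M lborel)"
        by (simp add: space_pair_measure)
    qed auto
    show "Measurable.pred (borel \<Otimes>\<^sub>M borel) (\<lambda>x. emeasure lborel {r. f (fst x + r *\<^sub>R v + snd x *\<^sub>R v) \<noteq> f (fst x + r *\<^sub>R v)} \<le> ennreal ?B)"
      by measurable
  qed
  then show fin: "AE z in lborel. emeasure lborel {r::real. f (z + r *\<^sub>R v) \<noteq> h z} < \<infinity>"
  proof eventually_elim
    fix z
    assume "AE s in lborel. emeasure lborel {r::real. f (z + r *\<^sub>R v + s *\<^sub>R v) \<noteq> f (z + r *\<^sub>R v)} \<le> ennreal ?B"
    moreover have "(\<lambda>r::real. f (z + r *\<^sub>R v)) \<in> borel_measurable borel" by measurable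
    ultimately obtain c where "off_level f z v c < \<infinity>"
      using eventually_constant_of_differences[of "\<lambda>r. f (z + r *\<^sub>R v)" ?B] C K
      by (auto simp: scaleR_add_left add.assoc)
    then show "emeasure lborel {r::real. f (z + r *\<^sub>R v) \<noteq> h z} < \<infinity>"
      unfolding h_def using line_limit_eq[OF f] by metis
  qed
  show e: "thin e C h"
    unfolding h_def by (rule thin_line_limit[OF f M C(2) C(1) fin[unfolded h_def]])
  show "thin e (2 * C) (\<lambda>z. f z - h z)"
    using thin_diff[OF f h C(2) e C(1) C(1)] by simp
  show "annih vs (\<lambda>z. f z - h z)"
  \<comment> \<open>Off a set of \<open>s\<close> of finite measure, \<open>h z\<close> is the
    sample \<open>f (z + s *\<^sub>R v)\<close>.\<close>
  proof (rule annih_limit[where G = "\<lambda>z s. f z - f (z + s *\<^sub>R v)"])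
    show "annih vs (\<lambda>z. f z - f (z + s *\<^sub>R v))" for s
      using annih annih_minus[of vs "\<lambda>z. f (z + s *\<^sub>R v) - f z"] by simp
    show "AE z in lborel. emeasure lborel {s. f z - h z \<noteq> f z - f (z + s *\<^sub>R v)} < \<infinity>"
      using fin by (simp add: eq_commute[of "h _"])
  qed measurable
qed

abbreviation directions :: "'a::euclidean_space \<Rightarrow> 'a list \<Rightarrow> bool" where
  "directions e \<equiv> sorted_wrt (\<lambda>v w. spans_over e v w \<and> spans_over e w v)"

text \<open>The existence of limits and the transfer of thinness are interlocked: the transfer to
  \<open>v\<close> for the tail yields the summand \<open>h\<close>; then \<open>f - h\<close> is
  transferred to \<open>w\<close> by the tail, and \<open>h\<close> by its invariance along
  \<open>v\<close>.\<close>

lemma transfers_ex: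
  fixes e :: "'a::euclidean_space"
  assumes "directions e vs" "\<And>v. v \<in> set vs \<Longrightarrow> spans_over e v w"
  shows "\<exists>K. transfers e vs w K"
  using assms
proof (induction vs arbitrary: w)
  case Nil
  have "transfers e [] w 0"
    unfolding transfers_def
  proof safe
    fix f :: "'a \<Rightarrow> real" and C
    assume [measurable]: "f \<in> borel_measurable borel" and "annih [] f"
    then have "AE z in lborel. AE r::real in lborel. f (z + r *\<^sub>R w) = 0"
      using AE_lborel_translate_line[of "\<lambda>z. f z = 0" w] by simp
    then show "thin w (0 * C) f"
      unfolding thin_def
    proof eventually_elim
      fix z assume "AE r::real in lborel. f (z + r *\<^sub>R w) = 0"
      then have "off_level f z w 0 = emeasure lborel ({} :: real set)"
        by (intro emeasure_eq_AE sets_line_Collect) (auto elim!: eventually_mono)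
      then show "off_level f z w 0 \<le> ennreal (0 * C)" by simp
    qed
  qed
  then show ?case by blast
next
  case (Cons v vs)
  obtain K where K: "transfers e vs v K" using Cons by fastforce
  obtain L where L: "transfers e vs w L" using Cons by fastforce
  obtain N where N: "N \<ge> 0" "\<And>h C. h \<in> borel_measurable borel \<Longrightarrow> (\<And>z r. h (z + r *\<^sub>R v) = h z) \<Longrightarrow> 0 \<le> C \<Longrightarrow> thin e C h \<Longrightarrow> thin w (N * C) h"
    using thin_invariant_transfer[OF Cons.prems(2)[of v, simplified]] by blast
  \<comment> \<open>The factor 2 comes from \<open>f - h\<close>, which is thin along
    \<open>e\<close> with constant \<open>2 * C\<close>.\<close>
  have "transfers e (v # vs) w (L * 2 + N)"
    unfolding transfers_def
  proof (intro conjI allI impI)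
    show "0 \<le> L * 2 + N" using L N by (simp add: transfers_def)
    fix f :: "'a \<Rightarrow> real" and M C
    assume f: "f \<in> borel_measurable borel" "\<forall>z. \<bar>f z\<bar> \<le> M" "0 \<le> C" "thin e C f" "annih (v # vs) f"
    define h where "h = line_limit v f"
    note s = line_limit_split[OF f(1) f(2)[rule_format] f(3-5) K, folded h_def]
    have "thin w (L * (2 * C)) (\<lambda>z. f z - h z)"
      using f s by (intro transfersD[OF L _ s(8)]) auto
    moreover have "thin w (N * C) h"
      by (rule N(2)[OF s(1) s(3) f(3) s(5)])
    ultimately have "thin w (L * (2 * C) + N * C) (\<lambda>z. (f z - h z) - (- h z))"
      using L N f s by (intro thin_diff) (auto simp: transfers_def thin_def)
    then show "thin w ((L * 2 + N) * C) f" by (simp add: algebra_simps)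
  qed
  then show ?case by blast
qed

lemma directions_Cons_transfers:
  assumes "directions e (v # vs)"
  obtains K where "transfers e vs v K"
  using assms transfers_ex[of e vs v] by auto

text \<open>On almost every line of direction \<open>w\<close> the function \<open>h\<close> is 0
  off a set of finite measure, so every limit of \<open>f - h\<close> there is a limit of
  \<open>f\<close>.\<close>

lemma limit_values_diff:
  fixes f h :: "'a::euclidean_space \<Rightarrow> real"
  assumes [measurable]: "f \<in> borel_measurable borel" "h \<in> borel_measurable borel"
    and "thin w C h"
    and "AE z in lborel. \<forall>c. off_level f z w c < \<infinity> \<longrightarrow> P c"
  shows "AE z in lborel. \<forall>c. emeasure lborel {r::real. f (z + r *\<^sub>R w) - h (z + r *\<^sub>R w) \<noteq> c} < \<infinity> \<longrightarrow> P c"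
  using assms(3,4) unfolding thin_def
proof eventually_elim
  fix z
  assume h: "off_level h z w 0 \<le> ennreal C"
    and f: "\<forall>c. off_level f z w c < \<infinity> \<longrightarrow> P c"
  show "\<forall>c. emeasure lborel {r::real. f (z + r *\<^sub>R w) - h (z + r *\<^sub>R w) \<noteq> c} < \<infinity> \<longrightarrow> P c"
  proof (intro allI impI)
    fix c assume c: "emeasure lborel {r::real. f (z + r *\<^sub>R w) - h (z + r *\<^sub>R w) \<noteq> c} < \<infinity>"
    have m: "{r::real. f (z + r *\<^sub>R w) - h (z + r *\<^sub>R w) \<noteq> c} \<in> sets lborel"
      by (intro sets_Collect_lborel) measurable
    note mh = sets_line_Collect(1)[OF assms(2)]
    have "off_level f z w c \<le>
      emeasure lborel ({r::real. f (z + r *\<^sub>R w) - h (z + r *\<^sub>R w) \<noteq> c} \<union> {r::real. h (z + r *\<^sub>R w) \<noteq> 0})"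
      by (intro emeasure_mono sets.Un m mh) auto
    also have "\<dots> \<le> emeasure lborel {r::real. f (z + r *\<^sub>R w) - h (z + r *\<^sub>R w) \<noteq> c} + off_level h z w 0"
      by (intro emeasure_subadditive m mh)
    also have "\<dots> < \<infinity>" using c le_less_trans[OF h ennreal_less_top] by simp
    finally show "P c" using f by blast
  qed
qed

text \<open>In effect \<open>f\<close> is a sum of limits along the directions: subtracting one
  limit does not change the limits along the others, and nothing remains after the last.\<close>

lemma nonneg_of_limits:
  fixes f :: "'a::euclidean_space \<Rightarrow> real"
  assumes "directions e vs" "f \<in> borel_measurable borel" "\<And>z. \<bar>f z\<bar> \<le> M" "0 \<le> C" "thin e C f" "annih vs f"
    and "\<And>v. v \<in> set vs \<Longrightarrow> AE z in lborel. \<forall>c. off_level f z v c < \<infinity> \<longrightarrow> 0 \<le> c"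
  shows "AE z in lborel. 0 \<le> f z"
  using assms
proof (induction vs arbitrary: f M C)
  case Nil
  then show ?case by auto
next
  case (Cons v vs)
  obtain K where K: "transfers e vs v K" using directions_Cons_transfers[OF Cons.prems(1)] .
  define h where "h = line_limit v f"
  note s = line_limit_split[OF Cons.prems(2-6) K, folded h_def]
  note [measurable] = Cons.prems(2) s(1)
  have h0: "AE z in lborel. 0 \<le> h z"
    using s(4) Cons.prems(7)[of v] by (auto elim!: AE_mp)
  have "AE z in lborel. 0 \<le> f z - h z"
  proof (rule Cons.IH)
    show "directions e vs" using Cons.prems(1) by simp
    show "\<And>z. \<bar>f z - h z\<bar> \<le> 2 * M" by (rule s(8))
    show "AE z in lborel. \<forall>c. emeasure lborel {r::real. f (z + r *\<^sub>R w) - h (z + r *\<^sub>R w) \<noteq> c} < \<infinity> \<longrightarrow> 0 \<le> c"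
      if w: "w \<in> set vs" for w
    proof -
      have "spans_over e v w" using Cons.prems(1) w by auto
      from thin_invariant_transfer[OF this] obtain N where N: "N \<ge> 0" "thin w (N * C) h"
        using s(1,3,5) Cons.prems(4) by metis
      have "AE z in lborel. \<forall>c. off_level f z w c < \<infinity> \<longrightarrow> 0 \<le> c"
        using Cons.prems(7)[of w] w by auto
      with N(2) show ?thesis
        by (rule limit_values_diff[OF Cons.prems(2) s(1)])
    qed
  qed (use s Cons.prems(4) in auto)
  with h0 show ?case by eventually_elim simp
qed

text \<open>Translation by \<open>t *\<^sub>R w + s *\<^sub>R v\<close> acts on \<open>h\<close>
  like translation by \<open>t *\<^sub>R w\<close>, which leaves \<open>k\<close> unchanged. So
  \<open>k\<close> is disjoint from every translate of \<open>h\<close>, and a typical point where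
  \<open>k\<close> is nonzero forces \<open>h\<close> to vanish.\<close>

lemma disjoint_invariant:
  fixes k h :: "'a::euclidean_space \<Rightarrow> real"
  assumes [measurable]: "k \<in> borel_measurable borel" "h \<in> borel_measurable borel"
    and k: "\<And>t::real. AE z in lborel. k (z + t *\<^sub>R w) = k z"
    and h: "\<And>z r. h (z + r *\<^sub>R v) = h z"
    and kh: "AE z in lborel. k z * h z = 0"
    and span: "\<And>u. \<exists>t s. u = t *\<^sub>R w + s *\<^sub>R v"
  shows "(AE z in lborel. k z = 0) \<or> (AE z in lborel. h z = 0)"
proof (rule disjCI)
  assume nh: "\<not> (AE z in lborel. h z = 0)"
  have "AE z in lborel. k z = 0 \<or> h (z + u) = 0" for u
  proof -
    obtain t s where u: "u = t *\<^sub>R w + s *\<^sub>R v" using span by blast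
    have "h (z + u) = h (z + t *\<^sub>R w)" for z using h[of "z + t *\<^sub>R w" s] by (simp add: u add.assoc)
    with AE_lborel_translate[OF kh, of "t *\<^sub>R w"] k[of t] show ?thesis by auto
  qed
  then have "AE z in lborel. AE u in lborel. k z = 0 \<or> h (z + u) = 0"
    by (intro AE_lborel_swap) measurable
  then show "AE z in lborel. k z = 0"
  proof eventually_elim
    fix z assume *: "AE u in lborel. k z = 0 \<or> h (z + u) = 0"
    show "k z = 0"
    proof (rule ccontr)
      assume "k z \<noteq> 0"
      with * have "AE u in lborel. h (z + u) = 0" by simp
      from AE_lborel_translate[OF this, of "- z"] nh show False by simp
    qed
  qed
qed

text \<open>Splitting off the limit \<open>h\<close> of \<open>f\<close> along the first direction leaves a function that is again
  zero-one valued, hence by induction invariant in another direction \<open>w\<close>. Two such functions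
  can only be disjoint if one of them vanishes.\<close>

lemma zero_one_annihilated:
  fixes f :: "'a::euclidean_space \<Rightarrow> real"
  assumes "directions e vs" "f \<in> borel_measurable borel" "\<And>z. \<bar>f z\<bar> \<le> M" "0 \<le> C" "thin e C f" "annih vs f"
    and "AE z in lborel. f z \<in> {0, 1}"
    and "sorted_wrt (\<lambda>v w. \<forall>u. \<exists>t s. u = t *\<^sub>R w + s *\<^sub>R v) vs"
  shows "(AE z in lborel. f z = 0) \<or> (\<exists>v\<in>set vs. \<forall>t. AE z in lborel. f (z + t *\<^sub>R v) = f z)"
  using assms
proof (induction vs arbitrary: f M C)
  case Nil
  then show ?case by auto
next
  case (Cons v vs)
  obtain K where K: "transfers e vs v K" using directions_Cons_transfers[OF Cons.prems(1)] .
  define h where "h = line_limit v f"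
  note s = line_limit_split[OF Cons.prems(2-6) K, folded h_def]
  note [measurable] = Cons.prems(2) s(1)
  have lim: "AE z in lborel. \<forall>c. off_level f z w c < \<infinity> \<longrightarrow> c \<in> {0, 1}" for w
    using AE_lborel_translate_line[OF Cons.prems(7), of w]
  proof eventually_elim
    fix z assume *: "AE s in lborel. f (z + s *\<^sub>R w) \<in> {0, 1}"
    show "\<forall>c. off_level f z w c < \<infinity> \<longrightarrow> c \<in> {0, 1}"
    proof (intro allI impI)
      fix c assume c: "off_level f z w c < \<infinity>"
      have "{r::real. f (z + r *\<^sub>R w) \<noteq> c} \<in> sets borel"
        using sets_line_Collect(1)[OF Cons.prems(2)] by simp
      from AE_ex_not_in_finite_measure[OF * this c] show "c \<in> {0, 1}" by auto
    qed
  qed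
  have h01: "AE z in lborel. h z \<in> {0, 1}"
    using s(4) lim[of v] by (auto elim!: AE_mp)
  have "AE z in lborel. 0 \<le> f z - h z"
  proof (rule nonneg_of_limits[of e vs])
    show "directions e vs" using Cons.prems(1) by simp
    show "\<And>z. \<bar>f z - h z\<bar> \<le> 2 * M" by (rule s(8))
    show "AE z in lborel. \<forall>c. emeasure lborel {r::real. f (z + r *\<^sub>R w) - h (z + r *\<^sub>R w) \<noteq> c} < \<infinity> \<longrightarrow> 0 \<le> c"
      if w: "w \<in> set vs" for w
    proof -
      have "spans_over e v w" using Cons.prems(1) w by auto
      from thin_invariant_transfer[OF this] obtain N where N: "N \<ge> 0" "thin w (N * C) h"
        using s(1,3,5) Cons.prems(4) by metis
      from lim[of w] have "AE z in lborel. \<forall>c. off_level f z w c < \<infinity> \<longrightarrow> 0 \<le> c"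
        by eventually_elim force
      with N(2) show ?thesis
        by (rule limit_values_diff[OF Cons.prems(2) s(1)])
    qed
  qed (use s Cons.prems(4) in auto)
  \<comment> \<open>Nonnegativity excludes \<open>f z = 0\<close> with \<open>h z = 1\<close>. In
    the other three cases the difference is 0 or 1, and it is 0 where
    \<open>h z = 1\<close>.\<close>
  with Cons.prems(7) h01 have k01: "AE z in lborel. f z - h z \<in> {0, 1}" and kh: "AE z in lborel. (f z - h z) * h z = 0"
    by (auto elim!: AE_mp)
  have inv: "\<forall>t. AE z in lborel. f (z + t *\<^sub>R v) = f z" if "AE z in lborel. f z - h z = 0"
  proof
    fix t
    from AE_lborel_translate[OF that, of "t *\<^sub>R v"] that
    show "AE z in lborel. f (z + t *\<^sub>R v) = f z" by eventually_elim (simp add: s(3))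
  qed
  have "(AE z in lborel. f z - h z = 0) \<or> (\<exists>w\<in>set vs. \<forall>t. AE z in lborel. f (z + t *\<^sub>R w) - h (z + t *\<^sub>R w) = f z - h z)"
    using Cons.prems s k01 by (intro Cons.IH[OF _ _ s(8)]) auto
  then show ?case
  proof
    assume "AE z in lborel. f z - h z = 0"
    with inv show ?thesis by auto
  next
    assume "\<exists>w\<in>set vs. \<forall>t. AE z in lborel. f (z + t *\<^sub>R w) - h (z + t *\<^sub>R w) = f z - h z"
    then obtain w where w: "w \<in> set vs" "\<And>t. AE z in lborel. f (z + t *\<^sub>R w) - h (z + t *\<^sub>R w) = f z - h z"
      by blast
    have "(AE z in lborel. f z - h z = 0) \<or> (AE z in lborel. h z = 0)"
      using w Cons.prems(8) by (intro disjoint_invariant[OF _ s(1) w(2) s(3) kh]) auto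
    then show ?thesis
    proof
      assume h0: "AE z in lborel. h z = 0"
      have "AE z in lborel. f (z + t *\<^sub>R w) = f z" for t
        using w(2)[of t] h0 AE_lborel_translate[OF h0, of "t *\<^sub>R w"] by eventually_elim simp
      with w show ?thesis by auto
    qed (use inv in auto)
  qed
qed

section \<open>Blowing up at a point\<close>

text \<open>The determinant of the pair \<open>v\<close>, \<open>z\<close>. For nonzero
  \<open>v\<close> it vanishes exactly on the line through 0 along \<open>v\<close>.\<close>

definition cross :: "real \<times> real \<Rightarrow> real \<times> real \<Rightarrow> real" where
  "cross v z = fst v * snd z - snd v * fst z"

lemma cross_add: "cross v (y + z) = cross v y + cross v z"
  by (simp add: cross_def algebra_simps)

lemma cross_scale: "cross v (c *\<^sub>R z) = c * cross v z"
  by (simp add: cross_def algebra_simps)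

lemma cross_diff: "cross v (y - z) = cross v y - cross v z"
  by (simp add: cross_def algebra_simps)

lemma cross_self: "cross v v = 0"
  by (simp add: cross_def)

lemma cross_commute: "cross w v = - cross v w"
  by (simp add: cross_def)

text \<open>Cramer's rule, cleared of its denominator.\<close>

lemma cross_expand: "cross v w *\<^sub>R z = cross z w *\<^sub>R v + cross v z *\<^sub>R w"
  by (simp add: cross_def prod_eq_iff algebra_simps)

lemma AE_cross_neq:
  assumes "v \<noteq> 0"
  shows "AE z in lborel. cross v (z + u) \<noteq> 0"
proof -
  let ?a = "(- snd v, fst v)"
  have "?a \<noteq> 0" using assms by (auto simp: prod_eq_iff)
  then have "negligible {z. ?a \<bullet> z = - cross v u}" by (intro negligible_hyperplane) auto
  moreover have "(?a \<bullet> z = - cross v u) \<longleftrightarrow> cross v (z + u) = 0" for z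
    by (auto simp: cross_def inner_prod_def algebra_simps)
  ultimately have "{z. cross v (z + u) = 0} \<in> null_sets lebesgue"
    by (simp add: negligible_iff_null_sets)
  from AE_not_in[OF this] have "AE z in lebesgue. cross v (z + u) \<noteq> 0" by simp
  then show ?thesis by (simp add: AE_completion_iff)
qed

section \<open>Iterated differences of functions that are constant on sectors\<close>

primrec iterated_diff :: "(real \<times> 'a::real_vector) list \<Rightarrow> ('a \<Rightarrow> real) \<Rightarrow> 'a \<Rightarrow> real" where
  "iterated_diff [] f = f"
| "iterated_diff (p # ps) f = iterated_diff ps (\<lambda>z. f (z + fst p *\<^sub>R snd p) - f z)"

lemma diffs_borel:
  fixes f :: "'a::euclidean_space \<Rightarrow> real"
  shows "f \<in> borel_measurable borel \<Longrightarrow> iterated_diff ps f \<in> borel_measurable borel"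
proof (induction ps arbitrary: f)
  case (Cons p ps)
  note [measurable] = Cons.prems
  show ?case by (simp add: Cons.IH)
qed simp

lemma diffs_bounded: "(\<And>z. \<bar>f z\<bar> \<le> M) \<Longrightarrow> \<bar>iterated_diff ps f z\<bar> \<le> 2 ^ length ps * M"
proof (induction ps arbitrary: f M)
  case (Cons p ps)
  have "\<bar>f (z + fst p *\<^sub>R snd p) - f z\<bar> \<le> 2 * M" for z
    using Cons.prems[of z] Cons.prems[of "z + fst p *\<^sub>R snd p"] by linarith
  from Cons.IH[where f = "\<lambda>z. f (z + fst p *\<^sub>R snd p) - f z", OF this] show ?case
    by (simp add: mult_ac)
qed simp

lemma annih_diffs:
  "(\<And>ts. length ts = length vs \<Longrightarrow> AE z in lborel. iterated_diff (zip ts vs) f z = 0) \<Longrightarrow> annih vs f"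
proof (induction vs arbitrary: f)
  case Nil
  then show ?case using Nil[of "[]"] by simp
next
  case (Cons v vs)
  have "annih vs (\<lambda>z. f (z + t *\<^sub>R v) - f z)" for t
  proof (rule Cons.IH)
    fix ts :: "real list" assume "length ts = length vs"
    then show "AE z in lborel. iterated_diff (zip ts vs) (\<lambda>z. f (z + t *\<^sub>R v) - f z) z = 0"
      using Cons.prems[of "t # ts"] by simp
  qed
  then show ?case by simp
qed

lemma quadrant_null_difference:
  assumes "quadrant_null f" "f \<in> borel_measurable borel" "\<And>z. \<bar>f z\<bar> \<le> M"
  shows "quadrant_null (\<lambda>z. f (z + a) - f z)"
  unfolding quadrant_null_def
proof (intro allI impI)
  fix \<tau> \<zeta> :: "real \<times> real" and \<epsilon> :: real
  assume e: "0 < \<epsilon>" "\<epsilon> < fst \<zeta>" "\<epsilon> < snd \<zeta>"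
  have z: "(LINT x|lborel. of_real (f (x + \<tau>)) * packet \<epsilon> \<zeta> x) = 0" for \<tau>
    using assms(1) e unfolding quadrant_null_def by blast
  note i = integrable_bounded_kernel2(2)[OF assms(2,3) e(1)]
  have "(LINT x|lborel. of_real (f (x + \<tau> + a) - f (x + \<tau>)) * packet \<epsilon> \<zeta> x)
    = (LINT x|lborel. of_real (f (x + (\<tau> + a))) * packet \<epsilon> \<zeta> x - of_real (f (x + \<tau>)) * packet \<epsilon> \<zeta> x)"
    by (simp add: left_diff_distrib add.assoc)
  also have "\<dots> = 0" by (subst Bochner_Integration.integral_diff[OF i i]) (simp add: z)
  finally show "(LINT x|lborel. of_real (f (x + \<tau> + a) - f (x + \<tau>)) * packet \<epsilon> \<zeta> x) = 0" .
qed

lemma quadrant_null_diffs: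
  "quadrant_null f \<Longrightarrow> f \<in> borel_measurable borel \<Longrightarrow> (\<And>z. \<bar>f z\<bar> \<le> M) \<Longrightarrow> quadrant_null (iterated_diff ps f)"
proof (induction ps arbitrary: f M)
  case (Cons p ps)
  note [measurable] = Cons.prems(2)
  have "\<bar>f (z + fst p *\<^sub>R snd p) - f z\<bar> \<le> 2 * M" for z
    using Cons.prems(3)[of z] Cons.prems(3)[of "z + fst p *\<^sub>R snd p"] by linarith
  from Cons.IH[OF quadrant_null_difference[OF Cons.prems] _ this] show ?case by simp
qed simp

text \<open>An integrable function needs no cutoff: the scale of the kernel tends to 0, staying
  below both coordinates of \<open>\<zeta>\<close>, and in the limit the transform itself vanishes
  at \<open>\<zeta>\<close>.\<close>

lemma quadrant_null_bounded_support:
  assumes null: "quadrant_null g" and [measurable]: "g \<in> borel_measurable borel" and M: "\<And>z. \<bar>g z\<bar> \<le> M"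
    and supp: "AE z in lborel. R < norm z \<longrightarrow> g z = 0"
  shows "AE z in lborel. g z = 0"
proof -
  define h where "h z = (if R < norm z then 0 else g z)" for z
  have [measurable]: "h \<in> borel_measurable borel" unfolding h_def by measurable
  have gh: "AE z in lborel. g z = h z" using supp by eventually_elim (auto simp: h_def)
  have hM: "\<bar>h z\<bar> \<le> M" for z using M[of z] by (auto simp: h_def)
  have hR: "R < norm z \<Longrightarrow> h z = 0" for z by (simp add: h_def)
  have ih: "integrable lborel h" by (rule bounded_support_integrable[OF _ hM hR]) measurable
  have "quadrant_class h"
    unfolding quadrant_class_def
  proof (intro conjI allI impI)
    show "\<exists>M. \<forall>x. \<bar>h x\<bar> \<le> M" "\<exists>R. \<forall>x. R < norm x \<longrightarrow> h x = 0" using hM hR by blast+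
    fix \<zeta> :: "real \<times> real" assume \<zeta>: "0 < fst \<zeta>" "0 < snd \<zeta>"
    define m where "m = min (fst \<zeta>) (snd \<zeta>)"
    define X where "X n = m / 2 * inverse (real (Suc n))" for n
    have m: "0 < m" "m \<le> fst \<zeta>" "m \<le> snd \<zeta>" using \<zeta> by (auto simp: m_def)
    have X: "X \<longlonglongrightarrow> 0"
      unfolding X_def using tendsto_mult_right_zero[OF LIMSEQ_inverse_real_of_nat] by blast
    have X2: "0 < X n" "X n < m" for n
    proof -
      show "0 < X n" using m by (simp add: X_def)
      have "m / 2 * inverse (real (Suc n)) \<le> m / 2 * 1"
        using m by (intro mult_left_mono) (auto simp: inverse_le_1_iff)
      then show "X n < m" using m unfolding X_def by linarith
    qed
    have zero: "(LINT x|lborel. of_real (h x) * (kernel2 (X n *\<^sub>R x) * wave \<zeta> x)) = 0" for n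
    proof -
      have "X n < fst \<zeta>" "X n < snd \<zeta>" using X2[of n] m by auto
      with null X2(1)[of n] have "(LINT x|lborel. of_real (g (x + 0)) * (kernel2 (X n *\<^sub>R x) * wave \<zeta> x)) = 0"
        unfolding quadrant_null_def by blast
      moreover have "(LINT x|lborel. of_real (g (x + 0)) * (kernel2 (X n *\<^sub>R x) * wave \<zeta> x))
        = (LINT x|lborel. of_real (h x) * (kernel2 (X n *\<^sub>R x) * wave \<zeta> x))"
      proof (rule integral_cong_AE)
        show "AE x in lborel. of_real (g (x + 0)) * (kernel2 (X n *\<^sub>R x) * wave \<zeta> x) = of_real (h x) * (kernel2 (X n *\<^sub>R x) * wave \<zeta> x)"
          using gh by eventually_elim simp
      qed measurable
      ultimately show ?thesis by simp
    qed
    have "(\<lambda>n. LINT x|lborel. of_real (h x) * (kernel2 (X n *\<^sub>R x) * wave \<zeta> x)) \<longlonglongrightarrow> (LINT x|lborel. of_real (h x) * (kernel2 (0 *\<^sub>R x) * wave \<zeta> x))"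
    proof (rule integral_dominated_convergence[where w = "\<lambda>x. \<bar>h x\<bar>"])
      show "AE x in lborel. (\<lambda>n. of_real (h x) * (kernel2 (X n *\<^sub>R x) * wave \<zeta> x)) \<longlonglongrightarrow> of_real (h x) * (kernel2 (0 *\<^sub>R x) * wave \<zeta> x)"
        by (intro AE_I2 tendsto_intros continuous_on_tendsto_compose[OF continuous_kernel2[of UNIV]] X) auto
      show "AE x in lborel. norm (of_real (h x) * (kernel2 (X n *\<^sub>R x) * wave \<zeta> x)) \<le> \<bar>h x\<bar>" for n
        using mult_left_mono[OF norm_kernel2_le_1] by (intro AE_I2) (simp add: norm_mult mult_left_le norm_kernel2_le_1)
    qed (measurable, use ih in simp)
    then show "(LINT x|lborel. of_real (h x) * wave \<zeta> x) = 0"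
      unfolding zero by (simp add: kernel2_0 LIMSEQ_const_iff)
  qed measurable
  from quadrant_class_eq_0[OF this] gh show ?thesis by eventually_elim simp
qed

text \<open>The subset sums of the steps: the offsets at which an iterated difference samples its
  function.\<close>

primrec vertices :: "(real \<times> 'a::real_vector) list \<Rightarrow> 'a set" where
  "vertices [] = {0}"
| "vertices (p # ps) = vertices ps \<union> (\<lambda>u. u + fst p *\<^sub>R snd p) ` vertices ps"

lemma finite_vertices: "finite (vertices ps)"
  by (induction ps) auto

lemma diffs_eq_0:
  "(\<And>u. u \<in> vertices ps \<Longrightarrow> f (z + u) = 0) \<Longrightarrow> iterated_diff ps f z = 0"
proof (induction ps arbitrary: f)
  case (Cons p ps)
  have "iterated_diff ps (\<lambda>z. f (z + fst p *\<^sub>R snd p) - f z) z = 0"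
  proof (rule Cons.IH)
    fix u assume "u \<in> vertices ps"
    then show "f (z + u + fst p *\<^sub>R snd p) - f (z + u) = 0"
      using Cons.prems[of u] Cons.prems[of "u + fst p *\<^sub>R snd p"] by (simp add: add.assoc)
  qed
  then show ?case by simp
qed simp

text \<open>Differences commute, so the position of the invariant step in the list does not matter:
  a different first step hands the invariance on to the difference it forms.\<close>

lemma diffs_eq_0_invariant:
  assumes "p \<in> set ps" "\<And>u. u \<in> vertices ps \<Longrightarrow> f (z + u + fst p *\<^sub>R snd p) = f (z + u)"
  shows "iterated_diff ps f z = 0"
  using assms
proof (induction ps arbitrary: f)
  case (Cons q ps)
  show ?case
  proof (cases "p = q")
    case True
    have "iterated_diff ps (\<lambda>z. f (z + fst q *\<^sub>R snd q) - f z) z = 0"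
      using Cons.prems(2) True by (intro diffs_eq_0) auto
    then show ?thesis by simp
  next
    case False
    have "iterated_diff ps (\<lambda>z. f (z + fst q *\<^sub>R snd q) - f z) z = 0"
    proof (rule Cons.IH)
      show "p \<in> set ps" using Cons.prems(1) False by simp
      fix u assume u: "u \<in> vertices ps"
      have "f (z + (u + fst q *\<^sub>R snd q) + fst p *\<^sub>R snd p) = f (z + (u + fst q *\<^sub>R snd q))"
        using u by (intro Cons.prems(2)) simp
      moreover have "f (z + u + fst p *\<^sub>R snd p) = f (z + u)"
        using u by (intro Cons.prems(2)) simp
      moreover have "z + u + fst p *\<^sub>R snd p + fst q *\<^sub>R snd q = z + (u + fst q *\<^sub>R snd q) + fst p *\<^sub>R snd p"
        "z + u + fst q *\<^sub>R snd q = z + (u + fst q *\<^sub>R snd q)"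
        by (simp_all add: ac_simps)
      ultimately show "f (z + u + fst p *\<^sub>R snd p + fst q *\<^sub>R snd q) - f (z + u + fst p *\<^sub>R snd p) = f (z + u + fst q *\<^sub>R snd q) - f (z + u)"
        by (simp only:)
    qed
    then show ?thesis by simp
  qed
qed simp

text \<open>Constancy on connected sets that avoid the lines replaces an enumeration of the open
  sectors.\<close>

definition conic :: "(real \<times> real) set \<Rightarrow> (real \<times> real \<Rightarrow> real) \<Rightarrow> bool" where
  "conic V h \<longleftrightarrow> (\<forall>T. connected T \<longrightarrow> (\<forall>z\<in>T. \<forall>v\<in>V. cross v z \<noteq> 0) \<longrightarrow> (\<forall>y\<in>T. \<forall>z\<in>T. h y = h z))"

lemma conicD:
  assumes "conic V h" "connected T" "\<And>z v. z \<in> T \<Longrightarrow> v \<in> V \<Longrightarrow> cross v z \<noteq> 0" "y \<in> T" "z \<in> T"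
  shows "h y = h z"
  using assms unfolding conic_def by blast

text \<open>Where two of the determinants are at most \<open>c\<close>, Cramer's rule bounds the
  norm of \<open>z\<close>; \<open>R\<close> dominates these bounds over all pairs.\<close>

lemma far_from_all_but_one:
  assumes V: "finite V" "V \<noteq> {}" "\<And>v w. v \<in> V \<Longrightarrow> w \<in> V \<Longrightarrow> v \<noteq> w \<Longrightarrow> cross v w \<noteq> 0"
  shows "\<exists>R. \<forall>z :: real \<times> real. R < norm z \<longrightarrow> (\<exists>v\<in>V. \<forall>w\<in>V. w \<noteq> v \<longrightarrow> c < \<bar>cross w z\<bar>)"
proof -
  define F where "F p = c * (norm (fst p) + norm (snd p)) / \<bar>cross (fst p) (snd p)\<bar>" for p :: "(real \<times> real) \<times> (real \<times> real)"
  have "finite (F ` (V \<times> V))" using V by simp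
  then obtain R where R: "\<And>p. p \<in> V \<times> V \<Longrightarrow> F p \<le> R"
    using bdd_above_finite[of "F ` (V \<times> V)"] unfolding bdd_above_def by blast
  show ?thesis
  proof (intro exI[of _ R] allI impI)
    fix z :: "real \<times> real" assume z: "R < norm z"
    show "\<exists>v\<in>V. \<forall>w\<in>V. w \<noteq> v \<longrightarrow> c < \<bar>cross w z\<bar>"
    proof (rule ccontr)
      assume not: "\<not> ?thesis"
      obtain v0 where v0: "v0 \<in> V" using V by blast
      with not obtain v where v: "v \<in> V" "\<bar>cross v z\<bar> \<le> c" by (auto simp: not_less)
      with not obtain w where w: "w \<in> V" "w \<noteq> v" "\<bar>cross w z\<bar> \<le> c" by (auto simp: not_less)
      have pos: "0 < \<bar>cross v w\<bar>" using V(3)[of v w] v w by auto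
      have "\<bar>cross v w\<bar> * norm z = norm (cross z w *\<^sub>R v + cross v z *\<^sub>R w)"
        by (simp flip: cross_expand)
      also have "\<dots> \<le> \<bar>cross z w\<bar> * norm v + \<bar>cross v z\<bar> * norm w"
        by (rule order_trans[OF norm_triangle_ineq]) simp
      also have "\<dots> \<le> c * norm v + c * norm w"
        using v w cross_commute[of z w] by (intro add_mono mult_right_mono) auto
      finally have "norm z \<le> F (v, w)" using pos by (simp add: F_def field_simps)
      also have "\<dots> \<le> R" using v w by (intro R) simp
      finally show False using z by simp
    qed
  qed
qed

text \<open>Far out, a point is close to at most one of the lines, say the one along
  \<open>v\<close>. The step along \<open>v\<close> then keeps every sample in its sector, and this
  one vanishing difference kills the iterated one.\<close>

lemma diffs_conic_bounded_support:
  assumes h: "conic (set vs) h" and vs: "vs \<noteq> []" "0 \<notin> set vs"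
    "\<And>v w. v \<in> set vs \<Longrightarrow> w \<in> set vs \<Longrightarrow> v \<noteq> w \<Longrightarrow> cross v w \<noteq> 0"
    and len: "length ts = length vs"
  shows "\<exists>R. AE z in lborel. R < norm z \<longrightarrow> iterated_diff (zip ts vs) h z = 0"
proof -
  let ?ps = "zip ts vs"
  \<comment> \<open>An upper bound \<open>c\<close> of \<open>F\<close> limits the change of
    \<open>cross w\<close> from \<open>z\<close> to any sample and along one more step, so
    \<open>cross w\<close> stays nonzero if it exceeds \<open>c\<close> in absolute value at
    \<open>z\<close>.\<close>
  define F where "F = (\<lambda>(w, u, p). \<bar>cross w u\<bar> + \<bar>cross w (fst p *\<^sub>R snd p)\<bar>)"
  have "finite (F ` (set vs \<times> vertices ?ps \<times> set ?ps))" by (simp add: finite_vertices)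
  then obtain c where c: "\<And>x. x \<in> set vs \<times> vertices ?ps \<times> set ?ps \<Longrightarrow> F x \<le> c"
    using bdd_above_finite[of "F ` (set vs \<times> vertices ?ps \<times> set ?ps)"] unfolding bdd_above_def by blast
  obtain R where R: "\<And>z. R < norm z \<Longrightarrow> \<exists>v\<in>set vs. \<forall>w\<in>set vs. w \<noteq> v \<longrightarrow> c < \<bar>cross w z\<bar>"
    using far_from_all_but_one[of "set vs" c] vs by auto
  have "AE z in lborel. \<forall>u\<in>vertices ?ps. \<forall>v\<in>set vs. cross v (z + u) \<noteq> 0"
    using vs by (intro AE_finite_allI finite_vertices finite_set AE_cross_neq) auto
  then have "AE z in lborel. R < norm z \<longrightarrow> iterated_diff ?ps h z = 0"
  proof eventually_elim
    fix z assume gen: "\<forall>u\<in>vertices ?ps. \<forall>v\<in>set vs. cross v (z + u) \<noteq> 0"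
    show "R < norm z \<longrightarrow> iterated_diff ?ps h z = 0"
    proof
      assume "R < norm z"
      then obtain v where v: "v \<in> set vs" "\<And>w. w \<in> set vs \<Longrightarrow> w \<noteq> v \<Longrightarrow> c < \<bar>cross w z\<bar>"
        using R by blast
      then obtain t where p: "(t, v) \<in> set ?ps"
        using len by (metis in_set_impl_in_set_zip2)
      show "iterated_diff ?ps h z = 0"
      proof (rule diffs_eq_0_invariant[OF p])
        fix u assume u: "u \<in> vertices ?ps"
        show "h (z + u + fst (t, v) *\<^sub>R snd (t, v)) = h (z + u)"
        proof (rule conicD[OF h, where T = "(\<lambda>s. z + u + s *\<^sub>R (t *\<^sub>R v)) ` {0..1}"])
          show "connected ((\<lambda>s. z + u + s *\<^sub>R (t *\<^sub>R v)) ` {0..1})"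
            by (intro connected_continuous_image continuous_intros) simp
          show "z + u + fst (t, v) *\<^sub>R snd (t, v) \<in> (\<lambda>s. z + u + s *\<^sub>R (t *\<^sub>R v)) ` {0..1}"
            by (rule image_eqI[of _ _ 1]) auto
          show "z + u \<in> (\<lambda>s. z + u + s *\<^sub>R (t *\<^sub>R v)) ` {0..1}"
            by (rule image_eqI[of _ _ 0]) auto
          fix q w assume "q \<in> (\<lambda>s. z + u + s *\<^sub>R (t *\<^sub>R v)) ` {0..1}" and w: "w \<in> set vs"
          then obtain s where s: "0 \<le> s" "s \<le> 1" "q = z + u + s *\<^sub>R (t *\<^sub>R v)" by auto
          show "cross w q \<noteq> 0"
          proof (cases "w = v")
            case True
            then show ?thesis using gen u w by (simp add: s cross_add cross_scale cross_self)
          next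
            case False
            have "\<bar>cross w u\<bar> + \<bar>cross w (t *\<^sub>R v)\<bar> \<le> c"
              using c[of "(w, u, (t, v))"] w u p by (simp add: F_def)
            moreover have "\<bar>cross w (s *\<^sub>R (t *\<^sub>R v))\<bar> \<le> \<bar>cross w (t *\<^sub>R v)\<bar>"
              unfolding cross_scale[of w s] abs_mult using s by (intro mult_left_le_one_le) auto
            ultimately show ?thesis
              using v(2)[OF w False] unfolding s cross_add by linarith
          qed
        qed
      qed
    qed
  qed
  then show ?thesis by blast
qed

lemma conic_annih:
  assumes h: "conic (set vs) h" "quadrant_null h" "h \<in> borel_measurable borel" "\<And>z. \<bar>h z\<bar> \<le> M"
    and vs: "vs \<noteq> []" "0 \<notin> set vs"
    "\<And>v w. v \<in> set vs \<Longrightarrow> w \<in> set vs \<Longrightarrow> v \<noteq> w \<Longrightarrow> cross v w \<noteq> 0"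
  shows "annih vs h"
proof (rule annih_diffs)
  fix ts :: "real list" assume "length ts = length vs"
  from diffs_conic_bounded_support[OF h(1) vs this] obtain R
    where "AE z in lborel. R < norm z \<longrightarrow> iterated_diff (zip ts vs) h z = 0" by blast
  from quadrant_null_bounded_support[OF quadrant_null_diffs[OF h(2-4)] diffs_borel[OF h(3)] diffs_bounded[OF h(4)] this]
  show "AE z in lborel. iterated_diff (zip ts vs) h z = 0" .
qed

section \<open>Blow-ups\<close>

definition conic_at :: "(real \<times> real) set \<Rightarrow> (real \<times> real \<Rightarrow> real) \<Rightarrow> real \<times> real \<Rightarrow> real \<Rightarrow> bool" where
  "conic_at V f p r \<longleftrightarrow> 0 < r \<and> (\<forall>T. connected T \<longrightarrow> T \<subseteq> ball p r \<longrightarrow> (\<forall>z\<in>T. \<forall>v\<in>V. cross v (z - p) \<noteq> 0)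
     \<longrightarrow> (\<forall>y\<in>T. \<forall>z\<in>T. f y = f z))"

lemma conic_atD:
  assumes "conic_at V f p r" "connected T" "T \<subseteq> ball p r" "\<And>z v. z \<in> T \<Longrightarrow> v \<in> V \<Longrightarrow> cross v (z - p) \<noteq> 0"
    "y \<in> T" "z \<in> T"
  shows "f y = f z"
  using assms unfolding conic_at_def by blast

text \<open>The blow-up of \<open>f\<close> at \<open>p\<close>: the plane is mapped radially into the ball in which \<open>f\<close> is conic.\<close>

definition tangent :: "(real \<times> real \<Rightarrow> real) \<Rightarrow> real \<times> real \<Rightarrow> real \<Rightarrow> real \<times> real \<Rightarrow> real" where
  "tangent f p r x = f (p + (r / (1 + norm x)) *\<^sub>R x)"

lemma tangent_borel [measurable]:
  assumes "f \<in> borel_measurable borel"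
  shows "tangent f p r \<in> borel_measurable borel"
proof -
  have "continuous_on UNIV (\<lambda>x. p + (r / (1 + norm x)) *\<^sub>R x)"
    by (intro continuous_intros) (metis add_nonneg_eq_0_iff norm_ge_zero zero_le_one zero_neq_one)
  from measurable_compose[OF borel_measurable_continuous_onI[OF this] assms] show ?thesis
    by (simp add: tangent_def[abs_def])
qed

lemma conic_tangent:
  assumes c: "conic_at V f p r"
  shows "conic V (tangent f p r)"
  unfolding conic_def
proof (intro allI impI ballI)
  fix T y z assume T: "connected T" "\<forall>z\<in>T. \<forall>v\<in>V. cross v z \<noteq> 0" "y \<in> T" "z \<in> T"
  let ?g = "\<lambda>x. p + (r / (1 + norm x)) *\<^sub>R x"
  have r: "0 < r" using c by (simp add: conic_at_def)
  have n: "0 < 1 + norm x" for x :: "real \<times> real" by (simp add: add_pos_nonneg)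
  have "f (?g y) = f (?g z)"
  proof (rule conic_atD[OF c, of "?g ` T"])
    have "continuous_on T ?g"
      by (intro continuous_intros) (metis add_nonneg_eq_0_iff norm_ge_zero zero_le_one zero_neq_one)
    then show "connected (?g ` T)" by (rule connected_continuous_image) (rule T)
    show "?g ` T \<subseteq> ball p r"
    proof (rule image_subsetI)
      fix x :: "real \<times> real"
      have "norm ((r / (1 + norm x)) *\<^sub>R x) = r * (norm x / (1 + norm x))"
        using r n[of x] by simp
      also have "\<dots> < r * 1" using r n[of x] by (intro mult_strict_left_mono) (simp_all add: divide_less_eq)
      finally show "?g x \<in> ball p r" by (simp add: dist_norm)
    qed
    show "cross v (w - p) \<noteq> 0" if w: "w \<in> ?g ` T" and v: "v \<in> V" for w v
    proof -
      obtain x where "x \<in> T" "w = ?g x" by (rule imageE[OF w])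
      moreover have "1 + norm x \<noteq> 0" using n[of x] by linarith
      ultimately show ?thesis using T(2) v r by (simp add: cross_scale)
    qed
  qed (use T in auto)
  then show "tangent f p r y = tangent f p r z" by (simp add: tangent_def)
qed

text \<open>The point \<open>p + x\<close> and its compressed image lie on one open ray from
  \<open>p\<close> inside the ball, hence in one sector.\<close>

lemma tangent_eq:
  assumes c: "conic_at V f p r" and x: "\<And>v. v \<in> V \<Longrightarrow> cross v x \<noteq> 0" "norm x < r"
  shows "f (p + x) = tangent f p r x"
proof (cases "x = 0")
  case False
  have r: "0 < r" using c by (simp add: conic_at_def)
  let ?T = "(\<lambda>s. p + s *\<^sub>R x) ` {0<..<r / norm x}"
  have "f (p + x) = f (p + (r / (1 + norm x)) *\<^sub>R x)"
  proof (rule conic_atD[OF c, of ?T])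
    show "connected ?T" by (intro connected_continuous_image continuous_intros) simp
    show "?T \<subseteq> ball p r" using False by (auto simp: dist_norm field_simps)
    show "cross v (z - p) \<noteq> 0" if "z \<in> ?T" "v \<in> V" for z v
      using that x(1)[of v] by (auto simp: cross_scale)
    show "p + x \<in> ?T" using x(2) False by (intro image_eqI[of _ _ 1]) auto
    show "p + (r / (1 + norm x)) *\<^sub>R x \<in> ?T"
      using r False by (intro image_eqI[OF refl]) (auto simp: add_pos_nonneg intro!: divide_strict_left_mono)
  qed
  then show ?thesis by (simp add: tangent_def)
qed (simp add: tangent_def)

lemma conic_scale:
  assumes "conic V h" "\<And>v. v \<in> V \<Longrightarrow> cross v x \<noteq> 0" "0 < s"
  shows "h (s *\<^sub>R x) = h x"
proof (rule conicD[OF assms(1), of "(\<lambda>s. s *\<^sub>R x) ` {0<..}"])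
  show "connected ((\<lambda>s. s *\<^sub>R x) ` {0<..})" by (intro connected_continuous_image continuous_intros) simp
  show "x \<in> (\<lambda>s. s *\<^sub>R x) ` {0<..}" by (intro image_eqI[of _ _ 1]) auto
qed (use assms in \<open>auto simp: cross_scale\<close>)

lemma lborel_integral_scale:
  fixes G :: "'a::euclidean_space \<Rightarrow> 'b::{banach, second_countable_topology}"
  assumes [measurable]: "G \<in> borel_measurable borel" and "0 < c"
  shows "(LINT x|lborel. G x) = c ^ DIM('a) *\<^sub>R (LINT x|lborel. G (c *\<^sub>R x))"
proof -
  have "(LINT x|lborel. G x) = (LINT x|density (distr lborel borel (\<lambda>x. 0 + c *\<^sub>R x)) (\<lambda>_. \<bar>c\<bar> ^ DIM('a)). G x)"
    using lborel_affine[of c "0 :: 'a"] assms by simp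
  also have "\<dots> = (LINT x|distr lborel borel (\<lambda>x. 0 + c *\<^sub>R x). (\<bar>c\<bar> ^ DIM('a)) *\<^sub>R G x)"
    by (subst integral_density) simp_all
  also have "\<dots> = (LINT x|lborel. (\<bar>c\<bar> ^ DIM('a)) *\<^sub>R G (0 + c *\<^sub>R x))"
    by (subst integral_distr) simp_all
  finally show ?thesis using assms by simp
qed

text \<open>Dilation divides the frequency and the width of the box by the same factor, and the
  quadrant is a cone.\<close>

lemma quadrant_null_scale:
  assumes null: "quadrant_null f" and [measurable]: "f \<in> borel_measurable borel" and "0 < c"
  shows "quadrant_null (\<lambda>x. f (p + c *\<^sub>R x))"
  unfolding quadrant_null_def
proof (intro allI impI)
  fix \<tau> \<zeta> :: "real \<times> real" and \<epsilon> :: real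
  assume \<epsilon>: "0 < \<epsilon>" "\<epsilon> < fst \<zeta>" "\<epsilon> < snd \<zeta>"
  define G where "G y = of_real (f (y + (p + c *\<^sub>R \<tau>))) * (kernel2 ((\<epsilon> / c) *\<^sub>R y) * wave (inverse c *\<^sub>R \<zeta>) y)" for y
  have [measurable]: "G \<in> borel_measurable borel" unfolding G_def by measurable
  have "\<epsilon> / c < fst (inverse c *\<^sub>R \<zeta>)" "\<epsilon> / c < snd (inverse c *\<^sub>R \<zeta>)" "0 < \<epsilon> / c"
    using \<epsilon> \<open>0 < c\<close> by (simp_all add: divide_inverse mult.commute)
  with null have "(LINT y|lborel. G y) = 0"
    unfolding quadrant_null_def G_def by blast
  then have "(LINT x|lborel. G (c *\<^sub>R x)) = 0"
    using lborel_integral_scale[of G c] \<open>0 < c\<close> by simp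
  moreover have "G (c *\<^sub>R x) = of_real (f (p + c *\<^sub>R (x + \<tau>))) * packet \<epsilon> \<zeta> x" for x
  proof -
    have "c *\<^sub>R x + (p + c *\<^sub>R \<tau>) = p + c *\<^sub>R (x + \<tau>)" by (simp add: scaleR_add_right add_ac)
    moreover have "(c *\<^sub>R x) \<bullet> (inverse c *\<^sub>R \<zeta>) = x \<bullet> \<zeta>" "(\<epsilon> / c) *\<^sub>R (c *\<^sub>R x) = \<epsilon> *\<^sub>R x"
      using \<open>0 < c\<close> by simp_all
    ultimately show ?thesis by (simp only: G_def wave_def)
  qed
  ultimately show "(LINT x|lborel. of_real (f (p + c *\<^sub>R (x + \<tau>))) * packet \<epsilon> \<zeta> x) = 0"
    by simp
qed

text \<open>Every zoom of \<open>f\<close> at \<open>p\<close> satisfies the condition. At a point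
  off the lines the zooms equal the blow-up as soon as the scale is small, because the blow-up is
  constant along rays; the bound \<open>M\<close> gives the domination.\<close>

lemma quadrant_null_tangent:
  assumes null: "quadrant_null f" and f [measurable]: "f \<in> borel_measurable borel" and M: "\<And>x. \<bar>f x\<bar> \<le> M"
    and c: "conic_at V f p r" and V: "finite V" "0 \<notin> V"
  shows "quadrant_null (tangent f p r)"
  unfolding quadrant_null_def
proof (intro allI impI)
  fix \<tau> \<zeta> :: "real \<times> real" and \<epsilon> :: real
  assume \<epsilon>: "0 < \<epsilon>" "\<epsilon> < fst \<zeta>" "\<epsilon> < snd \<zeta>"
  define X where "X n = inverse (real (Suc n))" for n
  have X: "X \<longlonglongrightarrow> 0" "\<And>n. 0 < X n"
    using LIMSEQ_inverse_real_of_nat by (simp_all add: X_def[abs_def])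
  have r: "0 < r" using c by (simp add: conic_at_def)
  have M0: "0 \<le> M" using M[of 0] by linarith
  let ?k = "\<lambda>x. packet \<epsilon> \<zeta> x"
  have zero: "(LINT x|lborel. of_real (f (p + X n *\<^sub>R (x + \<tau>))) * ?k x) = 0" for n
    using quadrant_null_scale[OF null f X(2)] \<epsilon> unfolding quadrant_null_def by blast
  have "(\<lambda>n. LINT x|lborel. of_real (f (p + X n *\<^sub>R (x + \<tau>))) * ?k x) \<longlonglongrightarrow> (LINT x|lborel. of_real (tangent f p r (x + \<tau>)) * ?k x)"
  proof (rule integral_dominated_convergence[where w = "\<lambda>x. M * norm (kernel2 (\<epsilon> *\<^sub>R x))"])
    show "integrable lborel (\<lambda>x. M * norm (kernel2 (\<epsilon> *\<^sub>R x)))"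
      using kernel2_integrable[OF \<epsilon>(1)] by simp
    show "AE x in lborel. norm (of_real (f (p + X n *\<^sub>R (x + \<tau>))) * ?k x) \<le> M * norm (kernel2 (\<epsilon> *\<^sub>R x))" for n
      using M by (intro AE_I2) (simp add: norm_mult mult_right_mono)
    have "AE x in lborel. \<forall>v\<in>V. cross v (x + \<tau>) \<noteq> 0"
      using V by (intro AE_finite_allI AE_cross_neq) auto
    then show "AE x in lborel. (\<lambda>n. of_real (f (p + X n *\<^sub>R (x + \<tau>))) * ?k x) \<longlonglongrightarrow> of_real (tangent f p r (x + \<tau>)) * ?k x"
    proof eventually_elim
      fix x assume gen: "\<forall>v\<in>V. cross v (x + \<tau>) \<noteq> 0"
      have "(\<lambda>n. norm (X n *\<^sub>R (x + \<tau>))) \<longlonglongrightarrow> norm (0 *\<^sub>R (x + \<tau>))"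
        by (intro tendsto_intros X)
      then have "\<forall>\<^sub>F n in sequentially. norm (X n *\<^sub>R (x + \<tau>)) < r"
        using order_tendstoD(2)[of _ "norm (0 *\<^sub>R (x + \<tau>))" sequentially r] r by simp
      then have "\<forall>\<^sub>F n in sequentially. of_real (f (p + X n *\<^sub>R (x + \<tau>))) * ?k x = of_real (tangent f p r (x + \<tau>)) * ?k x"
      proof eventually_elim
        fix n assume n: "norm (X n *\<^sub>R (x + \<tau>)) < r"
        have "f (p + X n *\<^sub>R (x + \<tau>)) = tangent f p r (X n *\<^sub>R (x + \<tau>))"
          using gen X(2)[of n] by (intro tangent_eq[OF c _ n]) (simp add: cross_scale)
        also have "\<dots> = tangent f p r (x + \<tau>)"
          using gen by (intro conic_scale[OF conic_tangent[OF c]] X(2)) auto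
        finally show "of_real (f (p + X n *\<^sub>R (x + \<tau>))) * ?k x = of_real (tangent f p r (x + \<tau>)) * ?k x" by simp
      qed
      then show "(\<lambda>n. of_real (f (p + X n *\<^sub>R (x + \<tau>))) * ?k x) \<longlonglongrightarrow> of_real (tangent f p r (x + \<tau>)) * ?k x"
        by (rule tendsto_eventually)
    qed
  qed measurable
  then show "(LINT x|lborel. of_real (tangent f p r (x + \<tau>)) * ?k x) = 0"
    unfolding zero by (simp add: LIMSEQ_const_iff)
qed

section \<open>From local to global difference equations\<close>

primrec local_annih :: "real \<Rightarrow> 'a::euclidean_space set \<Rightarrow> 'a list \<Rightarrow> ('a \<Rightarrow> real) \<Rightarrow> bool" where
  "local_annih \<delta> B [] f \<longleftrightarrow> (AE z in lborel. z \<in> B \<longrightarrow> f z = 0)"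
| "local_annih \<delta> B (v # vs) f \<longleftrightarrow> (\<forall>t. \<bar>t\<bar> \<le> \<delta> \<longrightarrow> local_annih \<delta> B vs (\<lambda>z. f (z + t *\<^sub>R v) - f z))"

lemma local_annih_mono:
  "local_annih \<delta> B vs f \<Longrightarrow> \<delta>' \<le> \<delta> \<Longrightarrow> B' \<subseteq> B \<Longrightarrow> local_annih \<delta>' B' vs f"
proof (induction vs arbitrary: f)
  case Nil
  then show ?case by (auto elim!: eventually_mono)
qed auto

lemma local_annih_UN:
  "finite I \<Longrightarrow> (\<And>i. i \<in> I \<Longrightarrow> local_annih \<delta> (B i) vs f) \<Longrightarrow> local_annih \<delta> (\<Union>i\<in>I. B i) vs f"
proof (induction vs arbitrary: f)
  case Nil
  then have "AE z in lborel. \<forall>i\<in>I. z \<in> B i \<longrightarrow> f z = 0"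
    by (intro AE_finite_allI) auto
  then show ?case by (auto elim!: eventually_mono)
qed auto

lemma local_annih_add:
  "local_annih \<delta> B vs f \<Longrightarrow> local_annih \<delta> B vs g \<Longrightarrow> local_annih \<delta> B vs (\<lambda>z. f z + g z)"
proof (induction vs arbitrary: f g)
  case Nil
  then show ?case by (auto elim!: AE_mp)
next
  case (Cons v vs)
  have "local_annih \<delta> B vs (\<lambda>z. (f (z + t *\<^sub>R v) - f z) + (g (z + t *\<^sub>R v) - g z))" if "\<bar>t\<bar> \<le> \<delta>" for t
    using Cons.prems that by (intro Cons.IH) auto
  then show ?case by (simp add: algebra_simps)
qed

lemma local_annih_0: "local_annih \<delta> B vs (\<lambda>z. 0)"
  by (induction vs) auto

lemma local_annih_translate:
  "local_annih \<delta> ((\<lambda>z. z + a) ` B) vs f \<Longrightarrow> local_annih \<delta> B vs (\<lambda>z. f (z + a))"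
proof (induction vs arbitrary: f)
  case Nil
  from AE_lborel_translate[OF Nil[simplified], of a] show ?case by (auto elim!: eventually_mono)
next
  case (Cons v vs)
  have "local_annih \<delta> B vs (\<lambda>z. f ((z + a) + t *\<^sub>R v) - f (z + a))" if "\<bar>t\<bar> \<le> \<delta>" for t
    using Cons.prems that by (intro Cons.IH[where f = "\<lambda>z. f (z + t *\<^sub>R v) - f z"]) auto
  then show ?case by (simp add: ac_simps)
qed

text \<open>Only the base point is confined to the ball of radius \<open>\<rho>\<close>. The samples
  stray from it by at most \<open>\<delta>\<close> times the sum of the norms, which is the loss of
  radius.\<close>

lemma local_annih_of_annih:
  assumes "annih vs g" "AE z in lborel. z \<in> ball p \<rho>' \<longrightarrow> f z = g z"
    and "0 \<le> \<delta>" "\<rho> + \<delta> * (\<Sum>v\<leftarrow>vs. norm v) \<le> \<rho>'"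
  shows "local_annih \<delta> (ball p \<rho>) vs f"
  using assms
proof (induction vs arbitrary: f g \<rho>')
  case Nil
  from Nil(1)[simplified] Nil(2) show ?case
    using Nil(4) by (auto elim!: AE_mp)
next
  case (Cons v vs)
  have "local_annih \<delta> (ball p \<rho>) vs (\<lambda>z. f (z + t *\<^sub>R v) - f z)" if t: "\<bar>t\<bar> \<le> \<delta>" for t
  proof (rule Cons.IH[where \<rho>' = "\<rho>' - \<delta> * norm v"])
    show "annih vs (\<lambda>z. g (z + t *\<^sub>R v) - g z)" using Cons.prems(1) by simp
    show "AE z in lborel. z \<in> ball p (\<rho>' - \<delta> * norm v) \<longrightarrow> f (z + t *\<^sub>R v) - f z = g (z + t *\<^sub>R v) - g z"
      using Cons.prems(2) AE_lborel_translate[OF Cons.prems(2), of "t *\<^sub>R v"]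
    proof eventually_elim
      fix z
      assume 1: "z \<in> ball p \<rho>' \<longrightarrow> f z = g z" and 2: "z + t *\<^sub>R v \<in> ball p \<rho>' \<longrightarrow> f (z + t *\<^sub>R v) = g (z + t *\<^sub>R v)"
      show "z \<in> ball p (\<rho>' - \<delta> * norm v) \<longrightarrow> f (z + t *\<^sub>R v) - f z = g (z + t *\<^sub>R v) - g z"
      proof
        assume "z \<in> ball p (\<rho>' - \<delta> * norm v)"
        then have z: "dist p z < \<rho>' - \<delta> * norm v" by simp
        have n: "norm (t *\<^sub>R v) \<le> \<delta> * norm v" using t by (simp add: mult_right_mono)
        have "0 \<le> \<delta> * norm v" using Cons.prems(3) by simp
        then have "z \<in> ball p \<rho>'" using z by simp
        moreover have "dist p (z + t *\<^sub>R v) \<le> dist p z + norm (t *\<^sub>R v)"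
          using dist_triangle[of p "z + t *\<^sub>R v" z] by (simp add: dist_norm)
        then have "z + t *\<^sub>R v \<in> ball p \<rho>'" using z n by simp
        ultimately show "f (z + t *\<^sub>R v) - f z = g (z + t *\<^sub>R v) - g z" using 1 2 by simp
      qed
    qed
  qed (use Cons.prems in \<open>auto simp: algebra_simps\<close>)
  then show ?case by simp
qed

lemma annih_translate:
  "annih vs f \<Longrightarrow> annih vs (\<lambda>z. f (z + a))"
proof (induction vs arbitrary: f)
  case Nil
  then show ?case using AE_lborel_translate[of "\<lambda>z. f z = 0" a] by simp
next
  case (Cons v vs)
  have "annih vs (\<lambda>z. f ((z + a) + t *\<^sub>R v) - f (z + a))" for t
    using Cons.prems by (intro Cons.IH[where f = "\<lambda>z. f (z + t *\<^sub>R v) - f z"]) auto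
  then show ?case by (simp add: ac_simps)
qed

text \<open>A difference of step \<open>t\<close> is a sum of translates of differences of step \<open>t / n\<close>.\<close>

lemma annih_of_local:
  fixes f :: "'a::euclidean_space \<Rightarrow> real"
  assumes "\<And>N. \<exists>\<delta>>0. local_annih \<delta> (ball 0 N) vs f"
  shows "annih vs f"
  using assms
proof (induction vs arbitrary: f)
  case Nil
  have "AE z in lborel. \<forall>n::nat. z \<in> ball 0 (real n) \<longrightarrow> f z = 0"
    unfolding AE_all_countable using Nil by auto
  then have "AE z in lborel. f z = 0"
  proof eventually_elim
    fix z assume *: "\<forall>n::nat. z \<in> ball 0 (real n) \<longrightarrow> f z = 0"
    obtain n :: nat where "norm z < real n" using reals_Archimedean2 by blast
    with * show "f z = 0" by (metis dist_0_norm mem_ball)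
  qed
  then show ?case by simp
next
  case (Cons v vs)
  have "annih vs (\<lambda>z. f (z + t *\<^sub>R v) - f z)" for t
  proof (rule Cons.IH)
    fix N :: real
    \<comment> \<open>The larger ball contains all intermediate points of the chain from
      \<open>z\<close> to \<open>z + t *\<^sub>R v\<close>.\<close>
    obtain \<delta> where \<delta>: "\<delta> > 0" "local_annih \<delta> (ball 0 (N + \<bar>t\<bar> * norm v)) (v # vs) f"
      using Cons.prems by blast
    obtain n :: nat where n: "\<bar>t\<bar> / \<delta> < real n" using reals_Archimedean2 by blast
    have n0: "0 < real n" using n \<delta>(1) by (metis abs_ge_zero divide_nonneg_pos le_less_trans)
    define s where "s = t / real n"
    have t: "t = real n * s" using n0 by (simp add: s_def)
    have "\<bar>s\<bar> \<le> \<delta>" using n n0 \<delta>(1) by (simp add: s_def abs_divide field_simps)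
    with \<delta>(2) have s: "local_annih \<delta> (ball 0 (N + \<bar>t\<bar> * norm v)) vs (\<lambda>z. f (z + s *\<^sub>R v) - f z)" by simp
    have "local_annih \<delta> (ball 0 N) vs (\<lambda>z. f (z + (real k * s) *\<^sub>R v) - f z)" if "k \<le> n" for k
      using that
    proof (induction k)
      case 0
      then show ?case by (simp add: local_annih_0)
    next
      case (Suc k)
      have "local_annih \<delta> (ball 0 N) vs (\<lambda>z. f ((z + (real k * s) *\<^sub>R v) + s *\<^sub>R v) - f (z + (real k * s) *\<^sub>R v))"
      proof (rule local_annih_translate[where f = "\<lambda>z. f (z + s *\<^sub>R v) - f z"], rule local_annih_mono[OF s order_refl])
        show "(\<lambda>z. z + (real k * s) *\<^sub>R v) ` ball 0 N \<subseteq> ball 0 (N + \<bar>t\<bar> * norm v)"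
        proof clarify
          fix z :: 'a assume "z \<in> ball 0 N"
          then have z: "norm z < N" by simp
          have "\<bar>real k * s\<bar> \<le> \<bar>t\<bar>" unfolding t abs_mult using Suc.prems by (intro mult_right_mono) auto
          then have "norm ((real k * s) *\<^sub>R v) \<le> \<bar>t\<bar> * norm v" by (simp only: norm_scaleR mult_right_mono norm_ge_zero)
          with z norm_triangle_ineq[of z "(real k * s) *\<^sub>R v"] show "z + (real k * s) *\<^sub>R v \<in> ball 0 (N + \<bar>t\<bar> * norm v)"
            unfolding mem_ball dist_0_norm by linarith
        qed
      qed
      then have "local_annih \<delta> (ball 0 N) vs (\<lambda>z. (f ((z + (real k * s) *\<^sub>R v) + s *\<^sub>R v) - f (z + (real k * s) *\<^sub>R v)) + (f (z + (real k * s) *\<^sub>R v) - f z))"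
        using Suc by (intro local_annih_add) auto
      moreover have "(z + (real k * s) *\<^sub>R v) + s *\<^sub>R v = z + (real (Suc k) * s) *\<^sub>R v" for z
        by (simp add: algebra_simps)
      ultimately show ?case by simp
    qed
    from this[of n] show "\<exists>\<delta>>0. local_annih \<delta> (ball 0 N) vs (\<lambda>z. f (z + t *\<^sub>R v) - f z)"
      using \<delta>(1) t by auto
  qed
  then show ?case by simp
qed

text \<open>The blow-up at each point provides a ball and a step size. Compactness covers a large
  ball by finitely many of these, hence with a common step size.\<close>

lemma annih_of_conic:
  assumes f: "quadrant_null f" "f \<in> borel_measurable borel" "\<And>z. \<bar>f z\<bar> \<le> M"
    and conic: "\<And>p. \<exists>r. conic_at (set vs) f p r"
    and vs: "vs \<noteq> []" "0 \<notin> set vs"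
    "\<And>v w. v \<in> set vs \<Longrightarrow> w \<in> set vs \<Longrightarrow> v \<noteq> w \<Longrightarrow> cross v w \<noteq> 0"
  shows "annih vs f"
proof (rule annih_of_local)
  fix N :: real
  define S where "S = (\<Sum>v\<leftarrow>vs. norm v)"
  have S: "0 \<le> S" unfolding S_def by (intro sum_list_nonneg) auto
  have "\<exists>\<rho> \<delta>. 0 < \<rho> \<and> 0 < \<delta> \<and> local_annih \<delta> (ball p \<rho>) vs f" for p
  proof -
    obtain r where c: "conic_at (set vs) f p r" using conic by blast
    have r: "0 < r" using c by (simp add: conic_at_def)
    have "annih vs (tangent f p r)"
    proof (rule conic_annih[OF conic_tangent[OF c] quadrant_null_tangent[OF f c] tangent_borel[OF f(2)] _ vs])
      show "\<bar>tangent f p r z\<bar> \<le> M" for z unfolding tangent_def by (rule f(3))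
    qed (use vs in auto)
    then have "annih vs (\<lambda>z. tangent f p r (z + - p))" by (rule annih_translate)
    moreover have "AE z in lborel. \<forall>v\<in>set vs. cross v (z + - p) \<noteq> 0"
      using vs by (intro AE_finite_allI AE_cross_neq) auto
    then have "AE z in lborel. z \<in> ball p r \<longrightarrow> f z = tangent f p r (z + - p)"
    proof eventually_elim
      fix z assume gen: "\<forall>v\<in>set vs. cross v (z + - p) \<noteq> 0"
      show "z \<in> ball p r \<longrightarrow> f z = tangent f p r (z + - p)"
        using tangent_eq[OF c, of "z + - p"] gen by (auto simp: dist_norm norm_minus_commute)
    qed
    \<comment> \<open>Half of the radius is reserved for the drift of the samples; the denominator
      \<open>1 + S\<close> is positive in any case.\<close>
    moreover have "r / 2 + (r / 2 / (1 + S)) * S \<le> r"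
    proof -
      have "r / 2 / (1 + S) * S \<le> r / 2 / (1 + S) * (1 + S)" using r S by (intro mult_left_mono) auto
      also have "\<dots> = r / 2"
      proof -
        have "r / 2 / J * J = r / 2" if "J \<noteq> 0" for J using that by simp
        from this[of "1 + S"] S show ?thesis by linarith
      qed
      finally show ?thesis by linarith
    qed
    ultimately have "local_annih (r / 2 / (1 + S)) (ball p (r / 2)) vs f"
      using r S unfolding S_def by (intro local_annih_of_annih) (auto simp: S_def[symmetric])
    then show ?thesis using r S by (intro exI[of _ "r / 2"] exI[of _ "r / 2 / (1 + S)"]) auto
  qed
  then obtain \<rho> \<delta> where rd: "\<And>p. 0 < \<rho> p" "\<And>p. 0 < \<delta> p" "\<And>p. local_annih (\<delta> p) (ball p (\<rho> p)) vs f"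
    by metis
  have "cball 0 N \<subseteq> (\<Union>p\<in>UNIV. ball p (\<rho> p))"
    using rd(1) by (auto intro: centre_in_ball[THEN iffD2])
  then obtain I where I: "finite I" "cball 0 N \<subseteq> (\<Union>p\<in>I. ball p (\<rho> p))"
    by (rule compactE_image[OF compact_cball, rotated]) auto
  define d where "d = Min (insert 1 (\<delta> ` I))"
  have d: "0 < d" "\<And>p. p \<in> I \<Longrightarrow> d \<le> \<delta> p"
    using I rd(2) by (auto simp: d_def)
  have "local_annih d (\<Union>p\<in>I. ball p (\<rho> p)) vs f"
    using d by (intro local_annih_UN I local_annih_mono[OF rd(3)]) auto
  then have "local_annih d (ball 0 N) vs f"
    using I(2) ball_subset_cball by (elim local_annih_mono) auto
  with d show "\<exists>\<delta>>0. local_annih \<delta> (ball 0 N) vs f" by blast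
qed

section \<open>Strips\<close>

lemma quadrant_null_cong_AE:
  assumes "quadrant_null f" and [measurable]: "f \<in> borel_measurable borel" "g \<in> borel_measurable borel"
    and eq: "AE z in lborel. f z = g z"
  shows "quadrant_null g"
  unfolding quadrant_null_def
proof (intro allI impI)
  fix \<tau> \<zeta> :: "real \<times> real" and \<epsilon> :: real
  assume \<epsilon>: "0 < \<epsilon>" "\<epsilon> < fst \<zeta>" "\<epsilon> < snd \<zeta>"
  have "(LINT x|lborel. of_real (g (x + \<tau>)) * packet \<epsilon> \<zeta> x)
      = (LINT x|lborel. of_real (f (x + \<tau>)) * packet \<epsilon> \<zeta> x)"
  proof (rule integral_cong_AE)
    show "AE x in lborel. of_real (g (x + \<tau>)) * packet \<epsilon> \<zeta> x = of_real (f (x + \<tau>)) * packet \<epsilon> \<zeta> x"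
      using AE_lborel_translate[OF eq, of \<tau>] by eventually_elim simp
  qed measurable
  with assms(1) \<epsilon> show "(LINT x|lborel. of_real (g (x + \<tau>)) * packet \<epsilon> \<zeta> x) = 0"
    unfolding quadrant_null_def by presburger
qed

lemma kernel_sq_eq: "(bump_kernel x)\<^sup>2 = of_real ((norm (bump_kernel x))\<^sup>2)"
  using complex_norm_square[of "bump_kernel x"] by (simp add: cnj_kernel power2_eq_square)

text \<open>The integrand is continuous, nonnegative and equal to 1 at 0. It is the squared plane
  kernel along a line through 0.\<close>

lemma kernel_sq_integral_pos:
  fixes c :: real
  defines "k \<equiv> \<lambda>y. (norm (bump_kernel (c * y)))\<^sup>2 * (norm (bump_kernel y))\<^sup>2"
  shows "integrable lborel k" "0 < (LINT y|lborel. k y)"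
proof -
  show i: "integrable lborel k"
  proof (rule Bochner_Integration.integrable_bound[OF kernel_integrable])
    have "(norm (bump_kernel (c * y)))\<^sup>2 * (norm (bump_kernel y))\<^sup>2 \<le> norm (bump_kernel y)" for y
    proof -
      have "(norm (bump_kernel (c * y)))\<^sup>2 * (norm (bump_kernel y))\<^sup>2 \<le> 1 * (norm (bump_kernel y) * 1)"
        unfolding power2_eq_square using norm_kernel_le_1 by (intro mult_mono mult_le_one) auto
      then show ?thesis by simp
    qed
    then show "AE y in lborel. norm (k y) \<le> norm (bump_kernel y)" by (simp add: k_def)
    show "k \<in> borel_measurable lborel" unfolding k_def by measurable
  qed
  have "(LINT y|lborel. k y) \<noteq> 0"
  proof
    assume "(LINT y|lborel. k y) = 0"
    then have 0: "AE y in lborel. k y = 0"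
      using integral_nonneg_eq_0_iff_AE[OF i] by (simp add: k_def)
    have "continuous_on UNIV k"
      unfolding k_def by (intro continuous_intros continuous_on_compose2[OF continuous_kernel[of UNIV]]) auto
    then have "open {y. k y \<noteq> 0}"
      by (intro open_Collect_neq) auto
    moreover have "0 \<in> {y. k y \<noteq> 0}" by (simp add: k_def kernel_0)
    moreover have "{y. k y \<noteq> 0} \<in> null_sets lebesgue"
    proof -
      have "AE y in lebesgue. k y = 0" using 0 by (simp add: AE_completion_iff)
      moreover have "{y. k y \<noteq> 0} \<in> sets lebesgue" using \<open>open _\<close> by simp
      ultimately show ?thesis using AE_iff_null_sets[of "{y. k y \<noteq> 0}" lebesgue] by simp
    qed
    ultimately show False
      using open_not_negligible[of "{y. k y \<noteq> 0}"] by (auto simp: negligible_iff_null_sets)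
  qed
  moreover have "0 \<le> (LINT y|lborel. k y)" by (intro integral_nonneg_AE) (simp add: k_def)
  ultimately show "0 < (LINT y|lborel. k y)" by linarith
qed

text \<open>Strips of negative slope have frequencies in the first quadrant. Contracting the strips by a
  factor \<open>\<epsilon>\<close> turns them, up to normalisation, into a multiple \<open>\<bar>E\<bar>\<close> of the
  line through 0, on which the squared kernel has a positive integral.\<close>

lemma negative_slope_null:
  assumes a: "0 < a" and b: "0 < b" and E [measurable]: "E \<in> sets borel" and fin: "emeasure lborel E < \<infinity>"
    and null: "quadrant_null (\<lambda>z. indicator E (- (a * snd z) - b * fst z))"
  shows "emeasure lborel E = 0"
proof -
  \<comment> \<open>The frequency \<open>(c * b, c * a)\<close> is normal to the strips, and both
    coordinates are at least 3, above the margin 2 that \<open>quadrant_null_square\<close> asks for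
    with a kernel of scale 1.\<close>
  define c where "c = 3 / min a b"
  define \<zeta> where "\<zeta> = (c * b, c * a)"
  have c: "0 < c" "2 < c * a" "2 < c * b" using a b by (auto simp: c_def min_def field_simps)
  let ?g = "\<lambda>z::real \<times> real. indicator E (- (a * snd z) - b * fst z) :: real"
  have "(\<lambda>z::real \<times> real. - (a * snd z) - b * fst z) \<in> borel_measurable borel"
    by (intro borel_measurable_continuous_onI continuous_intros)
  from measurable_compose[OF this borel_measurable_indicator[OF E]]
  have g [measurable]: "?g \<in> borel_measurable borel" .
  have intE: "integrable lborel (indicator E :: real \<Rightarrow> complex)"
  proof -
    have "integrable lborel (\<lambda>x. complex_of_real (indicator E x))"
      using fin by (intro integrable_of_real integrable_real_indicator) auto
    moreover have "(\<lambda>x. complex_of_real (indicator E x)) = indicator E"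
      by (auto simp: indicator_def)
    ultimately show ?thesis by (simp only:)
  qed
  \<comment> \<open>The integrand after solving \<open>\<epsilon> * w = - (a * y) - b * x\<close>
    for \<open>x\<close>. Now \<open>w\<close> runs through \<open>E\<close>, and the oscillation
    depends on \<open>w\<close> alone because the frequency is normal to the strips.\<close>
  define G where "G \<epsilon> w y = indicator E w * (cis (2 * pi * c * \<epsilon> * w) * ((bump_kernel (- (a / b) * y + (- (\<epsilon> / b)) * w))\<^sup>2 * (bump_kernel y)\<^sup>2))" for \<epsilon> w y
  have ik: "integrable (lborel \<Otimes>\<^sub>M lborel) (\<lambda>p. indicator E (fst p) * bump_kernel (snd p))"
    using lborel_integrable_product[OF intE kernel_integrable] by (simp add: lborel_prod)
  have [measurable]: "(\<lambda>p. G \<epsilon> (fst p) (snd p)) \<in> borel_measurable (lborel \<Otimes>\<^sub>M lborel)" for \<epsilon>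
  proof -
    have "(\<lambda>p. cis (2 * pi * c * \<epsilon> * fst p)) \<in> borel_measurable (borel :: (real \<times> real) measure)"
      by (intro borel_measurable_continuous_onI continuous_cis_compose continuous_intros)
    then have [measurable]: "(\<lambda>p. cis (2 * pi * c * \<epsilon> * fst p)) \<in> borel_measurable (lborel \<Otimes>\<^sub>M lborel :: (real \<times> real) measure)"
      by (simp add: lborel_prod)
    show ?thesis unfolding G_def by measurable
  qed
  have bound: "norm (G \<epsilon> w y) \<le> norm (indicator E w * bump_kernel y)" for \<epsilon> w y
  proof -
    have "(norm (bump_kernel x))\<^sup>2 * (norm (bump_kernel y))\<^sup>2 \<le> 1 * (norm (bump_kernel y) * 1)" for x
      unfolding power2_eq_square using norm_kernel_le_1 by (intro mult_mono mult_le_one) auto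
    then show ?thesis
      by (auto simp: G_def norm_mult norm_power indicator_def)
  qed
  have zero: "(LINT p|(lborel \<Otimes>\<^sub>M lborel). G \<epsilon> (fst p) (snd p)) = 0" if \<epsilon>: "0 < \<epsilon>" for \<epsilon>
  proof -
    have eq: "indicator E ((- (a * snd x) - b * fst x) / \<epsilon>) = ?g (0 + inverse \<epsilon> *\<^sub>R x)" for x
    proof -
      have "(- (a * snd x) - b * fst x) / \<epsilon> = - (a * snd (0 + inverse \<epsilon> *\<^sub>R x)) - b * fst (0 + inverse \<epsilon> *\<^sub>R x)"
        by (simp add: divide_inverse algebra_simps)
      then show ?thesis by (simp only:)
    qed
    have "quadrant_null (\<lambda>x. indicator E ((- (a * snd x) - b * fst x) / \<epsilon>))"
      unfolding eq using \<epsilon> by (intro quadrant_null_scale[OF null g]) simp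
    then have 1: "(LINT x|lborel. of_real (indicator E ((- (a * snd x) - b * fst x) / \<epsilon>)) * ((kernel2 (1 *\<^sub>R x))\<^sup>2 * wave \<zeta> x)) = 0"
    proof (rule quadrant_null_square[where M = 1])
      show "(\<lambda>x. indicator E ((- (a * snd x) - b * fst x) / \<epsilon>) :: real) \<in> borel_measurable borel"
        unfolding eq by (rule measurable_compose[OF _ g]) measurable
      show "\<bar>indicator E ((- (a * snd x) - b * fst x) / \<epsilon>) :: real\<bar> \<le> 1" for x
        by (simp add: indicator_def)
    qed (use c in \<open>simp_all add: \<zeta>_def\<close>)
    define F where "F x y = indicator E ((- (a * y) - b * x) / \<epsilon>) * (((bump_kernel x)\<^sup>2 * (bump_kernel y)\<^sup>2) * wave \<zeta> (x, y))" for x y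
    have F: "of_real (indicator E ((- (a * snd x) - b * fst x) / \<epsilon>)) * ((kernel2 (1 *\<^sub>R x))\<^sup>2 * wave \<zeta> x) = case_prod F x" for x
      by (simp add: F_def kernel2_def power_mult_distrib case_prod_beta' indicator_def)
    have "integrable (lborel \<Otimes>\<^sub>M lborel) (case_prod F)"
    proof (rule Bochner_Integration.integrable_bound)
      show "integrable (lborel \<Otimes>\<^sub>M lborel) (\<lambda>p. bump_kernel (fst p) * bump_kernel (snd p))"
        using lborel_integrable_product[OF kernel_integrable kernel_integrable] by (simp add: lborel_prod)
      have "(\<lambda>x. of_real (?g (0 + inverse \<epsilon> *\<^sub>R x)) * ((kernel2 (1 *\<^sub>R x))\<^sup>2 * wave \<zeta> x)) \<in> borel_measurable borel"
        by (intro borel_measurable_times borel_measurable_of_real measurable_compose[OF _ g]) measurable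
      then have "case_prod F \<in> borel_measurable borel"
        unfolding eq[symmetric] F by simp
      then show "case_prod F \<in> borel_measurable (lborel \<Otimes>\<^sub>M lborel)" by (simp add: lborel_prod)
      have "norm (bump_kernel x ^ 2) \<le> norm (bump_kernel x)" for x
        using mult_left_le[OF norm_kernel_le_1[of x], of "norm (bump_kernel x)"]
        by (simp add: power2_eq_square norm_mult)
      then have "norm (bump_kernel x ^ 2) * norm (bump_kernel y ^ 2) \<le> norm (bump_kernel x) * norm (bump_kernel y)" for x y
        by (intro mult_mono) auto
      then show "AE p in lborel \<Otimes>\<^sub>M lborel. norm (case_prod F p) \<le> norm (bump_kernel (fst p) * bump_kernel (snd p))"
        by (intro AE_I2) (auto simp: F_def norm_mult indicator_def case_prod_beta')
    qed
    from lborel_pair.integral_snd[OF this] have "(LINT y|lborel. LINT x|lborel. F x y) = 0"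
      using 1 unfolding F by (simp add: lborel_prod)
    moreover have "(LINT x|lborel. F x y) = \<bar>- (\<epsilon> / b)\<bar> *\<^sub>R (LINT w|lborel. G \<epsilon> w y)" for y
    proof -
      have "F (- (a / b) * y + (- (\<epsilon> / b)) * w) y = G \<epsilon> w y" for w
      proof -
        let ?x = "- (a / b) * y + (- (\<epsilon> / b)) * w"
        have x: "- (a * y) - b * ?x = \<epsilon> * w" using b by (simp add: algebra_simps)
        have "- 2 * pi * ((?x, y) \<bullet> \<zeta>) = 2 * pi * c * (- (a * y) - b * ?x)"
          by (simp add: \<zeta>_def algebra_simps)
        also have "\<dots> = 2 * pi * c * \<epsilon> * w" unfolding x by simp
        finally have "wave \<zeta> (?x, y) = cis (2 * pi * c * \<epsilon> * w)" by (simp only: wave_def)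
        then show ?thesis
          unfolding F_def G_def x using \<epsilon> by (simp add: mult_ac)
      qed
      then show ?thesis
        using lborel_integral_real_affine[of "- (\<epsilon> / b)" "\<lambda>x. F x y" "- (a / b) * y"] \<epsilon> b by simp
    qed
    ultimately have "(LINT y|lborel. LINT w|lborel. G \<epsilon> w y) = 0" using \<epsilon> b by simp
    moreover have "integrable (lborel \<Otimes>\<^sub>M lborel) (case_prod (G \<epsilon>))"
      using bound by (intro Bochner_Integration.integrable_bound[OF ik]) (auto simp: case_prod_beta')
    ultimately show ?thesis
      using lborel_pair.integral_snd[of "G \<epsilon>"] by (simp add: case_prod_beta')
  qed
  define X where "X n = inverse (real (Suc n))" for n
  have X: "X \<longlonglongrightarrow> 0" "\<And>n. 0 < X n"
    using LIMSEQ_inverse_real_of_nat by (simp_all add: X_def[abs_def])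
  \<comment> \<open>At scale 0 the variables separate, and the limit is the measure of
    \<open>E\<close> times the integral of the squared kernel along the line.\<close>
  have "(\<lambda>n. LINT p|(lborel \<Otimes>\<^sub>M lborel). G (X n) (fst p) (snd p)) \<longlonglongrightarrow> (LINT p|(lborel \<Otimes>\<^sub>M lborel). G 0 (fst p) (snd p))"
  proof (rule integral_dominated_convergence[where w = "\<lambda>p. norm (indicator E (fst p) * bump_kernel (snd p))"])
    show "integrable (lborel \<Otimes>\<^sub>M lborel) (\<lambda>p. norm (indicator E (fst p) * bump_kernel (snd p)))"
      using ik by (rule integrable_norm)
    show "AE p in lborel \<Otimes>\<^sub>M lborel. (\<lambda>n. G (X n) (fst p) (snd p)) \<longlonglongrightarrow> G 0 (fst p) (snd p)"
    proof (rule AE_I2)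
      fix p :: "real \<times> real"
      have cis: "(\<lambda>n. cis (2 * pi * c * X n * fst p)) \<longlonglongrightarrow> cis (2 * pi * c * 0 * fst p)"
        unfolding cis_conv_exp by (intro tendsto_intros X)
      have ker: "(\<lambda>n. bump_kernel (- (a / b) * snd p + (- (X n / b)) * fst p)) \<longlonglongrightarrow> bump_kernel (- (a / b) * snd p + (- (0 / b)) * fst p)"
        using b by (intro continuous_on_tendsto_compose[OF continuous_kernel[of UNIV]] tendsto_intros X) auto
      show "(\<lambda>n. G (X n) (fst p) (snd p)) \<longlonglongrightarrow> G 0 (fst p) (snd p)"
        unfolding G_def
        by (rule tendsto_mult[OF tendsto_const tendsto_mult[OF cis tendsto_mult[OF tendsto_power[OF ker] tendsto_const]]])
    qed
  qed (use bound in auto)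
  then have "(LINT p|(lborel \<Otimes>\<^sub>M lborel). G 0 (fst p) (snd p)) = 0"
    by (simp add: zero[OF X(2)] LIMSEQ_const_iff)
  moreover have "G 0 (fst p) (snd p) = indicator E (fst p) * of_real ((norm (bump_kernel (- (a / b) * snd p)))\<^sup>2 * (norm (bump_kernel (snd p)))\<^sup>2)" for p
    by (simp add: G_def kernel_sq_eq)
  ultimately have "(LINT p|lborel. indicator E (fst p) * complex_of_real ((norm (bump_kernel (- (a / b) * snd p)))\<^sup>2 * (norm (bump_kernel (snd p)))\<^sup>2)) = 0"
    by (simp only: lborel_prod)
  then have "(LINT w|lborel. indicator E w) * (LINT y|lborel. complex_of_real ((norm (bump_kernel (- (a / b) * y)))\<^sup>2 * (norm (bump_kernel y))\<^sup>2)) = 0"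
    by (subst (asm) lborel_integral_product[OF intE]) (simp_all only: kernel_sq_integral_pos integrable_of_real)
  moreover have "(LINT y|lborel. complex_of_real ((norm (bump_kernel (- (a / b) * y)))\<^sup>2 * (norm (bump_kernel y))\<^sup>2)) \<noteq> 0"
    unfolding integral_complex_of_real using kernel_sq_integral_pos(2)[of "- (a / b)"] by simp
  ultimately have "(LINT w|lborel. indicator E w :: complex) = 0" by simp
  moreover have "(LINT w|lborel. indicator E w :: complex) = of_real (LINT w|lborel. indicator E w)"
    unfolding integral_complex_of_real[symmetric]
    by (intro Bochner_Integration.integral_cong) (auto simp: indicator_def)
  moreover have "(LINT w|lborel. indicator E w :: real) = measure lborel E"
    by simp
  ultimately have "measure lborel E = 0" by simp
  then show ?thesis using fin by (auto simp: measure_def enn2real_eq_0_iff)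
qed

text \<open>The components are disjoint, so their lengths add up to the measure.\<close>

lemma open_real_countable_intervals:
  fixes E :: "real set"
  assumes "open E" "emeasure lborel E < \<infinity>"
  shows "\<exists>I :: nat \<Rightarrow> real set. (\<forall>n. is_interval (I n)) \<and> E = (\<Union>n. I n) \<and> (\<Sum>n. emeasure lebesgue (I n)) < \<infinity>"
proof -
  let ?C = "components E"
  have C: "countable ?C" 
    using pairwise_disjoint_components[of E] open_components[OF assms(1)]
    by (intro countable_disjoint_open_subsets) (auto simp: disjnt_def pairwise_def)
  \<comment> \<open>Each component sits at its number; an index that numbers no component gives the
    empty interval.\<close>
  define I where "I n = \<Union>{c \<in> ?C. to_nat_on ?C c = n}" for n
  have I: "I n = {} \<or> I n \<in> ?C" for n
  proof (cases "\<exists>c\<in>?C. to_nat_on ?C c = n")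
    case True
    then obtain c where c: "c \<in> ?C" "to_nat_on ?C c = n" by blast
    then have "{c \<in> ?C. to_nat_on ?C c = n} = {c}"
      using inj_on_to_nat_on[OF C] by (auto dest: inj_onD)
    with c show ?thesis by (simp add: I_def)
  qed (auto simp: I_def)
  have op: "open (I n)" for n
    using I[of n] open_components[OF assms(1)] by auto
  have UN: "(\<Union>n. I n) = E"
  proof -
    have "(\<Union>n. I n) = \<Union>?C" unfolding I_def by blast
    also have "\<dots> = E" by (metis Union_components)
    finally show ?thesis .
  qed
  have "disjoint_family I"
    unfolding disjoint_family_on_def
  proof (intro ballI impI)
    fix m n :: nat assume "m \<noteq> n"
    show "I m \<inter> I n = {}"
    proof (rule ccontr)
      assume "I m \<inter> I n \<noteq> {}"
      then obtain c d x where "c \<in> ?C" "d \<in> ?C" "to_nat_on ?C c = m" "to_nat_on ?C d = n" "x \<in> c" "x \<in> d"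
        by (auto simp: I_def)
      with \<open>m \<noteq> n\<close> components_nonoverlap[of c E d] show False by auto
    qed
  qed
  then have "(\<Sum>n. emeasure lebesgue (I n)) = emeasure lebesgue (\<Union>n. I n)"
    using op by (intro suminf_emeasure) auto
  also have "\<dots> = emeasure lborel E" unfolding UN using assms(1) by (simp add: emeasure_completion)
  finally have "(\<Sum>n. emeasure lebesgue (I n)) < \<infinity>" using assms(2) by simp
  moreover have "is_interval (I n)" for n
    using I[of n] in_components_connected by (auto simp: is_interval_connected_1)
  ultimately show ?thesis using UN by blast
qed

section \<open>Lines, their directions and the local shape of the boundary\<close>

lemma cross_decompose:
  assumes "cross v w \<noteq> 0"
  shows "z = (cross z w / cross v w) *\<^sub>R v + (cross v z / cross v w) *\<^sub>R w"
proof -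
  have "inverse (cross v w) *\<^sub>R (cross v w *\<^sub>R z) = inverse (cross v w) *\<^sub>R (cross z w *\<^sub>R v + cross v z *\<^sub>R w)"
    by (rule arg_cong[OF cross_expand])
  with assms show ?thesis by (simp add: scaleR_add_right divide_inverse mult.commute)
qed

lemma cross_eq_0D:
  assumes "v \<noteq> 0" "cross v z = 0"
  obtains t where "z = t *\<^sub>R v"
proof -
  define u where "u = (- snd v, fst v)"
  have "cross v u = (fst v)\<^sup>2 + (snd v)\<^sup>2" by (simp add: u_def cross_def power2_eq_square)
  moreover have "(fst v)\<^sup>2 + (snd v)\<^sup>2 \<noteq> 0" using assms(1) by (auto simp: prod_eq_iff sum_power2_eq_zero_iff)
  ultimately have "cross v u \<noteq> 0" by simp
  from cross_decompose[OF this, of z] assms(2) show ?thesis by (intro that) simp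
qed

lemma cross_borel [measurable]: "cross v \<in> borel_measurable borel"
  unfolding cross_def[abs_def] by (intro borel_measurable_continuous_onI continuous_intros)

lemma is_line_cross:
  assumes "is_line l"
  obtains p v where "v \<noteq> 0" "l = {z. cross v (z - p) = 0}"
    "line_direction l = {z. cross v z = 0}"
proof -
  obtain p v where v: "v \<noteq> 0" and l: "l = {p + t *\<^sub>R v | t. True}" using assms by (auto simp: is_line_def)
  have "l = {z. cross v (z - p) = 0}"
  proof (intro set_eqI iffI)
    fix z assume "z \<in> {z. cross v (z - p) = 0}"
    then obtain t where "z - p = t *\<^sub>R v" using cross_eq_0D[OF v] by blast
    then have "z = p + t *\<^sub>R v" by (simp add: algebra_simps)
    then show "z \<in> l" unfolding l by blast
  qed (auto simp: l cross_scale cross_self)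
  moreover have "line_direction l = {z. cross v z = 0}"
  proof (intro set_eqI iffI)
    fix z assume "z \<in> {z. cross v z = 0}"
    then obtain t where t: "z = t *\<^sub>R v" using cross_eq_0D[OF v] by blast
    have "z = (p + t *\<^sub>R v) - (p + 0 *\<^sub>R v)" by (simp add: t)
    then show "z \<in> line_direction l" unfolding line_direction_def l by blast
  next
    fix z assume "z \<in> line_direction l"
    then obtain t s where "z = (p + t *\<^sub>R v) - (p + s *\<^sub>R v)" unfolding line_direction_def l by blast
    then show "z \<in> {z. cross v z = 0}" by (simp only: mem_Collect_eq cross_diff cross_add cross_scale cross_self)
  qed
  ultimately show ?thesis using that v by blast
qed

lemma AE_not_in_line:
  assumes "is_line l"
  shows "AE z in lborel. z \<notin> l"
proof -
  obtain p v where "v \<noteq> 0" "l = {z. cross v (z - p) = 0}"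
    using is_line_cross[OF assms] by metis
  with AE_cross_neq[of v "- p"] show ?thesis by simp
qed

lemma closed_is_line:
  assumes "is_line l"
  shows "closed l"
proof -
  obtain p v where l: "l = {z. cross v (z - p) = 0}"
    using is_line_cross[OF assms] by metis
  show ?thesis unfolding l cross_def by (intro closed_Collect_eq continuous_intros)
qed

text \<open>Close to \<open>p\<close> only lines through \<open>p\<close> are met. A connected set
  that avoids their directions at \<open>p\<close> therefore avoids the frontier and lies inside or
  outside \<open>S\<close>.\<close>

lemma conic_at_interior:
  assumes lines: "\<And>l. l \<in> L \<Longrightarrow> is_line l" and fin: "locally_finite_lines L" and front: "frontier S \<subseteq> \<Union>L"
    and V: "\<And>l. l \<in> L \<Longrightarrow> \<exists>v\<in>V. \<forall>z\<in>line_direction l. cross v z = 0"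
  shows "\<exists>r. conic_at V (indicator (interior S)) p r"
proof -
  \<comment> \<open>The lines that meet the unit ball about \<open>p\<close> but miss
    \<open>p\<close>: finitely many closed sets, so a smaller ball avoids them all.\<close>
  define F where "F = {l \<in> L. l \<inter> cball p 1 \<noteq> {} \<and> p \<notin> l}"
  have F: "finite F"
  proof (rule finite_subset)
    show "F \<subseteq> {l \<in> L. l \<inter> cball p 1 \<noteq> {}}" by (auto simp: F_def)
    show "finite {l \<in> L. l \<inter> cball p 1 \<noteq> {}}" using fin unfolding locally_finite_lines_def by blast
  qed
  have "\<exists>d>0. \<forall>x\<in>l. d \<le> dist p x" if "l \<in> F" for l
    using that lines by (intro separate_point_closed closed_is_line) (auto simp: F_def)
  then obtain d where d: "\<And>l. l \<in> F \<Longrightarrow> 0 < d l" "\<And>l x. l \<in> F \<Longrightarrow> x \<in> l \<Longrightarrow> d l \<le> dist p x"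
    by metis
  define r where "r = Min (insert 1 (d ` F))"
  have r: "0 < r" "r \<le> 1" "\<And>l. l \<in> F \<Longrightarrow> r \<le> d l"
    using F d by (auto simp: r_def)
  have through: "p \<in> l" if "l \<in> L" "z \<in> l" "z \<in> ball p r" for l z
  proof (rule ccontr)
    assume "p \<notin> l"
    have "z \<in> cball p 1" using that(3) r by simp
    with \<open>p \<notin> l\<close> that have "l \<in> F" by (auto simp: F_def)
    from r(3)[OF this] d(2)[OF this that(2)] that(3) show False by simp
  qed
  have "conic_at V (indicator (interior S)) p r"
    unfolding conic_at_def
  proof (intro conjI allI impI ballI r)
    fix T y z assume T: "connected T" "T \<subseteq> ball p r" "\<forall>z\<in>T. \<forall>v\<in>V. cross v (z - p) \<noteq> 0" "y \<in> T" "z \<in> T"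
    have disj: "T \<inter> frontier S = {}"
    proof (rule ccontr)
      assume "T \<inter> frontier S \<noteq> {}"
      then obtain q l where q: "q \<in> T" "l \<in> L" "q \<in> l" using front by blast
      then have "p \<in> l" using through T(2) by blast
      with q have "q - p \<in> line_direction l" unfolding line_direction_def by blast
      with V[OF q(2)] T(3) q(1) show False by blast
    qed
    have "(y \<in> interior S) = (z \<in> interior S)"
    proof -
      have "T \<subseteq> S \<or> T \<inter> S = {}"
        using connected_Int_frontier[OF T(1), of S] disj by blast
      moreover have "w \<in> interior S \<longleftrightarrow> w \<in> S" if "w \<in> T" for w
        using that disj interior_subset[of S] closure_subset[of S] unfolding frontier_def by blast
      ultimately show ?thesis using T(4,5) by blast
    qed
    then show "indicator (interior S) y = (indicator (interior S) z :: real)"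
      by (simp add: indicator_def)
  qed
  then show ?thesis by blast
qed

text \<open>Horizontal lines are represented by \<open>(1, 0)\<close> outside the list, so that
  every listed direction is transversal to it; transferring thinness from the horizontal requires
  this.\<close>

lemma finite_directions:
  assumes "\<And>l. l \<in> L \<Longrightarrow> is_line l" "finite (line_direction ` L)"
  shows "\<exists>vs. distinct vs \<and> (\<forall>v\<in>set vs. snd v \<noteq> 0) \<and> (\<forall>v\<in>set vs. \<forall>w\<in>set vs. v \<noteq> w \<longrightarrow> cross v w \<noteq> 0) \<and>
    (\<forall>l\<in>L. \<exists>v\<in>set ((1, 0) # vs). \<forall>z\<in>line_direction l. cross v z = 0)"
proof -
  \<comment> \<open>The representative depends on the direction only, so different representatives
    are never parallel.\<close>
  define rep where "rep D = (SOME v. v \<noteq> 0 \<and> D = {z. cross v z = 0})" for D :: "(real \<times> real) set"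
  have rep: "rep D \<noteq> 0 \<and> D = {z. cross (rep D) z = 0}" if "D \<in> line_direction ` L" for D
  proof -
    have "\<exists>v. v \<noteq> 0 \<and> D = {z. cross v z = 0}"
      using that assms(1) is_line_cross by (metis imageE)
    then show ?thesis unfolding rep_def by (rule someI_ex)
  qed
  define V where "V = {v \<in> rep ` line_direction ` L. snd v \<noteq> 0}"
  have "finite V" using assms(2) by (simp add: V_def)
  then obtain vs where vs: "set vs = V" "distinct vs" using finite_distinct_list by blast
  have cross_trans: "cross w z = 0" if "cross v z = 0" "cross v w = 0" "v \<noteq> 0" for v w z
  proof -
    have "fst v * cross w z = fst w * cross v z - fst z * cross v w"
      "snd v * cross w z = snd w * cross v z - snd z * cross v w"
      by (simp_all add: cross_def algebra_simps)
    with that show ?thesis by (auto simp: prod_eq_iff)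
  qed
  show ?thesis
  proof (intro exI[of _ vs] conjI ballI impI vs(2))
    show "snd v \<noteq> 0" if "v \<in> set vs" for v using that vs by (simp add: V_def)
    show "cross v w \<noteq> 0" if vw: "v \<in> set vs" "w \<in> set vs" "v \<noteq> w" for v w
    proof
      assume 0: "cross v w = 0"
      obtain D1 D2 where D: "D1 \<in> line_direction ` L" "v = rep D1" "D2 \<in> line_direction ` L" "w = rep D2"
        using vw vs by (auto simp: V_def)
      have "{z. cross v z = 0} = {z. cross w z = 0}"
      proof -
        have "v \<noteq> 0" "w \<noteq> 0" using rep[OF D(1)] rep[OF D(3)] D by auto
        moreover have "cross w v = 0" using 0 cross_commute[of w v] by simp
        ultimately show ?thesis using cross_trans[OF _ 0] cross_trans[of w _ v] by blast
      qed
      with rep[OF D(1)] rep[OF D(3)] D have "D1 = D2" by metis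
      with D vw(3) show False by simp
    qed
    show "\<exists>v\<in>set ((1, 0) # vs). \<forall>z\<in>line_direction l. cross v z = 0" if l: "l \<in> L" for l
    proof (cases "snd (rep (line_direction l)) = 0")
      case True
      have r: "rep (line_direction l) \<noteq> 0" "line_direction l = {z. cross (rep (line_direction l)) z = 0}"
        using rep[of "line_direction l"] l by auto
      have "\<forall>z\<in>line_direction l. cross (1, 0) z = 0"
      proof
        fix z assume "z \<in> line_direction l"
        then have "cross (rep (line_direction l)) z = 0" using r(2) by blast
        moreover have "fst (rep (line_direction l)) \<noteq> 0" using True r(1) by (auto simp: prod_eq_iff)
        ultimately show "cross (1, 0) z = 0" using True by (simp add: cross_def)
      qed
      then show ?thesis by simp
    next
      case False
      then have "rep (line_direction l) \<in> set vs" using l vs by (auto simp: V_def)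
      moreover have "\<forall>z\<in>line_direction l. cross (rep (line_direction l)) z = 0"
        using rep[of "line_direction l"] l by blast
      ultimately show ?thesis by auto
    qed
  qed
qed

lemma sorted_wrt_pairwise:
  "distinct xs \<Longrightarrow> (\<And>x y. x \<in> set xs \<Longrightarrow> y \<in> set xs \<Longrightarrow> x \<noteq> y \<Longrightarrow> P x y) \<Longrightarrow> sorted_wrt P xs"
  by (induction xs) auto

lemma spans_over_cross:
  assumes "cross e v \<noteq> 0" "cross v w \<noteq> 0"
  shows "spans_over e v w"
proof -
  have "cross w v / cross e v \<noteq> 0"
    using assms cross_commute[of w v] by simp
  with cross_decompose[OF assms(1), of w] show ?thesis unfolding spans_over_def by blast
qed

text \<open>Rational translates of the open set \<open>U\<close> already fill the strips spanned by \<open>U\<close>.\<close>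

lemma invariant_open_strips:
  assumes U: "open U" and v: "v \<noteq> 0"
    and inv: "\<And>t. AE z in lborel. indicator U (z + t *\<^sub>R v) = (indicator U z :: real)"
  shows "AE z in lborel. z \<in> U \<longleftrightarrow> cross v z \<in> cross v ` U"
proof -
  have "AE z in lborel. \<forall>t\<in>\<rat>. indicator U (z + t *\<^sub>R v) = (indicator U z :: real)"
    using inv by (intro AE_ball_countable' countable_rat) auto
  then show ?thesis
  proof eventually_elim
    fix z assume rat: "\<forall>t\<in>\<rat>. indicator U (z + t *\<^sub>R v) = (indicator U z :: real)"
    show "z \<in> U \<longleftrightarrow> cross v z \<in> cross v ` U"
    proof
      assume "cross v z \<in> cross v ` U"
      then obtain y where y: "y \<in> U" "cross v (y - z) = 0" by (auto simp: cross_diff)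
      obtain t where "y - z = t *\<^sub>R v" using cross_eq_0D[OF v y(2)] .
      then have t: "y = z + t *\<^sub>R v" by (simp add: algebra_simps)
      have "open ((\<lambda>s. z + s *\<^sub>R v) -` U)"
        by (intro open_vimage U continuous_intros)
      moreover have "t \<in> (\<lambda>s. z + s *\<^sub>R v) -` U" using y t by simp
      ultimately obtain e where e: "e > 0" "ball t e \<subseteq> (\<lambda>s. z + s *\<^sub>R v) -` U"
        using open_contains_ball by blast
      obtain q where q: "q \<in> \<rat>" "t - e < q" "q < t + e"
        using Rats_dense_in_real[of "t - e" "t + e"] e(1) by auto
      then have "z + q *\<^sub>R v \<in> U" using e(2) by (auto simp: dist_real_def subset_iff)
      with rat q(1) show "z \<in> U" by (auto simp: indicator_def split: if_splits)
    qed blast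
  qed
qed

section \<open>Reduction to one direction and the sign of its slope\<close>

theorem theorem7:
  fixes S :: "(real \<times> real) set"
  assumes "S \<in> sets lebesgue"
    and "\<And>y. h_section S y \<in> lmeasurable"
    and "\<And>x. v_section S x \<in> lmeasurable"
    and "(SUP y. emeasure lebesgue (h_section S y)) < \<infinity>"
    and "double_Hilbert_fixed S"
    and "\<exists>L. countable L \<and> (\<forall>l\<in>L. is_line l) \<and> locally_finite_lines L \<and>
             finite (line_direction ` L) \<and> frontier S \<subseteq> \<Union>L"
  shows "\<exists>(\<alpha>::real) (\<beta>::real) (E::real set) (I::nat \<Rightarrow> real set).
           0 < \<alpha> \<and> 0 < \<beta> \<and>
           (\<forall>n. is_interval (I n)) \<and> E = (\<Union>n. I n) \<and>
           (\<Sum>n. emeasure lebesgue (I n)) < \<infinity> \<and>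
           sym_diff S {(x, y). \<alpha> * y - \<beta> * x \<in> E} \<in> null_sets lebesgue"
proof -
  obtain L where L: "countable L" "\<And>l. l \<in> L \<Longrightarrow> is_line l" "locally_finite_lines L"
    "finite (line_direction ` L)" "frontier S \<subseteq> \<Union>L"
    using assms(6) by blast
  define U where "U = interior S"
  define f :: "real \<times> real \<Rightarrow> real" where "f = indicator U"
  have U: "open U" "U \<subseteq> S" unfolding U_def by (auto simp: interior_subset)
  have [measurable]: "U \<in> sets borel" using U by simp
  have f [measurable]: "f \<in> borel_measurable borel" unfolding f_def by measurable
  have f1: "\<bar>f z\<bar> \<le> 1" for z by (simp add: f_def indicator_def)
  have "AE z in lborel. \<forall>l\<in>L. z \<notin> l"
    using L by (intro AE_ball_countable' AE_not_in_line) auto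
  then have SU: "AE z in lborel. z \<in> S \<longleftrightarrow> z \<in> U"
  proof eventually_elim
    fix z assume "\<forall>l\<in>L. z \<notin> l"
    then have "z \<notin> frontier S" using L(5) by blast
    then show "z \<in> S \<longleftrightarrow> z \<in> U"
      using closure_subset[of S] interior_subset[of S] by (auto simp: frontier_def U_def)
  qed
  then have SU': "AE z in lebesgue. z \<in> S \<longleftrightarrow> z \<in> U" by (rule AE_completion)
  have null: "quadrant_null f"
    by (rule double_Hilbert_fixed_quadrant_null[OF assms(1,5) f f1])
       (use SU' in \<open>eventually_elim, auto simp: f_def indicator_def\<close>)
  obtain vs where vs: "distinct vs" "\<And>v. v \<in> set vs \<Longrightarrow> snd v \<noteq> 0"
    "\<And>v w. v \<in> set vs \<Longrightarrow> w \<in> set vs \<Longrightarrow> v \<noteq> w \<Longrightarrow> cross v w \<noteq> 0"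
    "\<And>l. l \<in> L \<Longrightarrow> \<exists>v\<in>set ((1, 0) # vs). \<forall>z\<in>line_direction l. cross v z = 0"
    using finite_directions[OF L(2,4)] by blast
  \<comment> \<open>The direction in which the sections are bounded. It heads the list so that
    horizontal boundary lines are covered as well.\<close>
  define e :: "real \<times> real" where "e = (1, 0)"
  have ev: "cross e v \<noteq> 0" "cross v e \<noteq> 0" if "v \<in> set vs" for v
    using vs(2)[OF that] by (auto simp: cross_def e_def)
  have annih: "annih (e # vs) f"
  proof (rule annih_of_conic[OF null f f1])
    show "\<exists>r. conic_at (set (e # vs)) f p r" for p
      unfolding f_def U_def e_def by (rule conic_at_interior[OF L(2,3,5) vs(4)])
    show "0 \<notin> set (e # vs)" using vs(2)[of 0] by (auto simp: e_def zero_prod_def)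
    show "cross v w \<noteq> 0" if "v \<in> set (e # vs)" "w \<in> set (e # vs)" "v \<noteq> w" for v w
      using that vs(3)[of v w] ev[of v] ev[of w] by auto
  qed simp

  define C where "C = enn2real (SUP y. emeasure lebesgue (h_section S y))"
  have Ub: "{x. (x, y) \<in> U} \<in> sets borel" "{y. (x, y) \<in> U} \<in> sets borel" for x y
    by (intro sets_Collect_borel, measurable)+
  have hC: "emeasure lborel {x. (x, y) \<in> U} \<le> ennreal C" for y
  proof -
    have "emeasure lborel {x. (x, y) \<in> U} = emeasure lebesgue {x. (x, y) \<in> U}"
      using Ub by (simp add: emeasure_completion)
    also have "\<dots> \<le> emeasure lebesgue (h_section S y)"
      using U(2) assms(2)[of y] by (intro emeasure_mono) (auto simp: h_section_def fmeasurable_def)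
    also have "\<dots> \<le> (SUP y. emeasure lebesgue (h_section S y))" by (intro SUP_upper) simp
    also have "\<dots> = ennreal C" using assms(4) by (simp add: C_def)
    finally show ?thesis .
  qed
  have C: "0 \<le> C" by (simp add: C_def)
  have thin: "thin e C f"
    unfolding thin_def
  proof (intro AE_I2)
    fix z :: "real \<times> real"
    have "{r::real. f (z + r *\<^sub>R e) \<noteq> 0} = {r. (fst z + 1 * r, snd z) \<in> U}"
      by (auto simp: f_def e_def indicator_def plus_prod_def)
    moreover have "Measurable.pred borel (\<lambda>x. (x, snd z) \<in> U)" by measurable
    ultimately show "off_level f z e 0 \<le> ennreal C"
      using emeasure_lborel_affine_Collect[of "\<lambda>x. (x, snd z) \<in> U" 1 "fst z"] hC[of "snd z"] by simp
  qed
  \<comment> \<open>On a horizontal line \<open>f\<close> is 0 off a set of finite measure, so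
    \<open>f z - f (z + s *\<^sub>R e)\<close> equals \<open>f z\<close> for all other
    \<open>s\<close>, and the direction \<open>e\<close> drops out.\<close>
  have "annih vs f"
  proof (rule annih_limit[where G = "\<lambda>z s. f z - f (z + s *\<^sub>R e)"])
    show "annih vs (\<lambda>z. f z - f (z + s *\<^sub>R e))" for s
      using annih annih_minus[of vs "\<lambda>z. f (z + s *\<^sub>R e) - f z"] by simp
    show "AE z in lborel. emeasure lborel {s. f z \<noteq> f z - f (z + s *\<^sub>R e)} < \<infinity>"
      using thin unfolding thin_def by eventually_elim (auto intro: le_less_trans)
  qed measurable
  moreover have "directions e vs"
    using vs(1,3) ev by (intro sorted_wrt_pairwise) (auto intro!: spans_over_cross)
  moreover have "sorted_wrt (\<lambda>v w. \<forall>u. \<exists>t s. u = t *\<^sub>R w + s *\<^sub>R v) vs"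
  proof (intro sorted_wrt_pairwise vs(1) allI)
    fix v w u assume "v \<in> set vs" "w \<in> set vs" "v \<noteq> w"
    then have "cross v w \<noteq> 0" by (rule vs(3))
    from cross_decompose[OF this, of u] have "u = (cross v u / cross v w) *\<^sub>R w + (cross u w / cross v w) *\<^sub>R v"
      by (simp only: add.commute)
    then show "\<exists>t s. u = t *\<^sub>R w + s *\<^sub>R v" by blast
  qed
  moreover have "AE z in lborel. f z \<in> {0, 1}" by (simp add: f_def indicator_def)
  ultimately consider "AE z in lborel. f z = 0" | v where "v \<in> set vs" "\<And>t. AE z in lborel. f (z + t *\<^sub>R v) = f z"
    using zero_one_annihilated[OF _ f f1 C thin, of vs] by blast
  then show ?thesis
  proof cases
    case 1
    with SU have "AE z in lborel. z \<notin> S"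
      by eventually_elim (auto simp: f_def indicator_def split: if_splits)
    then have "AE z in lebesgue. z \<notin> S" by (rule AE_completion)
    then have "S \<in> null_sets lebesgue" using AE_iff_null_sets[OF assms(1)] by simp
    \<comment> \<open>\<open>S\<close> is null: the empty union of strips, with slope 1 as a
      filler.\<close>
    then show ?thesis
      by (intro exI[of _ 1] exI[of _ "{}"] exI[of _ "\<lambda>_. {}"]) simp
  next
    case (2 v0)
    \<comment> \<open>With \<open>v\<close> pointing upwards, the sign of \<open>fst v\<close> is
      the sign of the slope.\<close>
    define v where "v = sgn (snd v0) *\<^sub>R v0"
    have v: "0 < snd v" using vs(2)[OF 2(1)] by (simp add: v_def sgn_mult_self_eq mult_sgn_abs sgn_if)
    have inv: "AE z in lborel. f (z + t *\<^sub>R v) = f z" for t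
      using 2(2)[of "t * sgn (snd v0)"] by (simp add: v_def)
    define E where "E = cross v ` U"
    have strip: "AE z in lborel. z \<in> U \<longleftrightarrow> cross v z \<in> E"
      unfolding E_def using v inv by (intro invariant_open_strips U) (auto simp: f_def)
    have E: "open E"
    proof -
      have "linear (cross v)" by (intro linearI) (simp_all add: cross_add cross_scale)
      moreover have "surj (cross v)"
      proof (rule surjI)
        show "cross v (- (r / snd v), 0) = r" for r using v by (simp add: cross_def)
      qed
      ultimately show ?thesis unfolding E_def by (intro open_surjective_linear_image U)
    qed
    have [measurable]: "E \<in> sets borel" using E by simp
    have strip2: "AE x in lborel. AE y in lborel. (x, y) \<in> U \<longleftrightarrow> cross v (x, y) \<in> E"
    proof (rule lborel_pair.AE_pair)
      show "AE z in lborel \<Otimes>\<^sub>M lborel. z \<in> U \<longleftrightarrow> cross v z \<in> E"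
        unfolding lborel_prod by (rule strip)
    qed
    have [measurable]: "(\<lambda>x. cross v (fst x, snd x)) \<in> borel_measurable (borel \<Otimes>\<^sub>M borel)"
      unfolding cross_def by measurable
    have strip3: "AE y in lborel. AE x in lborel. (x, y) \<in> U \<longleftrightarrow> cross v (x, y) \<in> E"
    proof -
      have "{z \<in> space (lborel \<Otimes>\<^sub>M lborel). (fst z, snd z) \<in> U \<longleftrightarrow> cross v (fst z, snd z) \<in> E} \<in> sets (lborel \<Otimes>\<^sub>M lborel)"
        by measurable
      from lborel_pair.AE_commute[OF this] strip2 show ?thesis by simp
    qed
    \<comment> \<open>Almost every horizontal line meets \<open>U\<close>, up to a null set, in an
      affine copy of \<open>E\<close> scaled by \<open>1 / snd v\<close>; one such line bounds the
      measure of \<open>E\<close>.\<close>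
    have finE: "emeasure lborel E < \<infinity>"
    proof -
      have "\<exists>y. AE x in lborel. (x, y) \<in> U \<longleftrightarrow> cross v (x, y) \<in> E"
        using AE_ex_not_in_finite_measure[OF strip3, of "{}"] by auto
      then obtain y where y: "AE x in lborel. (x, y) \<in> U \<longleftrightarrow> cross v (x, y) \<in> E" by blast
      have cr: "cross v (x, y) = fst v * y + (- snd v) * x" for x by (simp add: cross_def)
      have m: "Measurable.pred borel (\<lambda>w. w \<in> E)" by measurable
      have "{x. fst v * y + (- snd v) * x \<in> E} \<in> sets borel"
        by (intro sets_Collect_borel) measurable
      then have "emeasure lborel {x. fst v * y + (- snd v) * x \<in> E} = emeasure lborel {x. (x, y) \<in> U}"
        using y Ub(1)[of y] unfolding cr by (intro emeasure_eq_AE) (auto elim!: eventually_mono)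
      also have "\<dots> \<le> ennreal C" by (rule hC)
      finally have "emeasure lborel E \<le> ennreal \<bar>- snd v\<bar> * ennreal C"
        using emeasure_lborel_affine_Collect[OF m, of "- snd v" "fst v * y"] v
        by (simp add: mult_left_mono)
      also have "\<dots> < \<infinity>" by (simp add: ennreal_mult_less_top)
      finally show ?thesis .
    qed
    \<comment> \<open>\<open>E\<close> is open, so measure 0 makes it empty, and \<open>U\<close>
      with it.\<close>
    have Enull: "f = (\<lambda>_. 0)" if "emeasure lborel E = 0"
    proof -
      have "E = {}"
      proof (rule ccontr)
        assume "E \<noteq> {}"
        then have "\<not> negligible E" using open_not_negligible[OF E] by blast
        moreover have "E \<in> null_sets lebesgue" using that by (intro null_sets_completionI) auto
        ultimately show False by (simp add: negligible_iff_null_sets)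
      qed
      then show ?thesis by (auto simp: f_def E_def)
    qed
    show ?thesis
    proof (cases "0 < fst v")
      case True
      obtain I where I: "\<forall>n. is_interval (I n)" "E = (\<Union>n. I n)" "(\<Sum>n. emeasure lebesgue (I n)) < \<infinity>"
        using open_real_countable_intervals[OF E finE] by (auto simp del: infinity_ennreal_def)
      have eq: "{(x, y). fst v * y - snd v * x \<in> E} = {z. cross v z \<in> E}"
        by (auto simp: cross_def)
      have cb: "{z. cross v z \<in> E} \<in> sets lborel"
        by (intro sets_Collect_lborel) measurable
      have "AE z in lborel. z \<notin> sym_diff S {z. cross v z \<in> E}"
        using SU strip by eventually_elim auto
      then have "AE z in lebesgue. z \<notin> sym_diff S {z. cross v z \<in> E}" by (rule AE_completion)
      moreover have "sym_diff S {z. cross v z \<in> E} \<in> sets lebesgue"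
        using cb assms(1) by (intro sets.Un sets.Diff) auto
      ultimately have "sym_diff S {(x, y). fst v * y - snd v * x \<in> E} \<in> null_sets lebesgue"
        unfolding eq using AE_iff_null_sets by blast
      with I True v show ?thesis by blast
    next
      case False
      have "emeasure lborel E = 0"
      proof (cases "fst v = 0")
        case True
        show ?thesis
        proof (rule ccontr)
          assume "emeasure lborel E \<noteq> 0"
          have "\<not> (AE x in lborel. - snd v * x \<notin> E)"
          proof
            assume "AE x in lborel. - snd v * x \<notin> E"
            from AE_borel_affine[OF _ _ this, of "- inverse (snd v)" 0] v
            have "AE x in lborel. x \<notin> E" by (simp flip: mult.assoc)
            then have "emeasure lborel E = 0" using AE_iff_null_sets[of E lborel] by auto
            with \<open>emeasure lborel E \<noteq> 0\<close> show False by simp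
          qed
          \<comment> \<open>Here \<open>v\<close> is vertical and \<open>cross v (x, y)\<close> does
            not depend on \<open>y\<close>. A value in \<open>E\<close> would put almost the whole
            vertical line over \<open>x\<close> into \<open>U\<close>, against the finite vertical
            section.\<close>
          moreover have "AE x in lborel. - snd v * x \<notin> E"
            using strip2
          proof eventually_elim
            fix x assume x: "AE y in lborel. (x, y) \<in> U \<longleftrightarrow> cross v (x, y) \<in> E"
            show "- snd v * x \<notin> E"
            proof
              assume "- snd v * x \<in> E"
              then have "AE y in lborel. (x, y) \<in> U" using x True by (simp add: cross_def)
              then have "emeasure lborel {y. (x, y) \<in> U} = emeasure lborel (UNIV :: real set)"
                using Ub(2)[of x] by (intro emeasure_eq_AE) auto
              then have "emeasure lebesgue {y. (x, y) \<in> U} = \<infinity>"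
                using Ub(2)[of x] by (simp add: emeasure_completion)
              moreover have "emeasure lebesgue {y. (x, y) \<in> U} \<le> emeasure lebesgue (v_section S x)"
                using U(2) assms(3)[of x] by (intro emeasure_mono) (auto simp: v_section_def fmeasurable_def)
              moreover have "emeasure lebesgue (v_section S x) < \<infinity>"
                using assms(3)[of x] unfolding fmeasurable_def by blast
              ultimately show False by simp
            qed
          qed
          ultimately show False by blast
        qed
      next
        case neq: False
        \<comment> \<open>Negative slope: with \<open>- fst v\<close> and \<open>snd v\<close>, both
          positive, as \<open>a\<close> and \<open>b\<close>, the level function
          \<open>cross v z\<close> has the form treated in
          \<open>negative_slope_null\<close>.\<close>
        have "quadrant_null (\<lambda>z. indicator E (- ((- fst v) * snd z) - snd v * fst z))"
        proof (rule quadrant_null_cong_AE[OF null f])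
          have eq: "- ((- fst v) * snd z) - snd v * fst z = cross v z" for z by (simp add: cross_def)
          show "(\<lambda>z. indicator E (- ((- fst v) * snd z) - snd v * fst z) :: real) \<in> borel_measurable borel"
            unfolding eq by measurable
          show "AE z in lborel. f z = indicator E (- ((- fst v) * snd z) - snd v * fst z)"
            unfolding eq using strip by eventually_elim (simp add: f_def indicator_def)
        qed
        then show ?thesis
          using False neq v finE by (intro negative_slope_null[of "- fst v" "snd v"]) auto
      qed
      then have "f = (\<lambda>_. 0)" by (rule Enull)
      then have "AE z in lborel. z \<notin> S"
        using SU by (auto simp: f_def indicator_def fun_eq_iff split: if_splits elim!: eventually_mono)
      then have "AE z in lebesgue. z \<notin> S" by (rule AE_completion)
      then have "S \<in> null_sets lebesgue" using AE_iff_null_sets[OF assms(1)] by simp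
      then show ?thesis
        by (intro exI[of _ 1] exI[of _ "{}"] exI[of _ "\<lambda>_. {}"]) simp
    qed
  qed
qed

end
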